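(* Let $G$ be a finite group acting faithfully on smooth projective curves $C_1,C_2$ of genus at least $2$, and diagonally on $C_1\times C_2$. Let $\chi$ be a character of $G$ of degree $1$. Then $$\left(H^{1,0}(C_1)^\chi\otimes H^{1,0}(C_2)^{\overline{\chi}}\right)^G=H^{1,0}(C_1)^\chi\otimes H^{1,0}(C_2)^{\overline{\chi}},$$ and the (schematic) base locus of its associated linear subsystem $\left(|K_{C_1}|^\chi\otimes |K_{C_2}|^{\overline{\chi}}\right)^G=|K_{C_1}|^\chi\otimes |K_{C_2}|^{\overline{\chi}}$ is given by $$\sum_{q\in \mathrm{Crit}(\lambda_1)} t_q^\chi R_q^{vert}+\sum_{l\in \mathrm{Crit}(\lambda_2)}t_l^{\overline{\chi}}R_l^{hor}.$$ Assume furthermore that $C_i/G\cong\mathbb P^1$ for $i=1,2$. Then the $t_q^\chi$ and $t_l^{\overline\chi}$ in this formula are the unique non-negative integers with $0\le t_q^\chi\le m_q-1$ and $0\le t_l^{\overline\chi}\le m_l-1$ satisfying $$\chi(h)=e^{\frac{2\pi i}{m_q}(m_q-t_q^\chi-1)}\qquad\text{and}\qquad \chi(g)=e^{\frac{2\pi i}{m_l}(t_l^{\overline\chi}+1)},$$ where $h$ is the local monodromy of a point of $C_1$ over $q$ and $g$ is the local monodromy of a point of $C_2$ over $l$.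
   Context: $\lambda_i\colon C_i\to C_i/G$ denotes the quotient map and $\mathrm{Crit}(\lambda_i)\subset C_i/G$ its set of branch points. $G$ acts on $H^{1,0}(C_i)$ by the canonical representation $g\cdot\omega=(g^{-1})^*\omega$. For an irreducible character $\chi$, $H^{1,0}(C_i)^\chi$ is the isotypic component of character $\chi$ and $|K_{C_i}|^\chi$ is the corresponding linear subsystem of $|K_{C_i}|$. $|K_{C_1}|^\chi\otimes|K_{C_2}|^{\overline\chi}$ and $(|K_{C_1}|^\chi\otimes|K_{C_2}|^{\overline\chi})^G$ are the linear subsystems of $|K_{C_1\times C_2}|$ given by $H^{1,0}(C_1)^\chi\otimes H^{1,0}(C_2)^{\overline\chi}$ and its $G$-invariant subspace, viewed in $H^{2,0}(C_1\times C_2)$. For $q\in C_1/G$, $m_q$ is the order of the stabilizer of any point of $C_1$ over $q$ (similarly $m_l$ for $l\in C_2/G$). For a point $p$ with stabilizer of order $m$, the local monodromy of $p$ is the unique generator of $\mathrm{Stab}(p)$ acting as $z\mapsto e^{2\pi i/m}z$ in a suitable local coordinate $z$ at $p$. $t_q^\chi$ (resp. $t_l^{\overline\chi}$) is the minimal vanishing order of a form in $H^{1,0}(C_1)^\chi$ (resp. $H^{1,0}(C_2)^{\overline\chi}$) at a point over $q$ (resp. over $l$); it does not depend on the chosen point in the fibre. $R_q^{vert}$ and $R_l^{hor}$ are the reduced inverse images in $C_1\times C_2$ of $\{q\}\times C_2/G$ and $C_1/G\times\{l\}$, i.e. $R_q^{vert}=\lambda_1^{-1}(q)\times C_2$ and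 $R_l^{hor}=C_1\times\lambda_2^{-1}(l)$ with reduced structure.
   Formalization: Unless both C_i/G are P^1, the base locus sum also includes non-branch points q, l with t_q, t_l non-zero (an étale double cover of a genus 2 curve refutes the original); claims involving t_q or t_l assume the isotypic spaces concerned are non-zero, as these numbers are otherwise undefined. *)

theory Defs
  imports
    "HOL-Complex_Analysis.Complex_Analysis"
    "HOL-Algebra.Group_Action"
    "HOL-Algebra.Generated_Groups"
    "HOL-Library.Function_Algebras"
    "HOL-Library.Multiset"
begin

section \<open>Riemann surfaces\<close>

text \<open>A chart is a pair of its domain and its coordinate function; only the values on the
  domain matter.  The atlas is not required to be maximal.\<close>

type_synonym 'a chart = "'a set \<times> ('a \<Rightarrow> complex)"

record 'a surface =
  topol :: "'a topology"
  atlas :: "'a chart set"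

abbreviation points :: "'a surface \<Rightarrow> 'a set" where
  "points X \<equiv> topspace (topol X)"

definition chart_inv :: "'a chart \<Rightarrow> complex \<Rightarrow> 'a" where
  "chart_inv c = inv_into (fst c) (snd c)"

definition is_chart :: "'a topology \<Rightarrow> 'a chart \<Rightarrow> bool" where
  "is_chart T c \<longleftrightarrow>
     openin T (fst c) \<and> open (snd c ` fst c) \<and>
     homeomorphic_map (subtopology T (fst c)) (top_of_set (snd c ` fst c)) (snd c)"

definition compatible :: "'a chart \<Rightarrow> 'a chart \<Rightarrow> bool" where
  "compatible c d \<longleftrightarrow>
     (snd d \<circ> chart_inv c) holomorphic_on (snd c ` (fst c \<inter> fst d)) \<and>
     (snd c \<circ> chart_inv d) holomorphic_on (snd d ` (fst c \<inter> fst d))"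

definition riemann_surface :: "'a surface \<Rightarrow> bool" where
  "riemann_surface X \<longleftrightarrow>
     Hausdorff_space (topol X) \<and> connected_space (topol X) \<and> points X \<noteq> {} \<and>
     (\<forall>c\<in>atlas X. is_chart (topol X) c) \<and>
     (\<forall>c\<in>atlas X. \<forall>d\<in>atlas X. compatible c d) \<and>
     (\<Union>c\<in>atlas X. fst c) = points X"

text \<open>Smooth projective complex curves (connected), as compact Riemann surfaces.\<close>

definition smooth_projective_curve :: "'a surface \<Rightarrow> bool" where
  "smooth_projective_curve X \<longleftrightarrow> riemann_surface X \<and> compact_space (topol X)"

definition local_coordinate :: "'a surface \<Rightarrow> 'a \<Rightarrow> 'a chart \<Rightarrow> bool" where
  "local_coordinate X p z \<longleftrightarrow>
     is_chart (topol X) z \<and> p \<in> fst z \<and> (\<forall>c\<in>atlas X. compatible c z)"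

definition holomorphic_map :: "'a surface \<Rightarrow> 'b surface \<Rightarrow> ('a \<Rightarrow> 'b) \<Rightarrow> bool" where
  "holomorphic_map X Y f \<longleftrightarrow>
     continuous_map (topol X) (topol Y) f \<and>
     (\<forall>c\<in>atlas X. \<forall>d\<in>atlas Y.
        (snd d \<circ> f \<circ> chart_inv c) holomorphic_on (snd c ` {x \<in> fst c. f x \<in> fst d}))"

definition holomorphic_function :: "'a surface \<Rightarrow> 'a set \<Rightarrow> ('a \<Rightarrow> complex) \<Rightarrow> bool" where
  "holomorphic_function X U f \<longleftrightarrow>
     (\<forall>c\<in>atlas X. (f \<circ> chart_inv c) holomorphic_on (snd c ` (fst c \<inter> U)))"

definition biholomorphic :: "'a surface \<Rightarrow> 'b surface \<Rightarrow> bool" where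
  "biholomorphic X Y \<longleftrightarrow>
     (\<exists>f g. holomorphic_map X Y f \<and> holomorphic_map Y X g \<and>
            (\<forall>x\<in>points X. g (f x) = x) \<and> (\<forall>y\<in>points Y. f (g y) = y))"

text \<open>The projective line, with \<open>None\<close> the point at infinity.\<close>

definition projective_line :: "complex option surface" where
  "projective_line =
     \<lparr> topol = Alexandroff_compactification euclidean,
       atlas = { (range Some, the),
                 (UNIV - {Some 0}, \<lambda>z. case z of None \<Rightarrow> 0 | Some w \<Rightarrow> inverse w) } \<rparr>"

definition branch_points :: "'a surface \<Rightarrow> 'b surface \<Rightarrow> ('a \<Rightarrow> 'b) \<Rightarrow> 'b set" where
  "branch_points X Y f =
     f ` {x \<in> points X. \<exists>c\<in>atlas X. \<exists>d\<in>atlas Y. x \<in> fst c \<and> f x \<in> fst d \<and>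
                          deriv (snd d \<circ> f \<circ> chart_inv c) (snd c x) = 0}"

section \<open>Holomorphic one-forms\<close>

text \<open>Complex-valued functions as a complex vector space (addition is pointwise).\<close>

global_interpretation cfun: vector_space "\<lambda>(c::complex) (f::'i \<Rightarrow> complex) i. c * f i"
  by unfold_locales (auto simp: fun_eq_iff algebra_simps)

text \<open>A one-form \<open>\<omega>\<close> is given by its coefficients: \<open>\<omega> (c, p)\<close> is the coefficient of
  \<open>d(snd c)\<close> in \<open>\<omega>\<close> at \<open>p\<close>.  Coefficients are \<open>0\<close> where they are meaningless, so that equality
  of forms is equality of functions.\<close>

type_synonym 'a oneform = "'a chart \<times> 'a \<Rightarrow> complex"

definition H10 :: "'a surface \<Rightarrow> 'a oneform set" where
  "H10 X = {\<omega>.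
     (\<forall>c p. \<not> (c \<in> atlas X \<and> p \<in> fst c) \<longrightarrow> \<omega> (c, p) = 0) \<and>
     (\<forall>c\<in>atlas X. (\<lambda>z. \<omega> (c, chart_inv c z)) holomorphic_on (snd c ` fst c)) \<and>
     (\<forall>c\<in>atlas X. \<forall>d\<in>atlas X. \<forall>p \<in> fst c \<inter> fst d.
        \<omega> (c, p) = \<omega> (d, p) * deriv (snd d \<circ> chart_inv c) (snd c p))}"

definition genus :: "'a surface \<Rightarrow> nat" where
  "genus X = cfun.dim (H10 X)"

definition chart_at :: "'a surface \<Rightarrow> 'a \<Rightarrow> 'a chart" where
  "chart_at X p = (SOME c. c \<in> atlas X \<and> p \<in> fst c)"

text \<open>By the transformation rule of one-forms, the chart chosen at the image point is immaterial.\<close>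

definition pullback :: "'a surface \<Rightarrow> 'b surface \<Rightarrow> ('a \<Rightarrow> 'b) \<Rightarrow> 'b oneform \<Rightarrow> 'a oneform" where
  "pullback X Y f \<omega> = (\<lambda>(c, p).
     if c \<in> atlas X \<and> p \<in> fst c
     then \<omega> (chart_at Y (f p), f p) * deriv (snd (chart_at Y (f p)) \<circ> f \<circ> chart_inv c) (snd c p)
     else 0)"

definition has_vanishing_order :: "'a surface \<Rightarrow> 'a oneform \<Rightarrow> 'a \<Rightarrow> nat \<Rightarrow> bool" where
  "has_vanishing_order X \<omega> p n \<longleftrightarrow>
     (\<exists>c\<in>atlas X. p \<in> fst c \<and> zorder (\<lambda>z. \<omega> (c, chart_inv c z)) (snd c p) = int n)"

section \<open>Characters and isotypic components\<close>

definition degree_one_character :: "('g, 'm) monoid_scheme \<Rightarrow> ('g \<Rightarrow> complex) \<Rightarrow> bool" where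
  "degree_one_character G chi \<longleftrightarrow>
     (\<forall>g\<in>carrier G. chi g \<noteq> 0) \<and>
     (\<forall>g\<in>carrier G. \<forall>h\<in>carrier G. chi (g \<otimes>\<^bsub>G\<^esub> h) = chi g * chi h)"

definition invariant_subspace ::
  "('g, 'm) monoid_scheme \<Rightarrow> ('g \<Rightarrow> ('i \<Rightarrow> complex) \<Rightarrow> ('i \<Rightarrow> complex)) \<Rightarrow> ('i \<Rightarrow> complex) set \<Rightarrow> bool"
  where
  "invariant_subspace G \<rho> W \<longleftrightarrow> cfun.subspace W \<and> (\<forall>g\<in>carrier G. \<rho> g ` W \<subseteq> W)"

definition irreducible_subspace ::
  "('g, 'm) monoid_scheme \<Rightarrow> ('g \<Rightarrow> ('i \<Rightarrow> complex) \<Rightarrow> ('i \<Rightarrow> complex)) \<Rightarrow> ('i \<Rightarrow> complex) set \<Rightarrow> bool"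
  where
  "irreducible_subspace G \<rho> W \<longleftrightarrow>
     invariant_subspace G \<rho> W \<and> W \<noteq> {0} \<and>
     (\<forall>U. invariant_subspace G \<rho> U \<and> U \<subseteq> W \<longrightarrow> U = {0} \<or> U = W)"

text \<open>The sum below is the trace of \<open>\<rho> g\<close> on \<open>W\<close>, computed in a basis \<open>B\<close> of \<open>W\<close>.\<close>

definition affords_character ::
  "('g, 'm) monoid_scheme \<Rightarrow> ('g \<Rightarrow> ('i \<Rightarrow> complex) \<Rightarrow> ('i \<Rightarrow> complex)) \<Rightarrow> ('i \<Rightarrow> complex) set \<Rightarrow>
     ('g \<Rightarrow> complex) \<Rightarrow> bool"
  where
  "affords_character G \<rho> W chi \<longleftrightarrow>
     (\<exists>B. finite B \<and> cfun.independent B \<and> cfun.span B = W \<and>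
          (\<forall>g\<in>carrier G. chi g = (\<Sum>b\<in>B. cfun.representation B (\<rho> g b) b)))"

definition isotypic_component ::
  "('g, 'm) monoid_scheme \<Rightarrow> ('g \<Rightarrow> ('i \<Rightarrow> complex) \<Rightarrow> ('i \<Rightarrow> complex)) \<Rightarrow> ('i \<Rightarrow> complex) set \<Rightarrow>
     ('g \<Rightarrow> complex) \<Rightarrow> ('i \<Rightarrow> complex) set"
  where
  "isotypic_component G \<rho> V chi =
     cfun.span (\<Union>{W. W \<subseteq> V \<and> irreducible_subspace G \<rho> W \<and> affords_character G \<rho> W chi})"

section \<open>Group actions on curves\<close>

definition acts_faithfully_on ::
  "('g, 'm) monoid_scheme \<Rightarrow> ('g \<Rightarrow> 'a \<Rightarrow> 'a) \<Rightarrow> 'a surface \<Rightarrow> bool" where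
  "acts_faithfully_on G \<phi> X \<longleftrightarrow>
     faithful_action G (points X) \<phi> \<and> (\<forall>g\<in>carrier G. holomorphic_map X X (\<phi> g))"

text \<open>The points of \<open>X/G\<close> are the orbits, so a point \<open>q\<close> of \<open>X/G\<close> is its own fibre under the
  quotient map \<open>orbit G \<phi>\<close>.  The charts of \<open>X/G\<close> are all homeomorphisms from open subsets of
  \<open>X/G\<close> to open subsets of the complex plane whose composition with the quotient map is
  holomorphic; they form the maximal atlas of the complex structure making the quotient map
  holomorphic.\<close>

definition quotient_topol ::
  "('g, 'm) monoid_scheme \<Rightarrow> ('g \<Rightarrow> 'a \<Rightarrow> 'a) \<Rightarrow> 'a surface \<Rightarrow> 'a set topology" where
  "quotient_topol G \<phi> X = topology (\<lambda>U.
     U \<subseteq> orbits G (points X) \<phi> \<and> openin (topol X) {x \<in> points X. orbit G \<phi> x \<in> U})"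

definition quotient_surface ::
  "('g, 'm) monoid_scheme \<Rightarrow> ('g \<Rightarrow> 'a \<Rightarrow> 'a) \<Rightarrow> 'a surface \<Rightarrow> 'a set surface" where
  "quotient_surface G \<phi> X =
     \<lparr> topol = quotient_topol G \<phi> X,
       atlas = {c. is_chart (quotient_topol G \<phi> X) c \<and>
                   holomorphic_function X {x \<in> points X. orbit G \<phi> x \<in> fst c}
                     (snd c \<circ> orbit G \<phi>)} \<rparr>"

definition Crit ::
  "('g, 'm) monoid_scheme \<Rightarrow> ('g \<Rightarrow> 'a \<Rightarrow> 'a) \<Rightarrow> 'a surface \<Rightarrow> 'a set set" where
  "Crit G \<phi> X = branch_points X (quotient_surface G \<phi> X) (orbit G \<phi>)"

definition stabilizer_order ::
  "('g, 'm) monoid_scheme \<Rightarrow> ('g \<Rightarrow> 'a \<Rightarrow> 'a) \<Rightarrow> 'a set \<Rightarrow> nat" where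
  "stabilizer_order G \<phi> q = (THE m. \<forall>x\<in>q. card (stabilizer G \<phi> x) = m)"

definition local_monodromy ::
  "('g, 'm) monoid_scheme \<Rightarrow> ('g \<Rightarrow> 'a \<Rightarrow> 'a) \<Rightarrow> 'a surface \<Rightarrow> 'a \<Rightarrow> 'g" where
  "local_monodromy G \<phi> X p = (THE h.
     h \<in> stabilizer G \<phi> p \<and> generate G {h} = stabilizer G \<phi> p \<and>
     (\<exists>z. local_coordinate X p z \<and> snd z p = 0 \<and>
        (\<forall>\<^sub>F x in nhdsin (topol X) p. \<phi> h x \<in> fst z \<and>
           snd z (\<phi> h x) = exp (2 * of_real pi * \<i> / of_nat (card (stabilizer G \<phi> p))) * snd z x)))"

definition canonical_representation ::
  "('g, 'm) monoid_scheme \<Rightarrow> ('g \<Rightarrow> 'a \<Rightarrow> 'a) \<Rightarrow> 'a surface \<Rightarrow> 'g \<Rightarrow> 'a oneform \<Rightarrow> 'a oneform"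
  where
  "canonical_representation G \<phi> X g \<omega> = pullback X X (\<phi> (inv\<^bsub>G\<^esub> g)) \<omega>"

definition H10_isotypic ::
  "('g, 'm) monoid_scheme \<Rightarrow> ('g \<Rightarrow> 'a \<Rightarrow> 'a) \<Rightarrow> 'a surface \<Rightarrow> ('g \<Rightarrow> complex) \<Rightarrow> 'a oneform set"
  where
  "H10_isotypic G \<phi> X chi = isotypic_component G (canonical_representation G \<phi> X) (H10 X) chi"

text \<open>The minimum is over the non-zero forms and all points of the fibre \<open>q\<close>.\<close>

definition min_vanishing_order ::
  "('g, 'm) monoid_scheme \<Rightarrow> ('g \<Rightarrow> 'a \<Rightarrow> 'a) \<Rightarrow> 'a surface \<Rightarrow> ('g \<Rightarrow> complex) \<Rightarrow> 'a set \<Rightarrow> nat"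
  where
  "min_vanishing_order G \<phi> X chi q =
     (LEAST n. \<exists>\<omega> \<in> H10_isotypic G \<phi> X chi - {0}. \<exists>x\<in>q. has_vanishing_order X \<omega> x n)"

section \<open>Holomorphic two-forms on the product surface\<close>

text \<open>\<open>\<eta> ((c, d), (x, y))\<close> is the coefficient of \<open>d(snd c) \<and> d(snd d)\<close> in \<open>\<eta>\<close> at \<open>(x, y)\<close>.\<close>

type_synonym ('a, 'b) twoform = "('a chart \<times> 'b chart) \<times> ('a \<times> 'b) \<Rightarrow> complex"

definition holomorphic2_on :: "(complex \<times> complex \<Rightarrow> complex) \<Rightarrow> (complex \<times> complex) set \<Rightarrow> bool"
  where
  "holomorphic2_on f S \<longleftrightarrow>
     (\<forall>P\<in>S. \<exists>a b. (f has_derivative (\<lambda>(u, v). a * u + b * v)) (at P))"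

text \<open>The Jacobian determinants of changes of product charts, and of product maps in product
  charts, are products of two one-variable derivatives.\<close>

definition H20 :: "'a surface \<Rightarrow> 'b surface \<Rightarrow> ('a, 'b) twoform set" where
  "H20 X Y = {\<eta>.
     (\<forall>c d x y. \<not> (c \<in> atlas X \<and> d \<in> atlas Y \<and> x \<in> fst c \<and> y \<in> fst d) \<longrightarrow> \<eta> ((c, d), (x, y)) = 0) \<and>
     (\<forall>c\<in>atlas X. \<forall>d\<in>atlas Y.
        holomorphic2_on (\<lambda>(z, w). \<eta> ((c, d), (chart_inv c z, chart_inv d w)))
          ((snd c ` fst c) \<times> (snd d ` fst d))) \<and>
     (\<forall>c\<in>atlas X. \<forall>c'\<in>atlas X. \<forall>d\<in>atlas Y. \<forall>d'\<in>atlas Y.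
        \<forall>x \<in> fst c \<inter> fst c'. \<forall>y \<in> fst d \<inter> fst d'.
          \<eta> ((c, d), (x, y)) = \<eta> ((c', d'), (x, y)) *
            (deriv (snd c' \<circ> chart_inv c) (snd c x) * deriv (snd d' \<circ> chart_inv d) (snd d y)))}"

definition pullback2 ::
  "'a surface \<Rightarrow> 'b surface \<Rightarrow> ('a \<Rightarrow> 'a) \<Rightarrow> ('b \<Rightarrow> 'b) \<Rightarrow> ('a, 'b) twoform \<Rightarrow> ('a, 'b) twoform" where
  "pullback2 X Y f g \<eta> = (\<lambda>((c, d), (x, y)).
     if c \<in> atlas X \<and> x \<in> fst c \<and> d \<in> atlas Y \<and> y \<in> fst d
     then \<eta> ((chart_at X (f x), chart_at Y (g y)), (f x, g y)) *
            (deriv (snd (chart_at X (f x)) \<circ> f \<circ> chart_inv c) (snd c x) *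
             deriv (snd (chart_at Y (g y)) \<circ> g \<circ> chart_inv d) (snd d y))
     else 0)"

text \<open>\<open>pr\<^sub>1\<^sup>* \<omega>\<^sub>1 \<and> pr\<^sub>2\<^sup>* \<omega>\<^sub>2\<close>\<close>

definition ext_wedge :: "'a oneform \<Rightarrow> 'b oneform \<Rightarrow> ('a, 'b) twoform" where
  "ext_wedge \<omega>\<^sub>1 \<omega>\<^sub>2 = (\<lambda>((c, d), (x, y)). \<omega>\<^sub>1 (c, x) * \<omega>\<^sub>2 (d, y))"

text \<open>The image of \<open>V \<otimes> W\<close> in \<open>H20\<close>.\<close>

definition tensor_forms :: "'a oneform set \<Rightarrow> 'b oneform set \<Rightarrow> ('a, 'b) twoform set" where
  "tensor_forms V W = cfun.span {ext_wedge \<omega>\<^sub>1 \<omega>\<^sub>2 | \<omega>\<^sub>1 \<omega>\<^sub>2. \<omega>\<^sub>1 \<in> V \<and> \<omega>\<^sub>2 \<in> W}"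

definition diagonal_invariants ::
  "('g, 'm) monoid_scheme \<Rightarrow> ('g \<Rightarrow> 'a \<Rightarrow> 'a) \<Rightarrow> ('g \<Rightarrow> 'b \<Rightarrow> 'b) \<Rightarrow> 'a surface \<Rightarrow> 'b surface \<Rightarrow>
     ('a, 'b) twoform set \<Rightarrow> ('a, 'b) twoform set" where
  "diagonal_invariants G \<phi> \<psi> X Y V =
     {\<eta> \<in> V. \<forall>g\<in>carrier G. pullback2 X Y (\<phi> (inv\<^bsub>G\<^esub> g)) (\<psi> (inv\<^bsub>G\<^esub> g)) \<eta> = \<eta>}"

lemma H20_outside:
  assumes "\<eta> \<in> H20 X Y" "\<not> (c \<in> atlas X \<and> d \<in> atlas Y \<and> x \<in> fst c \<and> y \<in> fst d)"
  shows "\<eta> ((c, d), (x, y)) = 0"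
  using assms unfolding H20_def by blast

lemma subspace_H20: "cfun.subspace (H20 X Y)"
proof (rule cfun.subspaceI)
  show "0 \<in> H20 X Y"
    unfolding H20_def holomorphic2_on_def
    by (auto intro!: exI[of _ 0] simp: case_prod_unfold)
next
  fix \<eta> \<theta> assume H: "\<eta> \<in> H20 X Y" "\<theta> \<in> H20 X Y"
  have "holomorphic2_on (\<lambda>(z, w). (\<eta> + \<theta>) ((c, d), (chart_inv c z, chart_inv d w)))
          ((snd c ` fst c) \<times> (snd d ` fst d))"
    if cd: "c \<in> atlas X" "d \<in> atlas Y" for c d
    unfolding holomorphic2_on_def
  proof
    fix P assume P: "P \<in> (snd c ` fst c) \<times> (snd d ` fst d)"
    obtain a b where ab: "((\<lambda>(z, w). \<eta> ((c, d), (chart_inv c z, chart_inv d w)))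
        has_derivative (\<lambda>(u, v). a * u + b * v)) (at P)"
      using H(1) cd P unfolding H20_def holomorphic2_on_def by blast
    obtain a' b' where ab': "((\<lambda>(z, w). \<theta> ((c, d), (chart_inv c z, chart_inv d w)))
        has_derivative (\<lambda>(u, v). a' * u + b' * v)) (at P)"
      using H(2) cd P unfolding H20_def holomorphic2_on_def by blast
    have "((\<lambda>(z, w). (\<eta> + \<theta>) ((c, d), (chart_inv c z, chart_inv d w)))
        has_derivative (\<lambda>(u, v). (a + a') * u + (b + b') * v)) (at P)"
      using has_derivative_add[OF ab ab'] by (simp add: case_prod_unfold algebra_simps)
    then show "\<exists>a b. ((\<lambda>(z, w). (\<eta> + \<theta>) ((c, d), (chart_inv c z, chart_inv d w)))
        has_derivative (\<lambda>(u, v). a * u + b * v)) (at P)" by blast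
  qed
  moreover have "(\<eta> + \<theta>) ((c, d), (x, y)) = 0"
    if "\<not> (c \<in> atlas X \<and> d \<in> atlas Y \<and> x \<in> fst c \<and> y \<in> fst d)" for c d x y
    using H20_outside[OF H(1) that] H20_outside[OF H(2) that] by simp
  moreover have "(\<eta> + \<theta>) ((c, d), (x, y)) = (\<eta> + \<theta>) ((c', d'), (x, y)) *
            (deriv (snd c' \<circ> chart_inv c) (snd c x) * deriv (snd d' \<circ> chart_inv d) (snd d y))"
    if "c \<in> atlas X" "c' \<in> atlas X" "d \<in> atlas Y" "d' \<in> atlas Y"
       "x \<in> fst c \<inter> fst c'" "y \<in> fst d \<inter> fst d'" for c c' d d' x y
  proof -
    have "\<zeta> ((c, d), (x, y)) = \<zeta> ((c', d'), (x, y)) *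
            (deriv (snd c' \<circ> chart_inv c) (snd c x) * deriv (snd d' \<circ> chart_inv d) (snd d y))"
      if "\<zeta> \<in> {\<eta>, \<theta>}" for \<zeta>
      using that H \<open>c \<in> atlas X\<close> \<open>c' \<in> atlas X\<close> \<open>d \<in> atlas Y\<close> \<open>d' \<in> atlas Y\<close>
        \<open>x \<in> fst c \<inter> fst c'\<close> \<open>y \<in> fst d \<inter> fst d'\<close>
      unfolding H20_def by blast
    from this[of \<eta>] this[of \<theta>] show ?thesis by (simp add: algebra_simps)
  qed
  ultimately show "\<eta> + \<theta> \<in> H20 X Y"
    unfolding H20_def by blast
next
  fix k :: complex and \<eta> assume H: "\<eta> \<in> H20 X Y"
  have "holomorphic2_on (\<lambda>(z, w). k * \<eta> ((c, d), (chart_inv c z, chart_inv d w)))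
          ((snd c ` fst c) \<times> (snd d ` fst d))"
    if cd: "c \<in> atlas X" "d \<in> atlas Y" for c d
    unfolding holomorphic2_on_def
  proof
    fix P assume P: "P \<in> (snd c ` fst c) \<times> (snd d ` fst d)"
    obtain a b where ab: "((\<lambda>(z, w). \<eta> ((c, d), (chart_inv c z, chart_inv d w)))
        has_derivative (\<lambda>(u, v). a * u + b * v)) (at P)"
      using H cd P unfolding H20_def holomorphic2_on_def by blast
    have "((\<lambda>(z, w). k * \<eta> ((c, d), (chart_inv c z, chart_inv d w)))
        has_derivative (\<lambda>(u, v). (k * a) * u + (k * b) * v)) (at P)"
      using has_derivative_mult_right[OF ab, of k]
      by (simp add: case_prod_unfold algebra_simps)
    then show "\<exists>a b. ((\<lambda>(z, w). k * \<eta> ((c, d), (chart_inv c z, chart_inv d w)))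
        has_derivative (\<lambda>(u, v). a * u + b * v)) (at P)" by blast
  qed
  moreover have "k * \<eta> ((c, d), (x, y)) = k * \<eta> ((c', d'), (x, y)) *
            (deriv (snd c' \<circ> chart_inv c) (snd c x) * deriv (snd d' \<circ> chart_inv d) (snd d y))"
    if "c \<in> atlas X" "c' \<in> atlas X" "d \<in> atlas Y" "d' \<in> atlas Y"
       "x \<in> fst c \<inter> fst c'" "y \<in> fst d \<inter> fst d'" for c c' d d' x y
  proof -
    have "\<eta> ((c, d), (x, y)) = \<eta> ((c', d'), (x, y)) *
            (deriv (snd c' \<circ> chart_inv c) (snd c x) * deriv (snd d' \<circ> chart_inv d) (snd d y))"
      using that H unfolding H20_def by blast
    then show ?thesis by simp
  qed
  moreover have "k * \<eta> ((c, d), (x, y)) = 0"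
    if "\<not> (c \<in> atlas X \<and> d \<in> atlas Y \<and> x \<in> fst c \<and> y \<in> fst d)" for c d x y
    using H20_outside[OF H that] by simp
  ultimately show "(\<lambda>i. k * \<eta> i) \<in> H20 X Y"
    unfolding H20_def by blast
qed

lemma ext_wedge_H20:
  assumes XY: "riemann_surface X" "riemann_surface Y"
    and H: "\<omega>\<^sub>1 \<in> H10 X" "\<omega>\<^sub>2 \<in> H10 Y"
  shows "ext_wedge \<omega>\<^sub>1 \<omega>\<^sub>2 \<in> H20 X Y"
proof -
  have "holomorphic2_on (\<lambda>(z, w). ext_wedge \<omega>\<^sub>1 \<omega>\<^sub>2 ((c, d), (chart_inv c z, chart_inv d w)))
          ((snd c ` fst c) \<times> (snd d ` fst d))"
    if cd: "c \<in> atlas X" "d \<in> atlas Y" for c d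
    unfolding holomorphic2_on_def
  proof
    fix P assume P: "P \<in> (snd c ` fst c) \<times> (snd d ` fst d)"
    let ?f = "\<lambda>z. \<omega>\<^sub>1 (c, chart_inv c z)" and ?g = "\<lambda>w. \<omega>\<^sub>2 (d, chart_inv d w)"
    have op: "open (snd c ` fst c)" "open (snd d ` fst d)"
      using XY cd unfolding riemann_surface_def is_chart_def by auto
    have hol: "?f holomorphic_on (snd c ` fst c)" "?g holomorphic_on (snd d ` fst d)"
      using H cd unfolding H10_def by auto
    obtain a where a: "(?f has_field_derivative a) (at (fst P))"
      using holomorphic_derivI[OF hol(1) op(1), of "fst P"] P by (auto simp: mem_Times_iff)
    obtain b where b: "(?g has_field_derivative b) (at (snd P))"
      using holomorphic_derivI[OF hol(2) op(2), of "snd P"] P by (auto simp: mem_Times_iff)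
    have f: "((\<lambda>Q. ?f (fst Q)) has_derivative (\<lambda>Q. a * fst Q)) (at P)"
      using has_derivative_compose[of fst fst P UNIV ?f "(*) a"] a
      by (simp add: has_field_derivative_def has_derivative_fst)
    have g: "((\<lambda>Q. ?g (snd Q)) has_derivative (\<lambda>Q. b * snd Q)) (at P)"
      using has_derivative_compose[of snd snd P UNIV ?g "(*) b"] b
      by (simp add: has_field_derivative_def has_derivative_snd)
    have "((\<lambda>(z, w). ext_wedge \<omega>\<^sub>1 \<omega>\<^sub>2 ((c, d), (chart_inv c z, chart_inv d w)))
        has_derivative (\<lambda>(u, v). (a * ?g (snd P)) * u + (?f (fst P) * b) * v)) (at P)"
      using has_derivative_mult[OF f g]
      by (simp add: ext_wedge_def case_prod_unfold algebra_simps)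
    then show "\<exists>a b. ((\<lambda>(z, w). ext_wedge \<omega>\<^sub>1 \<omega>\<^sub>2 ((c, d), (chart_inv c z, chart_inv d w)))
        has_derivative (\<lambda>(u, v). a * u + b * v)) (at P)" by blast
  qed
  moreover have "ext_wedge \<omega>\<^sub>1 \<omega>\<^sub>2 ((c, d), (x, y)) = ext_wedge \<omega>\<^sub>1 \<omega>\<^sub>2 ((c', d'), (x, y)) *
            (deriv (snd c' \<circ> chart_inv c) (snd c x) * deriv (snd d' \<circ> chart_inv d) (snd d y))"
    if "c \<in> atlas X" "c' \<in> atlas X" "d \<in> atlas Y" "d' \<in> atlas Y"
       "x \<in> fst c \<inter> fst c'" "y \<in> fst d \<inter> fst d'" for c c' d d' x y
  proof -
    have "\<omega>\<^sub>1 (c, x) = \<omega>\<^sub>1 (c', x) * deriv (snd c' \<circ> chart_inv c) (snd c x)"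
      using that H(1) unfolding H10_def by blast
    moreover have "\<omega>\<^sub>2 (d, y) = \<omega>\<^sub>2 (d', y) * deriv (snd d' \<circ> chart_inv d) (snd d y)"
      using that H(2) unfolding H10_def by blast
    ultimately show ?thesis by (simp add: ext_wedge_def)
  qed
  moreover have "ext_wedge \<omega>\<^sub>1 \<omega>\<^sub>2 ((c, d), (x, y)) = 0"
    if "\<not> (c \<in> atlas X \<and> d \<in> atlas Y \<and> x \<in> fst c \<and> y \<in> fst d)" for c d x y
  proof -
    have "\<omega>\<^sub>1 (c, x) = 0 \<or> \<omega>\<^sub>2 (d, y) = 0"
      using H that unfolding H10_def by blast
    then show ?thesis by (auto simp: ext_wedge_def)
  qed
  ultimately show ?thesis
    unfolding H20_def by blast
qed

lemma tensor_forms_subset_H20: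
  assumes "riemann_surface X" "riemann_surface Y" "V \<subseteq> H10 X" "W \<subseteq> H10 Y"
  shows "tensor_forms V W \<subseteq> H20 X Y"
  unfolding tensor_forms_def
  using assms by (intro cfun.span_minimal subspace_H20) (auto intro: ext_wedge_H20)

section \<open>Closed subschemes of the product surface\<close>

text \<open>An ideal of the ring of germs of holomorphic functions at \<open>P\<close> is represented by the set of
  all functions (defined everywhere, arbitrary away from \<open>P\<close>) whose germ lies in the ideal; so
  equality of ideals is equality of sets.  A closed subscheme is given by the stalks of its ideal
  sheaf.\<close>

abbreviation nhds2 :: "'a surface \<Rightarrow> 'b surface \<Rightarrow> 'a \<times> 'b \<Rightarrow> ('a \<times> 'b) filter" where
  "nhds2 X Y P \<equiv> nhdsin (prod_topology (topol X) (topol Y)) P"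

definition hol_germs :: "'a surface \<Rightarrow> 'b surface \<Rightarrow> 'a \<times> 'b \<Rightarrow> ('a \<times> 'b \<Rightarrow> complex) set" where
  "hol_germs X Y P = {f. \<exists>c\<in>atlas X. \<exists>d\<in>atlas Y. P \<in> fst c \<times> fst d \<and>
     (\<exists>S. open S \<and> (snd c (fst P), snd d (snd P)) \<in> S \<and> S \<subseteq> (snd c ` fst c) \<times> (snd d ` fst d) \<and>
          holomorphic2_on (\<lambda>(z, w). f (chart_inv c z, chart_inv d w)) S)}"

definition germ_ideal ::
  "'a surface \<Rightarrow> 'b surface \<Rightarrow> 'a \<times> 'b \<Rightarrow> ('a \<times> 'b \<Rightarrow> complex) set \<Rightarrow> ('a \<times> 'b \<Rightarrow> complex) set"
  where
  "germ_ideal X Y P S = {f \<in> hol_germs X Y P. \<exists>(n::nat) a s.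
     (\<forall>i<n. a i \<in> hol_germs X Y P \<and> s i \<in> S) \<and>
     (\<forall>\<^sub>F Q in nhds2 X Y P. f Q = (\<Sum>i<n. a i Q * s i Q))}"

definition base_scheme ::
  "'a surface \<Rightarrow> 'b surface \<Rightarrow> ('a, 'b) twoform set \<Rightarrow> ('a \<times> 'b \<Rightarrow> ('a \<times> 'b \<Rightarrow> complex) set)" where
  "base_scheme X Y V = (\<lambda>P \<in> points X \<times> points Y. germ_ideal X Y P
     {\<lambda>Q. \<eta> ((c, d), Q) | \<eta> c d. \<eta> \<in> V \<and> c \<in> atlas X \<and> d \<in> atlas Y \<and> P \<in> fst c \<times> fst d})"

definition reduced_ideal ::
  "'a surface \<Rightarrow> 'b surface \<Rightarrow> ('a \<times> 'b) set \<Rightarrow> 'a \<times> 'b \<Rightarrow> ('a \<times> 'b \<Rightarrow> complex) set" where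
  "reduced_ideal X Y Z P =
     {f \<in> hol_germs X Y P. \<forall>\<^sub>F Q in nhds2 X Y P. Q \<in> Z \<longrightarrow> f Q = 0}"

text \<open>An effective divisor is a formal sum, that is a multiset, of reduced curves; its ideal is the
  product of the ideals of these curves, taken with multiplicity.\<close>

definition divisor_scheme ::
  "'a surface \<Rightarrow> 'b surface \<Rightarrow> ('a \<times> 'b) set multiset \<Rightarrow> ('a \<times> 'b \<Rightarrow> ('a \<times> 'b \<Rightarrow> complex) set)" where
  "divisor_scheme X Y D = (\<lambda>P \<in> points X \<times> points Y. germ_ideal X Y P
     {\<lambda>Q. \<Prod>i<length Zs. s i Q | Zs s.
        mset Zs = D \<and> (\<forall>i<length Zs. s i \<in> reduced_ideal X Y (Zs ! i) P)})"

definition R_vert :: "'b surface \<Rightarrow> 'a set \<Rightarrow> ('a \<times> 'b) set" where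
  "R_vert Y q = q \<times> points Y"

definition R_hor :: "'a surface \<Rightarrow> 'b set \<Rightarrow> ('a \<times> 'b) set" where
  "R_hor X l = points X \<times> l"

text \<open>The divisor \<open>\<Sum>\<^bsub>q\<in>A\<^esub> t q R_vert q + \<Sum>\<^bsub>l\<in>B\<^esub> u l R_hor l\<close>.\<close>

definition fibre_divisor ::
  "'a surface \<Rightarrow> 'b surface \<Rightarrow> 'a set set \<Rightarrow> ('a set \<Rightarrow> nat) \<Rightarrow> 'b set set \<Rightarrow> ('b set \<Rightarrow> nat) \<Rightarrow>
     ('a \<times> 'b) set multiset" where
  "fibre_divisor X Y A t B u =
     (\<Sum>q\<in>A. replicate_mset (t q) (R_vert Y q)) + (\<Sum>l\<in>B. replicate_mset (u l) (R_hor X l))"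

end

theory Submission
  imports Defs
begin

text \<open>For a character \<open>\<chi>\<close> of degree one the isotypic component consists of the eigenforms
  \<open>g \<cdot> \<omega> = \<chi>(g) \<omega>\<close>.  As \<open>\<chi>\<close> times its conjugate is \<open>1\<close>, \<open>G\<close> acts trivially on the tensor product, and as the order of an
  eigenform is constant on orbits, near \<open>(x, y)\<close> the base ideal is generated by \<open>z\<^sup>t w\<^sup>u\<close>, with \<open>t\<close>, \<open>u\<close> the
  minimal orders over the images of \<open>x\<close>, \<open>y\<close>.  This is also the ideal of the divisor: a holomorphic
  function of two variables vanishing on \<open>z = 0\<close> is divisible by \<open>z\<close>.

  Let \<open>h\<close> be the local monodromy at a point with stabilizer of order \<open>m\<close>.  The leading coefficients in
  \<open>h\<^sup>* \<omega> = \<chi>(h)\<^sup>-\<^sup>1 \<omega>\<close> give \<open>\<chi>(h) e\<^bsup>2\<pi>i(t+1)/m\<^esup> = 1\<close>, so \<open>t\<close> is determined modulo \<open>m\<close>.  If the quotient is the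
  projective line, it has a function whose only pole is a simple one at the given branch point.  Its
  pullback has poles of order \<open>m\<close> along the fibre, so multiplying by it would lower a minimal order
  \<open>t \<ge> m\<close>; hence \<open>t < m\<close>.\<close>

subsection \<open>Vanishing orders in one variable\<close>

text \<open>At a point with trivial stabilizer the relation between character and order says
  nothing, so an isotypic system can have base points over unbranched points of the quotient. Hence
  the general divisor formula runs over the branch points and the finitely many fibres of positive
  minimal order; only the bound t < m, obtained when the quotient is the projective line, confines
  it to the branch points. If an isotypic space is zero there is no minimal order, so that case is
  excluded. Everything local at p rests on a coordinate z in which the stabilizer acts by m-th roots
  of unity, found by averaging a chart coordinate over the stabilizer. It identifies the stabilizer
  with the group of these roots, which gives the local monodromy, and z^m is a chart of the
  quotient, which is why a simple pole downstairs has order m upstairs. A function from the quotient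
  is invariant, so multiplying by it keeps the character. On the second curve the forms carry the
  conjugate character, which is the inverse of chi; this is why t + 1 enters the two formulas for
  chi with opposite signs.\<close>

definition vanishes_to :: "(complex \<Rightarrow> complex) \<Rightarrow> complex \<Rightarrow> nat \<Rightarrow> bool" where
  "vanishes_to f z n \<longleftrightarrow>
     (\<exists>g. g analytic_on {z} \<and> g z \<noteq> 0 \<and> (\<forall>\<^sub>F w in nhds z. f w = g w * (w - z) ^ n))"

lemma analytic_at_eventually_eq:
  assumes "f analytic_on {z}" "\<forall>\<^sub>F w in nhds z. g w = f w"
  shows "g analytic_on {z}"
  using assms analytic_at_cong[of g f z z] by simp

lemma analytic_at_eventually_analytic:
  assumes "f analytic_on {z}"
  shows "\<forall>\<^sub>F w in nhds z. f analytic_on {w}"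
proof -
  obtain S where "open S" "z \<in> S" "f holomorphic_on S"
    using assms unfolding analytic_at by blast
  then have "\<forall>\<^sub>F w in nhds z. w \<in> S" by (simp add: eventually_nhds_in_open)
  then show ?thesis
    by eventually_elim (use \<open>open S\<close> \<open>f holomorphic_on S\<close> in \<open>auto simp: analytic_at\<close>)
qed

lemma holomorphic_onI_analytic_at:
  assumes "\<And>z. z \<in> S \<Longrightarrow> f analytic_on {z}"
  shows "f holomorphic_on S"
  using assms analytic_imp_holomorphic analytic_on_analytic_at by blast

lemma analytic_at_tendsto:
  assumes "f analytic_on {z}" shows "(f \<longlongrightarrow> f z) (nhds z)"
  using analytic_at_imp_isCont[OF assms] by (simp add: isCont_def tendsto_at_iff_tendsto_nhds)

lemma analytic_at_compose:
  assumes "f analytic_on {z}" "g analytic_on {f z}"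
  shows "(\<lambda>w. g (f w)) analytic_on {z}"
  using analytic_on_compose[of f "{z}" g] assms by (simp add: o_def)

lemma deriv_compose_analytic:
  assumes "f analytic_on {z}" "g analytic_on {f z}"
  shows "deriv (\<lambda>w. g (f w)) z = deriv g (f z) * deriv f z"
  using deriv_chain[of f z g] assms analytic_on_imp_differentiable_at by (auto simp: o_def)

lemma vanishes_to_cong:
  assumes "vanishes_to f z n" "\<forall>\<^sub>F w in nhds z. g w = f w"
  shows "vanishes_to g z n"
proof -
  obtain k where k: "k analytic_on {z}" "k z \<noteq> 0" "\<forall>\<^sub>F w in nhds z. f w = k w * (w - z) ^ n"
    using assms unfolding vanishes_to_def by blast
  have "\<forall>\<^sub>F w in nhds z. g w = k w * (w - z) ^ n"
    using k(3) assms(2) by eventually_elim simp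
  then show ?thesis using k unfolding vanishes_to_def by blast
qed

lemma analytic_at_nonzero_eventually:
  assumes "g analytic_on {z}" "g z \<noteq> (0::complex)"
  shows "\<forall>\<^sub>F w in nhds z. g w \<noteq> 0"
  using tendsto_imp_eventually_ne[OF analytic_at_tendsto[OF assms(1)] assms(2)] .

text \<open>Links the factorisation to \<open>zorder\<close>, on which
  \<open>has_vanishing_order\<close> is based. If f is zero near z then \<open>vanishes_to\<close>
  fails for every n, so it carries the nonvanishing that a value of \<open>zorder\<close> by itself
  does not.\<close>

lemma vanishes_to_zorder:
  assumes "vanishes_to f z n"
  shows "zorder f z = int n"
proof -
  obtain g where g: "g analytic_on {z}" "g z \<noteq> 0" "\<forall>\<^sub>F w in nhds z. f w = g w * (w - z) ^ n"
    using assms unfolding vanishes_to_def by blast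
  obtain S where S: "open S" "z \<in> S" "g holomorphic_on S"
    using g(1) unfolding analytic_at by blast
  obtain T where T: "open T" "z \<in> T" "\<And>w. w \<in> T \<Longrightarrow> f w = g w * (w - z) ^ n"
    using g(3) unfolding eventually_nhds by blast
  show ?thesis
    by (rule zorder_eqI[of "S \<inter> T" z g]) (use S T g in \<open>auto intro: holomorphic_on_subset\<close>)
qed

lemma vanishes_to_unique: "vanishes_to f z n \<Longrightarrow> vanishes_to f z k \<Longrightarrow> n = k"
  using vanishes_to_zorder[of f z n] vanishes_to_zorder[of f z k] by simp

lemma analytic_at_vanishes_to:
  assumes "f analytic_on {z}" "\<not> (\<forall>\<^sub>F w in nhds z. f w = 0)"
  obtains n where "vanishes_to f z n"
proof -
  obtain r where r: "r > 0" "f holomorphic_on ball z r"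
    using assms(1) unfolding analytic_on_def by blast
  have "\<exists>w\<in>ball z r. f w \<noteq> 0"
  proof (rule ccontr)
    assume "\<not> ?thesis"
    moreover have "\<forall>\<^sub>F w in nhds z. w \<in> ball z r" using r by (intro eventually_nhds_in_open) auto
    ultimately have "\<forall>\<^sub>F w in nhds z. f w = 0" by (auto elim: eventually_mono)
    with assms(2) show False ..
  qed
  from zorder_exist_zero[OF r(2) open_ball connected_ball _ this, of z] r(1) obtain s where
    s: "s > 0" "zor_poly f z holomorphic_on cball z s"
     "\<And>w. w \<in> cball z s \<Longrightarrow> f w = zor_poly f z w * (w - z) ^ nat (zorder f z) \<and> zor_poly f z w \<noteq> 0"
    unfolding centre_in_ball by blast
  have "vanishes_to f z (nat (zorder f z))"
    unfolding vanishes_to_def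
  proof (intro exI[of _ "zor_poly f z"] conjI)
    show "zor_poly f z analytic_on {z}"
      using analytic_at holomorphic_on_subset[OF s(2) ball_subset_cball] s(1) open_ball centre_in_ball
      by blast
    show "zor_poly f z z \<noteq> 0" using s by auto
    have "\<forall>\<^sub>F w in nhds z. w \<in> ball z s" using s by (intro eventually_nhds_in_open) auto
    then show "\<forall>\<^sub>F w in nhds z. f w = zor_poly f z w * (w - z) ^ nat (zorder f z)"
      by eventually_elim (use s(3) in auto)
  qed
  then show ?thesis using that by blast
qed

lemma vanishes_to_isolated:
  assumes "vanishes_to f z n" shows "\<forall>\<^sub>F w in at z. f w \<noteq> 0"
proof -
  obtain g where g: "g analytic_on {z}" "g z \<noteq> 0" "\<forall>\<^sub>F w in nhds z. f w = g w * (w - z) ^ n"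
    using assms unfolding vanishes_to_def by blast
  show ?thesis
    using eventually_conj[OF g(3) analytic_at_nonzero_eventually[OF g(1,2)]]
    unfolding eventually_at_filter by eventually_elim auto
qed

lemma vanishes_to_analytic: assumes "vanishes_to f z n" shows "f analytic_on {z}"
proof -
  obtain g where g: "g analytic_on {z}" "g z \<noteq> 0" "\<forall>\<^sub>F w in nhds z. f w = g w * (w - z) ^ n"
    using assms unfolding vanishes_to_def by blast
  have "(\<lambda>w. g w * (w - z) ^ n) analytic_on {z}" using g by (intro analytic_intros)
  then show ?thesis using g(3) by (rule analytic_at_eventually_eq)
qed

lemma vanishes_to_mult:
  assumes "vanishes_to f z n" "vanishes_to h z k"
  shows "vanishes_to (\<lambda>w. f w * h w) z (n + k)"
proof -
  obtain g where g: "g analytic_on {z}" "g z \<noteq> 0" "\<forall>\<^sub>F w in nhds z. f w = g w * (w - z) ^ n"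
    using assms(1) unfolding vanishes_to_def by blast
  obtain g' where g': "g' analytic_on {z}" "g' z \<noteq> 0" "\<forall>\<^sub>F w in nhds z. h w = g' w * (w - z) ^ k"
    using assms(2) unfolding vanishes_to_def by blast
  show ?thesis unfolding vanishes_to_def
  proof (intro exI[of _ "\<lambda>w. g w * g' w"] conjI)
    show "(\<lambda>w. g w * g' w) analytic_on {z}" using g g' by (intro analytic_intros)
    show "\<forall>\<^sub>F w in nhds z. f w * h w = g w * g' w * (w - z) ^ (n + k)"
      using g(3) g'(3) by eventually_elim (simp add: power_add mult_ac)
  qed (use g g' in auto)
qed

lemma vanishes_to_0_iff:
  assumes "f analytic_on {z}" shows "vanishes_to f z 0 \<longleftrightarrow> f z \<noteq> 0"
proof
  assume "vanishes_to f z 0"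
  then obtain g where "g z \<noteq> 0" "\<forall>\<^sub>F w in nhds z. f w = g w * (w - z) ^ 0"
    unfolding vanishes_to_def by blast
  then show "f z \<noteq> 0" using eventually_nhds_x_imp_x by fastforce
next
  assume "f z \<noteq> 0"
  then show "vanishes_to f z 0"
    unfolding vanishes_to_def using assms by (intro exI[of _ f]) auto
qed

lemma vanishes_to_power:
  assumes "vanishes_to f z n"
  shows "vanishes_to (\<lambda>w. f w ^ k) z (n * k)"
proof (induction k)
  case 0
  show ?case using vanishes_to_0_iff[of "\<lambda>_. 1" z] by simp
next
  case (Suc k)
  from vanishes_to_mult[OF assms this] show ?case by simp
qed

text \<open>The order exists because a difference that is zero near z would have derivative zero; it
  is not 0 by the value at z, and an order of at least 2 would again make the derivative
  zero.\<close>

lemma vanishes_to_diff: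
  assumes "f analytic_on {z}" "deriv f z \<noteq> 0"
  shows "vanishes_to (\<lambda>w. f w - f z) z 1"
proof -
  have an: "(\<lambda>w. f w - f z) analytic_on {z}" using assms by (intro analytic_intros)
  have d: "(f has_field_derivative deriv f z) (at z)"
    using assms(1) analytic_on_imp_differentiable_at by (simp add: DERIV_deriv_iff_field_differentiable)
  have dd: "((\<lambda>w. f w - f z) has_field_derivative deriv f z) (at z)"
    by (auto intro!: derivative_eq_intros d)
  have "\<not> (\<forall>\<^sub>F w in nhds z. f w - f z = 0)"
  proof
    assume "\<forall>\<^sub>F w in nhds z. f w - f z = 0"
    then have "((\<lambda>w. 0) has_field_derivative deriv f z) (at z)"
      using dd DERIV_cong_ev[of z z "\<lambda>w. f w - f z" "\<lambda>_. 0" "deriv f z" "deriv f z"] by simp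
    then show False using assms(2) DERIV_unique[OF _ DERIV_const] by blast
  qed
  with an obtain n where n: "vanishes_to (\<lambda>w. f w - f z) z n"
    using analytic_at_vanishes_to by blast
  then obtain g where g: "g analytic_on {z}" "g z \<noteq> 0" "\<forall>\<^sub>F w in nhds z. f w - f z = g w * (w - z) ^ n"
    unfolding vanishes_to_def by blast
  have gd: "(g has_field_derivative deriv g z) (at z)"
    using g(1) analytic_on_imp_differentiable_at by (simp add: DERIV_deriv_iff_field_differentiable)
  have "n \<noteq> 0" using n vanishes_to_0_iff[OF an] by (cases n) auto
  moreover have "\<not> 2 \<le> n"
  proof
    assume n2: "2 \<le> n"
    have "((\<lambda>w. g w * (w - z) ^ n) has_field_derivative
            deriv g z * (z - z) ^ n + (of_nat n * (z - z) ^ (n - Suc 0)) * g z) (at z)"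
      by (auto intro!: derivative_eq_intros gd)
    then have "((\<lambda>w. g w * (w - z) ^ n) has_field_derivative 0) (at z)"
      using n2 by (simp add: power_0_left)
    then have "((\<lambda>w. f w - f z) has_field_derivative 0) (at z)"
      using g(3) DERIV_cong_ev[of z z "\<lambda>w. f w - f z" "\<lambda>w. g w * (w - z) ^ n" 0 0] by simp
    then show False using dd assms(2) DERIV_unique by blast
  qed
  ultimately have "n = 1" by linarith
  then show ?thesis using n by simp
qed

text \<open>Substituting f keeps the order because \<open>f w - f z\<close> has a simple zero at
  z.\<close>

lemma vanishes_to_compose:
  assumes "f analytic_on {z}" "deriv f z \<noteq> 0" "vanishes_to h (f z) n"
  shows "vanishes_to (\<lambda>w. h (f w)) z n"
proof -
  obtain g where g: "g analytic_on {f z}" "g (f z) \<noteq> 0"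
      "\<forall>\<^sub>F w in nhds (f z). h w = g w * (w - f z) ^ n"
    using assms(3) unfolding vanishes_to_def by blast
  have 1: "vanishes_to (\<lambda>w. g (f w)) z 0"
    using vanishes_to_0_iff[OF analytic_at_compose[OF assms(1) g(1)]] g(2) by blast
  have 2: "vanishes_to (\<lambda>w. (f w - f z) ^ n) z (1 * n)"
    by (rule vanishes_to_power[OF vanishes_to_diff[OF assms(1,2)]])
  have "\<forall>\<^sub>F w in nhds z. h (f w) = g (f w) * (f w - f z) ^ n"
    using analytic_at_tendsto[OF assms(1)] g(3) unfolding filterlim_iff by blast
  then show ?thesis using vanishes_to_cong[OF vanishes_to_mult[OF 1 2]] by simp
qed

subsection \<open>Charts\<close>

lemma chart_inv_into:
  assumes "z \<in> snd c ` fst c"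
  shows "snd c (chart_inv c z) = z" "chart_inv c z \<in> fst c"
  using assms unfolding chart_inv_def by (auto intro: f_inv_into_f inv_into_into)

context
  fixes T :: "'a topology" and c :: "'a chart"
  assumes c: "is_chart T c"
begin

lemma chart_subset: "fst c \<subseteq> topspace T"
  using c unfolding is_chart_def by (auto dest: openin_subset)

lemma chart_inj: "inj_on (snd c) (fst c)"
  using c chart_subset homeomorphic_imp_injective_map[of "subtopology T (fst c)" _ "snd c"]
  unfolding is_chart_def by (auto simp: Int_absorb1)

lemma chart_inv_left: "x \<in> fst c \<Longrightarrow> chart_inv c (snd c x) = x"
  unfolding chart_inv_def using chart_inj by simp

lemma chart_image_open:
  assumes "openin T U" shows "open (snd c ` (U \<inter> fst c))"
proof -
  have "open_map (subtopology T (fst c)) (top_of_set (snd c ` fst c)) (snd c)"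
    using c homeomorphic_imp_open_map unfolding is_chart_def by blast
  moreover have "openin (subtopology T (fst c)) (U \<inter> fst c)"
    using assms by (rule openin_subtopology_Int)
  ultimately have "openin (top_of_set (snd c ` fst c)) (snd c ` (U \<inter> fst c))"
    unfolding open_map_def by blast
  then show ?thesis using c unfolding is_chart_def using openin_open_eq by blast
qed

lemma chart_preimage_open:
  assumes "open S" shows "openin T {x \<in> fst c. snd c x \<in> S}"
proof -
  have "continuous_map (subtopology T (fst c)) (top_of_set (snd c ` fst c)) (snd c)"
    using c homeomorphic_imp_continuous_map unfolding is_chart_def by blast
  then have "continuous_map (subtopology T (fst c)) euclidean (snd c)"
    by (simp add: continuous_map_in_subtopology)
  then have "openin (subtopology T (fst c)) {x \<in> topspace (subtopology T (fst c)). snd c x \<in> S}"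
    using assms open_openin unfolding continuous_map_def by blast
  moreover have "topspace (subtopology T (fst c)) = fst c" using chart_subset by auto
  ultimately have "openin (subtopology T (fst c)) {x \<in> fst c. snd c x \<in> S}" by (simp only:)
  then show ?thesis
    using c openin_open_subtopology[of T "fst c"] unfolding is_chart_def by blast
qed

text \<open>Local statements about points of the surface are moved through this equivalence to
  neighbourhood filters in the plane, where the analytic lemmas apply.\<close>

lemma chart_eventually_iff:
  assumes "p \<in> fst c"
  shows "eventually P (nhdsin T p) \<longleftrightarrow> eventually (\<lambda>z. P (chart_inv c z)) (nhds (snd c p))"
proof
  assume "eventually P (nhdsin T p)"
  then obtain U where U: "openin T U" "p \<in> U" "\<And>x. x \<in> U \<Longrightarrow> P x"
    using assms chart_subset unfolding eventually_nhdsin by blast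
  then have "open (snd c ` (U \<inter> fst c))" "snd c p \<in> snd c ` (U \<inter> fst c)"
    using chart_image_open assms by auto
  moreover have "\<forall>z \<in> snd c ` (U \<inter> fst c). P (chart_inv c z)" using U chart_inv_left by auto
  ultimately show "eventually (\<lambda>z. P (chart_inv c z)) (nhds (snd c p))"
    unfolding eventually_nhds by blast
next
  assume "eventually (\<lambda>z. P (chart_inv c z)) (nhds (snd c p))"
  then obtain S where S: "open S" "snd c p \<in> S" "\<And>z. z \<in> S \<Longrightarrow> P (chart_inv c z)"
    unfolding eventually_nhds by blast
  have "\<forall>x \<in> {x \<in> fst c. snd c x \<in> S}. P x" using S(3) chart_inv_left by fastforce
  then show "eventually P (nhdsin T p)"
    unfolding eventually_nhdsin using chart_preimage_open[OF S(1)] S(2) assms by blast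
qed

lemma chart_open_image: "open (snd c ` fst c)"
  using c unfolding is_chart_def by simp

lemma chart_openin: "openin T (fst c)"
  using c unfolding is_chart_def by simp

lemma chart_eventually_image:
  "p \<in> fst c \<Longrightarrow> \<forall>\<^sub>F z in nhds (snd c p). z \<in> snd c ` fst c"
  by (rule eventually_nhds_in_open[OF chart_open_image]) simp

lemma chart_eventually_domain: "p \<in> fst c \<Longrightarrow> \<forall>\<^sub>F x in nhdsin T p. x \<in> fst c"
  unfolding eventually_nhdsin using chart_openin by blast

lemma chart_eventually_coord_iff:
  assumes "p \<in> fst c"
  shows "eventually (\<lambda>x. P (snd c x)) (nhdsin T p) \<longleftrightarrow> eventually P (nhds (snd c p))"
  unfolding chart_eventually_iff[OF assms]
  by (rule eventually_cong[OF chart_eventually_image[OF assms]]) (auto simp: chart_inv_into)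

text \<open>The conjunct \<open>x \<in> fst c\<close> is kept so that injectivity of the chart and
  \<open>chart_inv_left\<close> can be applied at x afterwards.\<close>

lemma eventually_nhds_chart_iff:
  assumes "p \<in> fst c"
  shows "eventually P (nhds (snd c p)) \<longleftrightarrow> eventually (\<lambda>x. x \<in> fst c \<and> P (snd c x)) (nhdsin T p)"
proof -
  have "eventually (\<lambda>x. x \<in> fst c \<and> P (snd c x)) (nhdsin T p) \<longleftrightarrow>
      eventually (\<lambda>x. P (snd c x)) (nhdsin T p)"
    by (rule eventually_cong[OF chart_eventually_domain[OF assms]]) auto
  then show ?thesis using chart_eventually_coord_iff[OF assms] by simp
qed

end

lemma eventually_nhdsin_openin: "openin T U \<Longrightarrow> p \<in> U \<Longrightarrow> \<forall>\<^sub>F x in nhdsin T p. x \<in> U"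
  unfolding eventually_nhdsin by blast

lemma eventually_nhdsin_self:
  "\<forall>\<^sub>F x in nhdsin T p. P x \<Longrightarrow> p \<in> topspace T \<Longrightarrow> P p"
  unfolding eventually_nhdsin by blast

lemma continuous_map_eventually:
  assumes "continuous_map S T f" "p \<in> topspace S" "\<forall>\<^sub>F y in nhdsin T (f p). P y"
  shows "\<forall>\<^sub>F x in nhdsin S p. P (f x)"
proof -
  have "f p \<in> topspace T" using assms unfolding continuous_map_def by auto
  then obtain U where U: "openin T U" "f p \<in> U" "\<And>y. y \<in> U \<Longrightarrow> P y"
    using assms(3) unfolding eventually_nhdsin by blast
  then have "openin S {x \<in> topspace S. f x \<in> U}" using assms(1) unfolding continuous_map_def by blast
  then show ?thesis unfolding eventually_nhdsin using U assms(2)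
    by (intro disjI2 exI[of _ "{x \<in> topspace S. f x \<in> U}"]) auto
qed

subsection \<open>Forms on Riemann surfaces\<close>

lemma eventually_atin_nhdsin: "eventually P (atin T p) \<longleftrightarrow> (\<forall>\<^sub>F x in nhdsin T p. x \<noteq> p \<longrightarrow> P x)"
  unfolding eventually_atin eventually_nhdsin by blast

text \<open>The points near which P holds form an open set. Its complement is open too, because
  around such a point P fails on a punctured neighbourhood. Connectedness makes the set empty or
  everything. The principle serves both for zeros of forms and for fixed points of group
  elements.\<close>

lemma connected_identity_principle:
  assumes "connected_space T"
    and P: "\<And>p. p \<in> topspace T \<Longrightarrow> (\<forall>\<^sub>F x in nhdsin T p. P x) \<or> (\<forall>\<^sub>F x in atin T p. \<not> P x)"
  shows "(\<forall>p \<in> topspace T. P p) \<or> (\<forall>p \<in> topspace T. \<forall>\<^sub>F x in atin T p. \<not> P x)"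
proof -
  define A where "A = {p \<in> topspace T. \<forall>\<^sub>F x in nhdsin T p. P x}"
  have "openin T A"
    unfolding openin_subopen[of T A]
  proof
    fix p assume "p \<in> A"
    then obtain U where U: "openin T U" "p \<in> U" "\<forall>x\<in>U. P x"
      unfolding A_def eventually_nhdsin by blast
    then have "U \<subseteq> A" using openin_subset unfolding A_def eventually_nhdsin by blast
    then show "\<exists>U. openin T U \<and> p \<in> U \<and> U \<subseteq> A" using U by blast
  qed
  moreover have "openin T (topspace T - A)"
    unfolding openin_subopen[of T "topspace T - A"]
  proof
    fix p assume p: "p \<in> topspace T - A"
    then have "\<forall>\<^sub>F x in atin T p. \<not> P x" using P unfolding A_def by blast
    then obtain U where U: "openin T U" "p \<in> U" "\<forall>x\<in>U - {p}. \<not> P x"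
      using p unfolding eventually_atin by blast
    have "x \<notin> A" if "x \<in> U" for x
    proof (cases "x = p")
      case False
      then have "\<not> P x" using U that by blast
      then show ?thesis unfolding A_def using eventually_nhdsin_self[of P T x] by blast
    qed (use p in auto)
    then show "\<exists>U. openin T U \<and> p \<in> U \<and> U \<subseteq> topspace T - A"
      using U openin_subset by (intro exI[of _ U]) blast
  qed
  ultimately have "A = {} \<or> A = topspace T"
    using assms(1) unfolding connected_space_clopen_in closedin_def A_def by blast
  then show ?thesis
  proof
    assume "A = {}"
    then show ?thesis using P unfolding A_def by blast
  next
    assume "A = topspace T"
    then have "\<forall>p\<in>topspace T. \<forall>\<^sub>F x in nhdsin T p. P x" unfolding A_def by blast
    then show ?thesis using eventually_nhdsin_self[of P T] by blast
  qed
qed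

text \<open>Each point has a neighbourhood in which P can hold at its centre only; the centres of a
  finite subcover contain all points with P.\<close>

lemma compact_space_discrete_finite:
  assumes "compact_space T" and P: "\<And>p. p \<in> topspace T \<Longrightarrow> \<forall>\<^sub>F x in atin T p. \<not> P x"
  shows "finite {x \<in> topspace T. P x}"
proof -
  have "\<forall>p\<in>topspace T. \<exists>U. openin T U \<and> p \<in> U \<and> (\<forall>x\<in>U - {p}. \<not> P x)"
    using P unfolding eventually_atin by blast
  then obtain U where U: "\<And>p. p \<in> topspace T \<Longrightarrow> openin T (U p) \<and> p \<in> U p \<and> (\<forall>x\<in>U p - {p}. \<not> P x)"
    by metis
  have "\<forall>V\<in>U ` topspace T. openin T V" "topspace T \<subseteq> \<Union>(U ` topspace T)" using U by auto
  then obtain F where F: "finite F" "F \<subseteq> U ` topspace T" "topspace T \<subseteq> \<Union>F"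
    using assms(1) unfolding compact_space_alt by meson
  obtain C where C: "C \<subseteq> topspace T" "finite C" "F = U ` C"
    using finite_subset_image[OF F(1,2)] by blast
  have "{x \<in> topspace T. P x} \<subseteq> C"
  proof
    fix x assume x: "x \<in> {x \<in> topspace T. P x}"
    then obtain p where "p \<in> C" "x \<in> U p" using F C by blast
    then have "x = p" using U[of p] C x by blast
    then show "x \<in> C" using \<open>p \<in> C\<close> by simp
  qed
  then show ?thesis using C finite_subset by blast
qed

text \<open>A transition map is injective on the image of the overlap, and an injective holomorphic
  function has no critical point.\<close>

lemma compatible_analytic:
  assumes "is_chart T c" "is_chart T d" "compatible c d" "p \<in> fst c" "p \<in> fst d"
  shows "(\<lambda>z. snd d (chart_inv c z)) analytic_on {snd c p}"
    and "deriv (\<lambda>z. snd d (chart_inv c z)) (snd c p) \<noteq> 0"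
proof -
  let ?S = "snd c ` (fst d \<inter> fst c)"
  have S: "open ?S" using chart_image_open[OF assms(1) chart_openin[OF assms(2)]] .
  have p: "snd c p \<in> ?S" using assms by blast
  have hol: "(\<lambda>z. snd d (chart_inv c z)) holomorphic_on ?S"
    using assms(3) unfolding compatible_def by (simp add: o_def Int_commute)
  show "(\<lambda>z. snd d (chart_inv c z)) analytic_on {snd c p}"
    using S p hol analytic_at by blast
  have "inj_on (\<lambda>z. snd d (chart_inv c z)) ?S"
    by (intro inj_onI) (auto simp: chart_inv_left[OF assms(1)] dest: inj_onD[OF chart_inj[OF assms(2)]])
  then show "deriv (\<lambda>z. snd d (chart_inv c z)) (snd c p) \<noteq> 0"
    using holomorphic_injective_imp_regular[OF hol S] p by blast
qed

locale riemann_surface_on =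
  fixes X :: "'a surface"
  assumes rs: "riemann_surface X"
begin

lemma atlas_chart: "c \<in> atlas X \<Longrightarrow> is_chart (topol X) c"
  and atlas_compatible: "c \<in> atlas X \<Longrightarrow> d \<in> atlas X \<Longrightarrow> compatible c d"
  and atlas_cover: "p \<in> points X \<Longrightarrow> \<exists>c\<in>atlas X. p \<in> fst c"
  and Hausdorff: "Hausdorff_space (topol X)"
  and connected: "connected_space (topol X)"
  and nonempty: "points X \<noteq> {}"
  using rs unfolding riemann_surface_def by blast+

lemma atlas_points: "c \<in> atlas X \<Longrightarrow> p \<in> fst c \<Longrightarrow> p \<in> points X"
  using rs unfolding riemann_surface_def by blast

lemma chart_at:
  assumes "p \<in> points X" shows "chart_at X p \<in> atlas X" "p \<in> fst (chart_at X p)"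
  using someI_ex[of "\<lambda>c. c \<in> atlas X \<and> p \<in> fst c"] atlas_cover[OF assms] unfolding chart_at_def by blast+

lemmas atlas_analytic = compatible_analytic[OF atlas_chart atlas_chart atlas_compatible]

text \<open>Used to tell vertical from horizontal curves in the product as sets: a finite fibre is
  never the whole curve.\<close>

lemma infinite_points: "infinite (points X)"
proof -
  obtain p c where c: "c \<in> atlas X" "p \<in> fst c" using nonempty atlas_cover by blast
  have "infinite (snd c ` fst c)"
    using finite_imp_not_open[of "snd c ` fst c"] chart_open_image[OF atlas_chart[OF c(1)]] c(2) by blast
  then have "infinite (fst c)" by blast
  moreover have "fst c \<subseteq> points X" using atlas_points[OF c(1)] by blast
  ultimately show ?thesis using finite_subset by blast
qed

lemma H10_outside: "\<omega> \<in> H10 X \<Longrightarrow> \<not> (c \<in> atlas X \<and> p \<in> fst c) \<Longrightarrow> \<omega> (c, p) = 0"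
  unfolding H10_def by blast

lemma H10_analytic:
  assumes "\<omega> \<in> H10 X" "c \<in> atlas X" "p \<in> fst c"
  shows "(\<lambda>z. \<omega> (c, chart_inv c z)) analytic_on {snd c p}"
  using assms chart_open_image[OF atlas_chart[OF assms(2)]] unfolding analytic_at H10_def by blast

lemma H10_trans:
  assumes "\<omega> \<in> H10 X" "c \<in> atlas X" "d \<in> atlas X" "p \<in> fst c" "p \<in> fst d"
  shows "\<omega> (c, p) = \<omega> (d, p) * deriv (\<lambda>z. snd d (chart_inv c z)) (snd c p)"
  using assms unfolding H10_def o_def by blast

lemma H10_I:
  assumes "\<And>c p. \<not> (c \<in> atlas X \<and> p \<in> fst c) \<Longrightarrow> \<omega> (c, p) = 0"
    and "\<And>c p. c \<in> atlas X \<Longrightarrow> p \<in> fst c \<Longrightarrow> (\<lambda>z. \<omega> (c, chart_inv c z)) analytic_on {snd c p}"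
    and "\<And>c d p. c \<in> atlas X \<Longrightarrow> d \<in> atlas X \<Longrightarrow> p \<in> fst c \<Longrightarrow> p \<in> fst d \<Longrightarrow>
       \<omega> (c, p) = \<omega> (d, p) * deriv (\<lambda>z. snd d (chart_inv c z)) (snd c p)"
  shows "\<omega> \<in> H10 X"
proof -
  have "(\<lambda>z. \<omega> (c, chart_inv c z)) holomorphic_on (snd c ` fst c)" if "c \<in> atlas X" for c
    using assms(2)[OF that] by (intro holomorphic_onI_analytic_at) auto
  then show ?thesis using assms unfolding H10_def o_def by blast
qed

lemma subspace_H10: "cfun.subspace (H10 X)"
proof (rule cfun.subspaceI)
  show "0 \<in> H10 X" by (rule H10_I) auto
  show "\<omega> + \<eta> \<in> H10 X" if "\<omega> \<in> H10 X" "\<eta> \<in> H10 X" for \<omega> \<eta>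
  proof (rule H10_I)
    show "(\<lambda>z. (\<omega> + \<eta>) (c, chart_inv c z)) analytic_on {snd c p}" if "c \<in> atlas X" "p \<in> fst c" for c p
      using that \<open>\<omega> \<in> H10 X\<close> \<open>\<eta> \<in> H10 X\<close> by (auto intro!: analytic_on_add H10_analytic)
  next
    fix c d p assume "c \<in> atlas X" "d \<in> atlas X" "p \<in> fst c" "p \<in> fst d"
    then show "(\<omega> + \<eta>) (c, p) = (\<omega> + \<eta>) (d, p) * deriv (\<lambda>z. snd d (chart_inv c z)) (snd c p)"
      using H10_trans[OF \<open>\<omega> \<in> H10 X\<close>, of c d p] H10_trans[OF \<open>\<eta> \<in> H10 X\<close>, of c d p]
      by (simp add: algebra_simps)
  next
    fix c p assume n: "\<not> (c \<in> atlas X \<and> p \<in> fst c)"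
    show "(\<omega> + \<eta>) (c, p) = 0"
      using H10_outside[OF that(1) n] H10_outside[OF that(2) n] by simp
  qed
  show "(\<lambda>i. k * \<omega> i) \<in> H10 X" if "\<omega> \<in> H10 X" for k \<omega>
  proof (rule H10_I)
    show "(\<lambda>z. k * \<omega> (c, chart_inv c z)) analytic_on {snd c p}" if "c \<in> atlas X" "p \<in> fst c" for c p
      by (rule analytic_on_mult[OF analytic_on_const H10_analytic[OF \<open>\<omega> \<in> H10 X\<close> that]])
  next
    fix c d p assume "c \<in> atlas X" "d \<in> atlas X" "p \<in> fst c" "p \<in> fst d"
    then show "k * \<omega> (c, p) = k * \<omega> (d, p) * deriv (\<lambda>z. snd d (chart_inv c z)) (snd c p)"
      using H10_trans[OF \<open>\<omega> \<in> H10 X\<close>, of c d p] by simp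
  next
    fix c p assume n: "\<not> (c \<in> atlas X \<and> p \<in> fst c)"
    show "k * \<omega> (c, p) = 0"
      using H10_outside[OF that n] by simp
  qed
qed

lemma coefficient_transition:
  assumes "\<omega> \<in> H10 X" "c \<in> atlas X" "d \<in> atlas X" "p \<in> fst c" "p \<in> fst d"
  shows "\<forall>\<^sub>F z in nhds (snd c p). \<omega> (c, chart_inv c z) =
     (\<lambda>w. \<omega> (d, chart_inv d w)) (snd d (chart_inv c z)) * deriv (\<lambda>z. snd d (chart_inv c z)) z"
proof -
  note cc = atlas_chart[OF assms(2)] and dd = atlas_chart[OF assms(3)]
  have "\<forall>\<^sub>F x in nhdsin (topol X) p. x \<in> fst c \<and> x \<in> fst d"
    using chart_eventually_domain[OF cc assms(4)] chart_eventually_domain[OF dd assms(5)]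
    by (rule eventually_conj)
  then have "\<forall>\<^sub>F z in nhds (snd c p). chart_inv c z \<in> fst c \<and> chart_inv c z \<in> fst d"
    unfolding chart_eventually_iff[OF cc assms(4)] .
  with chart_eventually_image[OF cc assms(4)] show ?thesis
  proof eventually_elim
    case (elim z)
    have "snd c (chart_inv c z) = z" using chart_inv_into(1)[OF elim(1)] .
    then show ?case
      using H10_trans[OF assms(1-3), of "chart_inv c z"] elim(2) chart_inv_left[OF dd, of "chart_inv c z"]
      by simp
  qed
qed

lemma vanishes_to_transition:
  assumes "\<omega> \<in> H10 X" "c \<in> atlas X" "d \<in> atlas X" "p \<in> fst c" "p \<in> fst d"
    and "vanishes_to (\<lambda>z. \<omega> (d, chart_inv d z)) (snd d p) n"
  shows "vanishes_to (\<lambda>z. \<omega> (c, chart_inv c z)) (snd c p) n"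
proof -
  let ?t = "\<lambda>z. snd d (chart_inv c z)"
  have t: "?t analytic_on {snd c p}" "deriv ?t (snd c p) \<noteq> 0"
    using atlas_analytic assms(2-5) by blast+
  have eq: "?t (snd c p) = snd d p" using chart_inv_left[OF atlas_chart[OF assms(2)] assms(4)] by simp
  have "vanishes_to (\<lambda>z. (\<lambda>w. \<omega> (d, chart_inv d w)) (?t z)) (snd c p) n"
    by (rule vanishes_to_compose[OF t]) (use assms(6) eq in simp)
  moreover have "vanishes_to (deriv ?t) (snd c p) 0"
    using vanishes_to_0_iff[OF analytic_deriv[OF t(1)]] t(2) by blast
  ultimately have "vanishes_to (\<lambda>z. (\<lambda>w. \<omega> (d, chart_inv d w)) (?t z) * deriv ?t z) (snd c p) (n + 0)"
    by (rule vanishes_to_mult)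
  then show ?thesis
    using vanishes_to_cong[OF _ coefficient_transition[OF assms(1-5)], of n] by simp
qed

lemma form_zero_transition:
  assumes "\<omega> \<in> H10 X" "c \<in> atlas X" "d \<in> atlas X" "p \<in> fst c" "p \<in> fst d" "\<omega> (d, p) = 0"
  shows "\<omega> (c, p) = 0"
  using H10_trans[OF assms(1-5)] assms(6) by simp

text \<open>Vanishing of a form at a point does not depend on the chart, so the identity principle
  applies to it. A form vanishing at all points is excluded because coefficients off the charts are
  0 by convention, so it would be the zero function.\<close>

lemma form_zeros_isolated:
  assumes "\<omega> \<in> H10 X" "\<omega> \<noteq> 0" "p \<in> points X"
  shows "\<forall>\<^sub>F x in atin (topol X) p. \<not> (\<exists>c\<in>atlas X. x \<in> fst c \<and> \<omega> (c, x) = 0)"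
proof -
  let ?P = "\<lambda>x. \<exists>c\<in>atlas X. x \<in> fst c \<and> \<omega> (c, x) = 0"
  have "(\<forall>\<^sub>F x in nhdsin (topol X) p. ?P x) \<or> (\<forall>\<^sub>F x in atin (topol X) p. \<not> ?P x)"
    if p: "p \<in> points X" for p
  proof -
    obtain c where c: "c \<in> atlas X" "p \<in> fst c" using atlas_cover[OF p] by blast
    note cc = atlas_chart[OF c(1)]
    note an = H10_analytic[OF assms(1) c]
    show ?thesis
    proof (cases "\<forall>\<^sub>F z in nhds (snd c p). \<omega> (c, chart_inv c z) = 0")
      case True
      then have "\<forall>\<^sub>F x in nhdsin (topol X) p. \<omega> (c, x) = 0" unfolding chart_eventually_iff[OF cc c(2)] .
      then have "\<forall>\<^sub>F x in nhdsin (topol X) p. ?P x"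
        using chart_eventually_domain[OF cc c(2)] by eventually_elim (use c in blast)
      then show ?thesis ..
    next
      case False
      then obtain n where "vanishes_to (\<lambda>z. \<omega> (c, chart_inv c z)) (snd c p) n"
        using analytic_at_vanishes_to[OF an] by blast
      from vanishes_to_isolated[OF this]
      have "\<forall>\<^sub>F z in nhds (snd c p). z \<noteq> snd c p \<longrightarrow> \<omega> (c, chart_inv c z) \<noteq> 0"
        unfolding eventually_at_filter by simp
      then have "\<forall>\<^sub>F x in nhdsin (topol X) p. x \<in> fst c \<and>
          (snd c x \<noteq> snd c p \<longrightarrow> \<omega> (c, chart_inv c (snd c x)) \<noteq> 0)"
        unfolding eventually_nhds_chart_iff[OF cc c(2)] .
      then have "\<forall>\<^sub>F x in nhdsin (topol X) p. x \<noteq> p \<longrightarrow> \<not> ?P x"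
      proof eventually_elim
        case (elim x)
        show ?case
        proof
          assume "x \<noteq> p"
          then have "snd c x \<noteq> snd c p" using elim c(2) chart_inj[OF cc] by (meson inj_onD)
          moreover have x: "x \<in> fst c" using elim by simp
          ultimately have "\<omega> (c, x) \<noteq> 0" using elim chart_inv_left[OF cc x] by simp
          then show "\<not> ?P x" using form_zero_transition[OF assms(1) c(1) _ x] by metis
        qed
      qed
      then show ?thesis unfolding eventually_atin_nhdsin by blast
    qed
  qed
  then have "(\<forall>p\<in>points X. ?P p) \<or> (\<forall>p\<in>points X. \<forall>\<^sub>F x in atin (topol X) p. \<not> ?P x)"
    by (rule connected_identity_principle[OF connected])
  moreover have "\<not> (\<forall>p\<in>points X. ?P p)"
  proof
    assume *: "\<forall>p\<in>points X. ?P p"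
    have "\<omega> (c, p) = 0" for c p
    proof (cases "c \<in> atlas X \<and> p \<in> fst c")
      case True
      then obtain d where "d \<in> atlas X" "p \<in> fst d" "\<omega> (d, p) = 0" using * atlas_points by blast
      then show ?thesis using form_zero_transition[OF assms(1)] True by blast
    qed (use H10_outside[OF assms(1)] in blast)
    then have "\<omega> = 0" by (auto simp: fun_eq_iff)
    then show False using assms(2) by contradiction
  qed
  ultimately show ?thesis using assms(3) by blast
qed

text \<open>Turns two incompatible statements on a punctured neighbourhood into a contradiction.
  Read in a chart, it is the fact that points of the plane are not isolated.\<close>

lemma not_isolated:
  assumes "p \<in> points X" shows "atin (topol X) p \<noteq> bot"
proof
  assume "atin (topol X) p = bot"
  then have *: "\<forall>\<^sub>F x in nhdsin (topol X) p. x \<noteq> p \<longrightarrow> False"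
    using eventually_atin_nhdsin[of "\<lambda>_. False" "topol X" p] by (simp del: not_imp)
  obtain c where c: "c \<in> atlas X" "p \<in> fst c" using atlas_cover[OF assms] by blast
  note cc = atlas_chart[OF c(1)]
  have "\<forall>\<^sub>F x in nhdsin (topol X) p. snd c x = snd c p"
    using * by (rule eventually_mono) auto
  then have "\<forall>\<^sub>F z in nhds (snd c p). z = snd c p"
    using chart_eventually_coord_iff[OF cc c(2), of "\<lambda>z. z = snd c p"] by simp
  then have "\<forall>\<^sub>F z in at (snd c p). False" unfolding eventually_at_filter by eventually_elim simp
  then show False by simp
qed

lemma form_vanishing_order_exists:
  assumes "\<omega> \<in> H10 X" "\<omega> \<noteq> 0" "c \<in> atlas X" "p \<in> fst c"
  obtains n where "vanishes_to (\<lambda>z. \<omega> (c, chart_inv c z)) (snd c p) n"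
proof -
  note cc = atlas_chart[OF assms(3)]
  have p: "p \<in> points X" using assms atlas_points by blast
  have "\<not> (\<forall>\<^sub>F z in nhds (snd c p). \<omega> (c, chart_inv c z) = 0)"
  proof
    assume "\<forall>\<^sub>F z in nhds (snd c p). \<omega> (c, chart_inv c z) = 0"
    then have "\<forall>\<^sub>F x in nhdsin (topol X) p. \<omega> (c, x) = 0"
      unfolding chart_eventually_iff[OF cc assms(4)] .
    then have "\<forall>\<^sub>F x in nhdsin (topol X) p. \<exists>c\<in>atlas X. x \<in> fst c \<and> \<omega> (c, x) = 0"
      using chart_eventually_domain[OF cc assms(4)] by eventually_elim (use assms in blast)
    moreover have "\<forall>\<^sub>F x in nhdsin (topol X) p. x \<noteq> p \<longrightarrow> \<not> (\<exists>c\<in>atlas X. x \<in> fst c \<and> \<omega> (c, x) = 0)"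
      using form_zeros_isolated[OF assms(1,2) p] unfolding eventually_atin_nhdsin .
    ultimately have "\<forall>\<^sub>F x in nhdsin (topol X) p. x \<noteq> p \<longrightarrow> False" by eventually_elim blast
    then show False using not_isolated[OF p] eventually_atin_nhdsin[of "\<lambda>_. False" "topol X" p]
      by (simp add: trivial_limit_def)
  qed
  then show ?thesis using analytic_at_vanishes_to[OF H10_analytic[OF assms(1,3,4)]] that by blast
qed

text \<open>The definition asks for one chart only and speaks of \<open>zorder\<close>. For a
  nonzero form an order exists in every chart, and regularity of the transition maps makes these
  orders agree, so any convenient chart may be used from here on.\<close>

lemma has_vanishing_order_iff:
  assumes "\<omega> \<in> H10 X" "\<omega> \<noteq> 0" "c \<in> atlas X" "p \<in> fst c"
  shows "has_vanishing_order X \<omega> p n \<longleftrightarrow> vanishes_to (\<lambda>z. \<omega> (c, chart_inv c z)) (snd c p) n"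
proof
  assume "has_vanishing_order X \<omega> p n"
  then obtain d where d: "d \<in> atlas X" "p \<in> fst d" "zorder (\<lambda>z. \<omega> (d, chart_inv d z)) (snd d p) = int n"
    unfolding has_vanishing_order_def by blast
  obtain k where "vanishes_to (\<lambda>z. \<omega> (d, chart_inv d z)) (snd d p) k"
    using form_vanishing_order_exists[OF assms(1,2) d(1,2)] by blast
  with d(3) have "vanishes_to (\<lambda>z. \<omega> (d, chart_inv d z)) (snd d p) n" using vanishes_to_zorder[of _ "snd d p" k] by simp
  then show "vanishes_to (\<lambda>z. \<omega> (c, chart_inv c z)) (snd c p) n"
    using vanishes_to_transition[OF assms(1,3) d(1) assms(4) d(2)] by blast
next
  assume "vanishes_to (\<lambda>z. \<omega> (c, chart_inv c z)) (snd c p) n"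
  then show "has_vanishing_order X \<omega> p n"
    unfolding has_vanishing_order_def using vanishes_to_zorder assms by blast
qed

lemma closedin_finite: "finite A \<Longrightarrow> A \<subseteq> points X \<Longrightarrow> closedin (topol X) A"
  using iffD1[OF t1_space_closedin_finite Hausdorff_imp_t1_space[OF Hausdorff]] by blast

lemma eventually_avoid_finite:
  assumes "finite A" "A \<subseteq> points X" "x \<in> points X" "x \<notin> A"
  shows "\<forall>\<^sub>F y in nhdsin (topol X) x. y \<notin> A"
proof -
  have "openin (topol X) (points X - A)" using closedin_finite[OF assms(1,2)] unfolding closedin_def by blast
  then have "\<forall>\<^sub>F y in nhdsin (topol X) x. y \<in> points X - A" by (rule eventually_nhdsin_openin) (use assms in simp)
  then show ?thesis by (rule eventually_mono) simp
qed

text \<open>The exceptional set allows forms to be compared that are known only off the poles of a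
  multiplier function. A nonzero difference would have zeros filling a punctured
  neighbourhood.\<close>

lemma forms_eqI:
  assumes "\<omega> \<in> H10 X" "\<eta> \<in> H10 X" "finite N"
    and "\<And>c p. c \<in> atlas X \<Longrightarrow> p \<in> fst c \<Longrightarrow> p \<notin> N \<Longrightarrow> \<omega> (c, p) = \<eta> (c, p)"
  shows "\<omega> = \<eta>"
proof (rule ccontr)
  assume "\<omega> \<noteq> \<eta>"
  then have ne: "\<omega> - \<eta> \<noteq> 0" by simp
  have H: "\<omega> - \<eta> \<in> H10 X" using cfun.subspace_diff[OF subspace_H10 assms(1,2)] .
  obtain p where p: "p \<in> points X" using nonempty by blast
  have "\<forall>\<^sub>F x in nhdsin (topol X) p. x \<notin> N \<inter> points X - {p}"
    by (rule eventually_avoid_finite) (use assms(3) p in auto)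
  moreover have "\<forall>\<^sub>F x in nhdsin (topol X) p. x \<in> points X"
    using p by (rule eventually_nhdsin_openin[OF openin_topspace])
  moreover have "\<forall>\<^sub>F x in nhdsin (topol X) p. x \<noteq> p \<longrightarrow> \<not> (\<exists>c\<in>atlas X. x \<in> fst c \<and> (\<omega> - \<eta>) (c, x) = 0)"
    using form_zeros_isolated[OF H ne p] unfolding eventually_atin_nhdsin .
  ultimately have "\<forall>\<^sub>F x in nhdsin (topol X) p. x \<noteq> p \<longrightarrow> False"
  proof eventually_elim
    case (elim x)
    show ?case
    proof
      assume "x \<noteq> p"
      then have x: "x \<in> points X" "x \<notin> N" using elim by auto
      then obtain c where "c \<in> atlas X" "x \<in> fst c" using atlas_cover by blast
      then show False using elim x assms(4) \<open>x \<noteq> p\<close> by auto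
    qed
  qed
  then show False using not_isolated[OF p] eventually_atin_nhdsin[of "\<lambda>_. False" "topol X" p]
    by (simp add: trivial_limit_def)
qed

end

subsection \<open>Holomorphic maps and pullbacks\<close>

text \<open>Formulated for single charts of arbitrary surfaces because it is also applied to the map
  from the quotient to the projective line.\<close>

lemma holomorphic_map_analytic_chart:
  assumes f: "holomorphic_map S T f" and c: "c \<in> atlas S" "is_chart (topol S) c" "p \<in> fst c"
    and d: "d \<in> atlas T" "openin (topol T) (fst d)" "f p \<in> fst d"
  shows "(\<lambda>z. snd d (f (chart_inv c z))) analytic_on {snd c p}"
    and "\<forall>\<^sub>F x in nhdsin (topol S) p. x \<in> fst c \<and> f x \<in> fst d"
proof -
  let ?U = "{x \<in> points S. f x \<in> fst d}"
  have cp: "fst c \<subseteq> points S" using chart_subset[OF c(2)] .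
  have U: "openin (topol S) ?U" using f d(2) unfolding holomorphic_map_def continuous_map_def by blast
  then have "open (snd c ` (?U \<inter> fst c))" by (rule chart_image_open[OF c(2)])
  moreover have eq: "?U \<inter> fst c = {x \<in> fst c. f x \<in> fst d}" using cp by blast
  moreover have "(\<lambda>z. snd d (f (chart_inv c z))) holomorphic_on (snd c ` {x \<in> fst c. f x \<in> fst d})"
    using f c(1) d(1) unfolding holomorphic_map_def o_def by blast
  ultimately show "(\<lambda>z. snd d (f (chart_inv c z))) analytic_on {snd c p}" unfolding analytic_at using c(3) d(3)
    by (intro exI[of _ "snd c ` {x \<in> fst c. f x \<in> fst d}"]) auto
  have "openin (topol S) (?U \<inter> fst c)" using U chart_openin[OF c(2)] by blast
  then have "\<forall>\<^sub>F x in nhdsin (topol S) p. x \<in> ?U \<inter> fst c"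
    by (rule eventually_nhdsin_openin) (use c d cp in auto)
  then show "\<forall>\<^sub>F x in nhdsin (topol S) p. x \<in> fst c \<and> f x \<in> fst d"
    by (rule eventually_mono) blast
qed

lemma holomorphic_map_analytic:
  assumes X: "riemann_surface X" and Y: "riemann_surface Y" and f: "holomorphic_map X Y f"
    and c: "c \<in> atlas X" "p \<in> fst c" and d: "d \<in> atlas Y" "f p \<in> fst d"
  shows "(\<lambda>z. snd d (f (chart_inv c z))) analytic_on {snd c p}"
    and holomorphic_map_eventually_domain: "\<forall>\<^sub>F x in nhdsin (topol X) p. x \<in> fst c \<and> f x \<in> fst d"
      "\<forall>\<^sub>F z in nhds (snd c p). z \<in> snd c ` fst c \<and> chart_inv c z \<in> fst c \<and> f (chart_inv c z) \<in> fst d"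
proof -
  interpret X: riemann_surface_on X using X by unfold_locales
  interpret Y: riemann_surface_on Y using Y by unfold_locales
  note cc = X.atlas_chart[OF c(1)]
  note chart = holomorphic_map_analytic_chart[OF f c(1) cc c(2) d(1) chart_openin[OF Y.atlas_chart[OF d(1)]] d(2)]
  show "(\<lambda>z. snd d (f (chart_inv c z))) analytic_on {snd c p}" by (rule chart(1))
  show "\<forall>\<^sub>F x in nhdsin (topol X) p. x \<in> fst c \<and> f x \<in> fst d" by (rule chart(2))
  then have "\<forall>\<^sub>F z in nhds (snd c p). chart_inv c z \<in> fst c \<and> f (chart_inv c z) \<in> fst d"
    unfolding chart_eventually_iff[OF cc c(2)] .
  then show "\<forall>\<^sub>F z in nhds (snd c p). z \<in> snd c ` fst c \<and> chart_inv c z \<in> fst c \<and> f (chart_inv c z) \<in> fst d"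
    by (rule eventually_conj[OF chart_eventually_image[OF cc c(2)]])
qed

lemma deriv_holomorphic_map_source:
  assumes X: "riemann_surface X" and Y: "riemann_surface Y" and f: "holomorphic_map X Y f"
    and c: "c \<in> atlas X" "p \<in> fst c" and c': "c' \<in> atlas X" "p \<in> fst c'"
    and d: "d \<in> atlas Y" "f p \<in> fst d"
  shows "deriv (\<lambda>z. snd d (f (chart_inv c z))) (snd c p) =
     deriv (\<lambda>z. snd d (f (chart_inv c' z))) (snd c' p) * deriv (\<lambda>z. snd c' (chart_inv c z)) (snd c p)"
proof -
  interpret X: riemann_surface_on X using X by unfold_locales
  interpret Y: riemann_surface_on Y using Y by unfold_locales
  let ?t = "\<lambda>z. snd c' (chart_inv c z)" and ?F = "\<lambda>z. snd d (f (chart_inv c' z))"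
  have t: "?t analytic_on {snd c p}" using X.atlas_analytic(1)[of c c'] c c' by blast
  have tp: "?t (snd c p) = snd c' p" using chart_inv_left[OF X.atlas_chart[OF c(1)] c(2)] by simp
  have F: "?F analytic_on {?t (snd c p)}" unfolding tp by (rule holomorphic_map_analytic(1)[OF X Y f c' d])
  have "\<forall>\<^sub>F x in nhdsin (topol X) p. x \<in> fst c'" by (rule chart_eventually_domain[OF X.atlas_chart[OF c'(1)] c'(2)])
  then have "\<forall>\<^sub>F z in nhds (snd c p). chart_inv c z \<in> fst c'"
    unfolding chart_eventually_iff[OF X.atlas_chart[OF c(1)] c(2)] .
  then have "\<forall>\<^sub>F z in nhds (snd c p). snd d (f (chart_inv c z)) = ?F (?t z)"
    by eventually_elim (simp add: chart_inv_left[OF X.atlas_chart[OF c'(1)]])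
  then have "deriv (\<lambda>z. snd d (f (chart_inv c z))) (snd c p) = deriv (\<lambda>z. ?F (?t z)) (snd c p)"
    by (rule deriv_cong_ev) simp
  also have "\<dots> = deriv ?F (?t (snd c p)) * deriv ?t (snd c p)" by (rule deriv_compose_analytic[OF t F])
  finally show ?thesis unfolding tp .
qed

lemma deriv_holomorphic_map_target:
  assumes X: "riemann_surface X" and Y: "riemann_surface Y" and f: "holomorphic_map X Y f"
    and c: "c \<in> atlas X" "p \<in> fst c" and d: "d \<in> atlas Y" "f p \<in> fst d" and d': "d' \<in> atlas Y" "f p \<in> fst d'"
  shows "deriv (\<lambda>z. snd d' (f (chart_inv c z))) (snd c p) =
     deriv (\<lambda>z. snd d' (chart_inv d z)) (snd d (f p)) * deriv (\<lambda>z. snd d (f (chart_inv c z))) (snd c p)"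
proof -
  interpret X: riemann_surface_on X using X by unfold_locales
  interpret Y: riemann_surface_on Y using Y by unfold_locales
  let ?t = "\<lambda>z. snd d' (chart_inv d z)" and ?F = "\<lambda>z. snd d (f (chart_inv c z))"
  have F: "?F analytic_on {snd c p}" by (rule holomorphic_map_analytic(1)[OF X Y f c d])
  have Fp: "?F (snd c p) = snd d (f p)" using chart_inv_left[OF X.atlas_chart[OF c(1)] c(2)] by simp
  have t: "?t analytic_on {?F (snd c p)}" unfolding Fp using Y.atlas_analytic(1)[of d d'] d d' by blast
  have "\<forall>\<^sub>F z in nhds (snd c p). snd d' (f (chart_inv c z)) = ?t (?F z)"
    using holomorphic_map_eventually_domain(2)[OF X Y f c d]
    by eventually_elim (simp add: chart_inv_left[OF Y.atlas_chart[OF d(1)]])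
  then have "deriv (\<lambda>z. snd d' (f (chart_inv c z))) (snd c p) = deriv (\<lambda>z. ?t (?F z)) (snd c p)"
    by (rule deriv_cong_ev) simp
  also have "\<dots> = deriv ?t (?F (snd c p)) * deriv ?F (snd c p)" by (rule deriv_compose_analytic[OF F t])
  finally show ?thesis unfolding Fp .
qed

lemma pullback_eq:
  assumes X: "riemann_surface X" and Y: "riemann_surface Y" and f: "holomorphic_map X Y f"
    and \<omega>: "\<omega> \<in> H10 Y"
    and c: "c \<in> atlas X" "p \<in> fst c" and d: "d \<in> atlas Y" "f p \<in> fst d"
  shows "pullback X Y f \<omega> (c, p) = \<omega> (d, f p) * deriv (\<lambda>z. snd d (f (chart_inv c z))) (snd c p)"
proof -
  interpret Y: riemann_surface_on Y using Y by unfold_locales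
  define e where "e = chart_at Y (f p)"
  have e: "e \<in> atlas Y" "f p \<in> fst e" using Y.chart_at Y.atlas_points d unfolding e_def by blast+
  have "pullback X Y f \<omega> (c, p) = \<omega> (e, f p) * deriv (\<lambda>z. snd e (f (chart_inv c z))) (snd c p)"
    using c unfolding pullback_def e_def o_def by simp
  then show ?thesis
    using deriv_holomorphic_map_target[OF X Y f c d e] Y.H10_trans[OF \<omega> d(1) e(1) d(2) e(2)] by simp
qed

lemma pullback_coefficient:
  assumes X: "riemann_surface X" and Y: "riemann_surface Y" and f: "holomorphic_map X Y f"
    and \<omega>: "\<omega> \<in> H10 Y"
    and c: "c \<in> atlas X" "p \<in> fst c" and d: "d \<in> atlas Y" "f p \<in> fst d"
  shows "\<forall>\<^sub>F z in nhds (snd c p). pullback X Y f \<omega> (c, chart_inv c z) =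
     (\<lambda>w. \<omega> (d, chart_inv d w)) (snd d (f (chart_inv c z))) * deriv (\<lambda>z. snd d (f (chart_inv c z))) z"
proof -
  interpret Y: riemann_surface_on Y using Y by unfold_locales
  show ?thesis
    using holomorphic_map_eventually_domain(2)[OF X Y f c d]
  proof eventually_elim
    case (elim z)
    then have "pullback X Y f \<omega> (c, chart_inv c z) =
       \<omega> (d, f (chart_inv c z)) * deriv (\<lambda>z. snd d (f (chart_inv c z))) (snd c (chart_inv c z))"
      by (intro pullback_eq[OF X Y f \<omega> c(1) _ d(1)]) auto
    moreover have "snd c (chart_inv c z) = z" using elim chart_inv_into(1)[of z c] by simp
    moreover have "chart_inv d (snd d (f (chart_inv c z))) = f (chart_inv c z)"
      using chart_inv_left[OF Y.atlas_chart[OF d(1)]] elim by simp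
    ultimately show ?case by simp
  qed
qed

lemma pullback_H10:
  assumes X: "riemann_surface X" and Y: "riemann_surface Y" and f: "holomorphic_map X Y f"
    and \<omega>: "\<omega> \<in> H10 Y"
  shows "pullback X Y f \<omega> \<in> H10 X"
proof -
  interpret X: riemann_surface_on X using X by unfold_locales
  interpret Y: riemann_surface_on Y using Y by unfold_locales
  have ex: "\<exists>d\<in>atlas Y. f p \<in> fst d" if "c \<in> atlas X" "p \<in> fst c" for c p
  proof -
    have "f p \<in> points Y" using f X.atlas_points[OF that] unfolding holomorphic_map_def continuous_map_def by blast
    then show ?thesis using Y.atlas_cover by blast
  qed
  show ?thesis
  proof (rule X.H10_I)
    fix c p assume c: "c \<in> atlas X" "p \<in> fst c"
    obtain d where d: "d \<in> atlas Y" "f p \<in> fst d" using ex[OF c] by blast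
    let ?F = "\<lambda>z. snd d (f (chart_inv c z))"
    have F: "?F analytic_on {snd c p}" by (rule holomorphic_map_analytic(1)[OF X Y f c d])
    have Fp: "?F (snd c p) = snd d (f p)" using chart_inv_left[OF X.atlas_chart[OF c(1)] c(2)] by simp
    have "(\<lambda>w. \<omega> (d, chart_inv d w)) analytic_on {?F (snd c p)}"
      unfolding Fp by (rule Y.H10_analytic[OF \<omega> d])
    then have "(\<lambda>z. (\<lambda>w. \<omega> (d, chart_inv d w)) (?F z)) analytic_on {snd c p}"
      by (rule analytic_at_compose[OF F])
    then have "(\<lambda>z. (\<lambda>w. \<omega> (d, chart_inv d w)) (?F z) * deriv ?F z) analytic_on {snd c p}"
      by (rule analytic_on_mult[OF _ analytic_deriv[OF F]])
    then show "(\<lambda>z. pullback X Y f \<omega> (c, chart_inv c z)) analytic_on {snd c p}"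
      by (rule analytic_at_eventually_eq[OF _ pullback_coefficient[OF X Y f \<omega> c d]])
  next
    fix c c' p assume c: "c \<in> atlas X" "c' \<in> atlas X" "p \<in> fst c" "p \<in> fst c'"
    obtain d where d: "d \<in> atlas Y" "f p \<in> fst d" using ex[OF c(1,3)] by blast
    show "pullback X Y f \<omega> (c, p) = pullback X Y f \<omega> (c', p) * deriv (\<lambda>z. snd c' (chart_inv c z)) (snd c p)"
      using pullback_eq[OF X Y f \<omega> c(1,3) d] pullback_eq[OF X Y f \<omega> c(2,4) d]
        deriv_holomorphic_map_source[OF X Y f c(1,3) c(2,4) d] by simp
  qed (auto simp: pullback_def)
qed

text \<open>The coefficient of the pullback is the substituted coefficient times the derivative of
  the map; the first keeps its order and the second is a unit.\<close>

lemma pullback_vanishes_to: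
  assumes X: "riemann_surface X" and Y: "riemann_surface Y" and f: "holomorphic_map X Y f"
    and \<omega>: "\<omega> \<in> H10 Y"
    and c: "c \<in> atlas X" "p \<in> fst c" and d: "d \<in> atlas Y" "f p \<in> fst d"
    and reg: "deriv (\<lambda>z. snd d (f (chart_inv c z))) (snd c p) \<noteq> 0"
    and van: "vanishes_to (\<lambda>z. \<omega> (d, chart_inv d z)) (snd d (f p)) n"
  shows "vanishes_to (\<lambda>z. pullback X Y f \<omega> (c, chart_inv c z)) (snd c p) n"
proof -
  interpret X: riemann_surface_on X using X by unfold_locales
  let ?F = "\<lambda>z. snd d (f (chart_inv c z))"
  have F: "?F analytic_on {snd c p}" by (rule holomorphic_map_analytic(1)[OF X Y f c d])
  have Fp: "?F (snd c p) = snd d (f p)" using chart_inv_left[OF X.atlas_chart[OF c(1)] c(2)] by simp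
  have "vanishes_to (\<lambda>z. (\<lambda>w. \<omega> (d, chart_inv d w)) (?F z)) (snd c p) n"
    by (rule vanishes_to_compose[OF F reg]) (use van Fp in simp)
  moreover have "vanishes_to (deriv ?F) (snd c p) 0"
    using vanishes_to_0_iff[OF analytic_deriv[OF F]] reg by blast
  ultimately have "vanishes_to (\<lambda>z. (\<lambda>w. \<omega> (d, chart_inv d w)) (?F z) * deriv ?F z) (snd c p) (n + 0)"
    by (rule vanishes_to_mult)
  then show ?thesis
    using vanishes_to_cong[OF _ pullback_coefficient[OF X Y f \<omega> c d], of n] by simp
qed

context riemann_surface_on
begin

text \<open>Removable singularities for forms. The coefficients extend chart by chart; the
  transformation rule at a point of N then follows by continuity from the punctured
  neighbourhood.\<close>

lemma H10_extension:
  fixes \<theta> :: "'a oneform"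
  assumes N: "finite N"
    and an: "\<And>c p. c \<in> atlas X \<Longrightarrow> p \<in> fst c \<Longrightarrow> p \<notin> N \<Longrightarrow> (\<lambda>z. \<theta> (c, chart_inv c z)) analytic_on {snd c p}"
    and sing: "\<And>c p. c \<in> atlas X \<Longrightarrow> p \<in> fst c \<Longrightarrow> p \<in> N \<Longrightarrow>
       \<exists>h. h analytic_on {snd c p} \<and> (\<forall>\<^sub>F z in at (snd c p). \<theta> (c, chart_inv c z) = h z)"
    and trans: "\<And>c d p. c \<in> atlas X \<Longrightarrow> d \<in> atlas X \<Longrightarrow> p \<in> fst c \<Longrightarrow> p \<in> fst d \<Longrightarrow> p \<notin> N \<Longrightarrow>
       \<theta> (c, p) = \<theta> (d, p) * deriv (\<lambda>z. snd d (chart_inv c z)) (snd c p)"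
  obtains \<omega> where "\<omega> \<in> H10 X" "\<And>c p. c \<in> atlas X \<Longrightarrow> p \<in> fst c \<Longrightarrow> p \<notin> N \<Longrightarrow> \<omega> (c, p) = \<theta> (c, p)"
proof -
  \<comment> \<open>The punctured limit is taken at every point, not only on N. Off N it returns the
    value of \<theta>, which is analytic there, so one formula serves everywhere.\<close>
  define \<omega> where "\<omega> = (\<lambda>(c, p). if c \<in> atlas X \<and> p \<in> fst c
     then Lim (at (snd c p)) (\<lambda>z. \<theta> (c, chart_inv c z)) else 0)"
  have ext: "\<exists>h. h analytic_on {snd c p} \<and> (\<forall>\<^sub>F z in at (snd c p). \<theta> (c, chart_inv c z) = h z) \<and>
      (p \<notin> N \<longrightarrow> h (snd c p) = \<theta> (c, p))"
    if "c \<in> atlas X" "p \<in> fst c" for c p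
  proof (cases "p \<in> N")
    case False
    then show ?thesis using an[OF that False] chart_inv_left[OF atlas_chart[OF that(1)] that(2)]
      by (intro exI[of _ "\<lambda>z. \<theta> (c, chart_inv c z)"]) auto
  qed (use sing[OF that] in auto)
  have Lim: "\<omega> (c, p) = h (snd c p)"
    if "c \<in> atlas X" "p \<in> fst c" "h analytic_on {snd c p}" "\<forall>\<^sub>F z in at (snd c p). \<theta> (c, chart_inv c z) = h z" for c p h
  proof -
    have "(h \<longlongrightarrow> h (snd c p)) (at (snd c p))"
      using analytic_at_imp_isCont[OF that(3)] by (simp add: isCont_def)
    then have "((\<lambda>z. \<theta> (c, chart_inv c z)) \<longlongrightarrow> h (snd c p)) (at (snd c p))"
      using tendsto_cong[OF that(4)] by blast
    then have "Lim (at (snd c p)) (\<lambda>z. \<theta> (c, chart_inv c z)) = h (snd c p)"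
      by (rule tendsto_Lim[OF trivial_limit_at])
    then show ?thesis using that(1,2) unfolding \<omega>_def by simp
  qed
  have near: "\<forall>\<^sub>F z in nhds (snd c p). \<omega> (c, chart_inv c z) = h z"
    if c: "c \<in> atlas X" "p \<in> fst c" "h analytic_on {snd c p}" "\<forall>\<^sub>F z in at (snd c p). \<theta> (c, chart_inv c z) = h z" for c p h
  proof -
    \<comment> \<open>Equality near the point gives equality near each neighbouring z as well, so
      the limit that defines \<omega> can be evaluated at z.\<close>
    have "\<forall>\<^sub>F z in nhds (snd c p). \<forall>\<^sub>F w in nhds z. w \<noteq> snd c p \<longrightarrow> \<theta> (c, chart_inv c w) = h w"
      using that(4) unfolding eventually_at_filter eventually_eventually by simp
    then show ?thesis
      using analytic_at_eventually_analytic[OF c(3)] chart_eventually_image[OF atlas_chart[OF c(1)] c(2)]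
    proof eventually_elim
      case (elim z)
      have zz: "snd c (chart_inv c z) = z" "chart_inv c z \<in> fst c" using chart_inv_into[OF elim(3)] by auto
      have "\<forall>\<^sub>F w in at z. \<theta> (c, chart_inv c w) = h w"
      proof (cases "z = snd c p")
        case True
        then show ?thesis using that(4) by simp
      next
        case False
        then have "\<forall>\<^sub>F w in nhds z. w \<noteq> snd c p" by (intro t1_space_nhds) 
        with elim(1) show ?thesis unfolding eventually_at_filter by eventually_elim simp
      qed
      then show ?case using Lim[of c "chart_inv c z" h] c(1) zz elim(2) by simp
    qed
  qed
  have "\<omega> \<in> H10 X"
  proof (rule H10_I)
    show "\<omega> (c, p) = 0" if "\<not> (c \<in> atlas X \<and> p \<in> fst c)" for c p using that unfolding \<omega>_def by auto
    show An: "(\<lambda>z. \<omega> (c, chart_inv c z)) analytic_on {snd c p}" if cp: "c \<in> atlas X" "p \<in> fst c" for c p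
    proof -
      obtain h where h: "h analytic_on {snd c p}" "\<forall>\<^sub>F z in at (snd c p). \<theta> (c, chart_inv c z) = h z"
        using ext[OF cp] by blast
      then show ?thesis using near[OF cp h] by (intro analytic_at_eventually_eq[OF h(1)])
    qed
    fix c d p assume cd: "c \<in> atlas X" "d \<in> atlas X" "p \<in> fst c" "p \<in> fst d"
    note cc = atlas_chart[OF cd(1)] and dd = atlas_chart[OF cd(2)]
    let ?t = "\<lambda>z. snd d (chart_inv c z)"
    let ?R = "\<lambda>z. (\<lambda>w. \<omega> (d, chart_inv d w)) (?t z) * deriv ?t z"
    have t: "?t analytic_on {snd c p}" using atlas_analytic(1)[OF cd(1,2) cd] .
    have tp: "?t (snd c p) = snd d p" using chart_inv_left[OF cc cd(3)] by simp
    have "(\<lambda>z. (\<lambda>w. \<omega> (d, chart_inv d w)) (?t z)) analytic_on {snd c p}"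
      by (rule analytic_at_compose[OF t]) (use An[OF cd(2,4)] tp in simp)
    then have R: "?R analytic_on {snd c p}" by (rule analytic_on_mult[OF _ analytic_deriv[OF t]])
    have "\<forall>\<^sub>F x in nhdsin (topol X) p. x \<notin> N \<inter> points X - {p}"
      by (rule eventually_avoid_finite) (use N atlas_points[OF cd(1,3)] in auto)
    then have "\<forall>\<^sub>F x in nhdsin (topol X) p. (x \<noteq> p \<longrightarrow> x \<notin> N) \<and> x \<in> fst d"
      using chart_eventually_domain[OF dd cd(4)]
      by eventually_elim (use atlas_points[OF cd(2)] in auto)
    then have "\<forall>\<^sub>F z in nhds (snd c p). (chart_inv c z \<noteq> p \<longrightarrow> chart_inv c z \<notin> N) \<and> chart_inv c z \<in> fst d"
      unfolding chart_eventually_iff[OF cc cd(3)] .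
    then have "\<forall>\<^sub>F z in nhds (snd c p). z \<noteq> snd c p \<longrightarrow> \<omega> (c, chart_inv c z) = ?R z"
      using chart_eventually_image[OF cc cd(3)]
    proof eventually_elim
      case (elim z)
      show ?case
      proof
        assume "z \<noteq> snd c p"
        define x where "x = chart_inv c z"
        have x: "snd c x = z" "x \<in> fst c" "x \<in> fst d" using chart_inv_into[OF elim(2)] elim(1) unfolding x_def by auto
        then have "x \<notin> N" using elim \<open>z \<noteq> snd c p\<close> unfolding x_def by metis
        have "\<omega> (e, x) = \<theta> (e, x)" if "e \<in> atlas X" "x \<in> fst e" for e
          using ext[OF that] Lim[OF that] \<open>x \<notin> N\<close> by metis
        then show "\<omega> (c, chart_inv c z) = ?R z"
          using trans[OF cd(1,2) x(2,3) \<open>x \<notin> N\<close>] cd x chart_inv_left[OF dd x(3)] unfolding x_def[symmetric]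
          by simp
      qed
    qed
    then have "\<forall>\<^sub>F z in at (snd c p). \<omega> (c, chart_inv c z) = ?R z" unfolding eventually_at_filter by simp
    moreover have "((\<lambda>z. \<omega> (c, chart_inv c z)) \<longlongrightarrow> \<omega> (c, chart_inv c (snd c p))) (at (snd c p))"
      using analytic_at_imp_isCont[OF An[OF cd(1,3)]] by (simp add: isCont_def)
    ultimately have "(?R \<longlongrightarrow> \<omega> (c, chart_inv c (snd c p))) (at (snd c p))"
      by (simp only: tendsto_cong)
    moreover have "(?R \<longlongrightarrow> ?R (snd c p)) (at (snd c p))"
      using analytic_at_imp_isCont[OF R] by (simp add: isCont_def)
    ultimately have "\<omega> (c, chart_inv c (snd c p)) = ?R (snd c p)" by (rule tendsto_unique[OF trivial_limit_at])
    then show "\<omega> (c, p) = \<omega> (d, p) * deriv ?t (snd c p)"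
      using tp chart_inv_left[OF cc cd(3)] chart_inv_left[OF dd cd(4)] by simp
  qed
  moreover have "\<omega> (c, p) = \<theta> (c, p)" if "c \<in> atlas X" "p \<in> fst c" "p \<notin> N" for c p
    using ext[OF that(1,2)] Lim[OF that(1,2)] that(3) by metis
  ultimately show ?thesis using that by blast
qed

end

subsection \<open>Holomorphic germs in two variables\<close>

text \<open>Germ version of \<open>holomorphic2_on\<close>, written with a filter so that finitely
  many conditions combine without choosing open sets.\<close>

definition hol2_at :: "(complex \<times> complex \<Rightarrow> complex) \<Rightarrow> complex \<times> complex \<Rightarrow> bool" where
  "hol2_at f P \<longleftrightarrow> (\<forall>\<^sub>F Q in nhds P. \<exists>a b. (f has_derivative (\<lambda>(u, v). a * u + b * v)) (at Q))"

lemma hol2_at_iff: "hol2_at f P \<longleftrightarrow> (\<exists>S. open S \<and> P \<in> S \<and> holomorphic2_on f S)"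
  unfolding hol2_at_def holomorphic2_on_def eventually_nhds Ball_def by simp

lemma hol2_at_cong:
  assumes "hol2_at f P" "\<forall>\<^sub>F Q in nhds P. g Q = f Q"
  shows "hol2_at g P"
proof -
  have "\<forall>\<^sub>F Q in nhds P. \<forall>\<^sub>F R in nhds Q. g R = f R"
    using assms(2) by (simp add: eventually_eventually)
  with assms(1)[unfolded hol2_at_def] show ?thesis
    unfolding hol2_at_def
  proof eventually_elim
    case (elim Q)
    then obtain a b where ab: "(f has_derivative (\<lambda>(u, v). a * u + b * v)) (at Q)" by blast
    obtain T where T: "open T" "Q \<in> T" "\<And>R. R \<in> T \<Longrightarrow> f R = g R"
      using elim(2) unfolding eventually_nhds by metis
    show ?case using has_derivative_transform_within_open[OF ab T] by blast
  qed
qed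

lemma hol2_at_const: "hol2_at (\<lambda>_. k) P"
proof -
  have "((\<lambda>_. k) has_derivative (\<lambda>(u, v). 0 * u + 0 * v)) (at Q)" for Q :: "complex \<times> complex"
    by (simp add: case_prod_unfold)
  then show ?thesis unfolding hol2_at_def by (intro always_eventually allI exI)
qed

lemma hol2_at_add:
  assumes "hol2_at f P" "hol2_at g P" shows "hol2_at (\<lambda>Q. f Q + g Q) P"
  using assms unfolding hol2_at_def
proof eventually_elim
  case (elim Q)
  then obtain a b a' b' where "(f has_derivative (\<lambda>(u, v). a * u + b * v)) (at Q)"
    "(g has_derivative (\<lambda>(u, v). a' * u + b' * v)) (at Q)" by blast
  from has_derivative_add[OF this]
  have "((\<lambda>Q. f Q + g Q) has_derivative (\<lambda>(u, v). (a + a') * u + (b + b') * v)) (at Q)"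
    by (simp add: case_prod_unfold algebra_simps)
  then show ?case by blast
qed

lemma hol2_at_mult:
  assumes "hol2_at f P" "hol2_at g P" shows "hol2_at (\<lambda>Q. f Q * g Q) P"
  using assms unfolding hol2_at_def
proof eventually_elim
  case (elim Q)
  then obtain a b a' b' where "(f has_derivative (\<lambda>(u, v). a * u + b * v)) (at Q)"
    "(g has_derivative (\<lambda>(u, v). a' * u + b' * v)) (at Q)" by blast
  from has_derivative_mult[OF this]
  have "((\<lambda>Q. f Q * g Q) has_derivative
      (\<lambda>(u, v). (f Q * a' + a * g Q) * u + (f Q * b' + b * g Q) * v)) (at Q)"
    by (simp add: case_prod_unfold algebra_simps)
  then show ?case by blast
qed

text \<open>Changes of product charts act by one function in each variable, hence the shape of the
  substitution.\<close>

lemma hol2_at_compose: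
  assumes f: "hol2_at f (F z, G w)" and F: "F analytic_on {z}" and G: "G analytic_on {w}"
  shows "hol2_at (\<lambda>Q. f (F (fst Q), G (snd Q))) (z, w)"
proof -
  have "((\<lambda>Q. (F (fst Q), G (snd Q))) \<longlongrightarrow> (F z, G w)) (nhds (z, w))"
  proof (rule tendsto_Pair)
    have "(fst \<longlongrightarrow> z) (nhds (z, w))" "(snd \<longlongrightarrow> w) (nhds (z, w))"
      unfolding nhds_prod by (rule filterlim_fst, rule filterlim_snd)
    then show "((\<lambda>Q. F (fst Q)) \<longlongrightarrow> F z) (nhds (z, w))" "((\<lambda>Q. G (snd Q)) \<longlongrightarrow> G w) (nhds (z, w))"
      using filterlim_compose[OF analytic_at_tendsto[OF F]] filterlim_compose[OF analytic_at_tendsto[OF G]]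
      by blast+
  qed
  then have "\<forall>\<^sub>F Q in nhds (z, w). \<exists>a b. (f has_derivative (\<lambda>(u, v). a * u + b * v)) (at (F (fst Q), G (snd Q)))"
    using f unfolding hol2_at_def filterlim_iff by blast
  moreover have "\<forall>\<^sub>F Q in nhds (z, w). F analytic_on {fst Q} \<and> G analytic_on {snd Q}"
    unfolding nhds_prod
    by (rule eventually_prodI[OF analytic_at_eventually_analytic[OF F] analytic_at_eventually_analytic[OF G]])
  ultimately show ?thesis
    unfolding hol2_at_def
  proof eventually_elim
    case (elim Q)
    obtain a b where ab: "(f has_derivative (\<lambda>(u, v). a * u + b * v)) (at (F (fst Q), G (snd Q)))"
      using elim by blast
    have dF: "(F has_derivative (*) (deriv F (fst Q))) (at (fst Q))"
      and dG: "(G has_derivative (*) (deriv G (snd Q))) (at (snd Q))"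
      using elim analytic_on_imp_differentiable_at has_field_derivative_def
        DERIV_deriv_iff_field_differentiable by blast+
    have 1: "((\<lambda>Q. F (fst Q)) has_derivative (\<lambda>h. deriv F (fst Q) * fst h)) (at Q)"
      using has_derivative_compose[of fst fst Q UNIV F "(*) (deriv F (fst Q))"] dF
      by (simp add: has_derivative_fst)
    have 2: "((\<lambda>Q. G (snd Q)) has_derivative (\<lambda>h. deriv G (snd Q) * snd h)) (at Q)"
      using has_derivative_compose[of snd snd Q UNIV G "(*) (deriv G (snd Q))"] dG
      by (simp add: has_derivative_snd)
    have "((\<lambda>Q. f (F (fst Q), G (snd Q))) has_derivative
        (\<lambda>h. (\<lambda>(u, v). a * u + b * v) (deriv F (fst Q) * fst h, deriv G (snd Q) * snd h))) (at Q)"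
      by (rule has_derivative_compose[OF has_derivative_Pair[OF 1 2] ab])
    then have "((\<lambda>Q. f (F (fst Q), G (snd Q))) has_derivative
        (\<lambda>(u, v). (a * deriv F (fst Q)) * u + (b * deriv G (snd Q)) * v)) (at Q)"
      by (simp add: case_prod_unfold mult.assoc)
    then show ?case by blast
  qed
qed

lemma hol2_at_fst: "F analytic_on {z} \<Longrightarrow> hol2_at (\<lambda>Q. F (fst Q)) (z, w)"
  and hol2_at_snd: "G analytic_on {w} \<Longrightarrow> hol2_at (\<lambda>Q. G (snd Q)) (z, w)"
proof -
  have f: "(fst has_derivative (\<lambda>(u, v). 1 * u + 0 * v)) (at Q)"
    and s: "(snd has_derivative (\<lambda>(u, v). 0 * u + 1 * v)) (at Q)" for Q :: "complex \<times> complex"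
    using has_derivative_fst[OF has_derivative_ident] has_derivative_snd[OF has_derivative_ident]
    by (auto simp: case_prod_unfold)
  have "hol2_at fst P" "hol2_at snd P" for P
    unfolding hol2_at_def using f s by (intro always_eventually allI exI, blast)+
  then show "F analytic_on {z} \<Longrightarrow> hol2_at (\<lambda>Q. F (fst Q)) (z, w)"
    "G analytic_on {w} \<Longrightarrow> hol2_at (\<lambda>Q. G (snd Q)) (z, w)"
    using hol2_at_compose[of fst F z id w] hol2_at_compose[of snd id z G w]
    by (auto simp: analytic_on_id)
qed

lemma norm_circlepath: "0 < r \<Longrightarrow> norm (circlepath z r t - z) = r"
  by (simp add: circlepath norm_mult)

lemma contour_integral_circlepath:
  "contour_integral (circlepath z r) F =
     integral (cbox 0 1) (\<lambda>t. F (circlepath z r t) * (2 * of_real pi * \<i> * (circlepath z r t - z)))"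
proof -
  have "vector_derivative (circlepath z r) (at t) = 2 * of_real pi * \<i> * (circlepath z r t - z)" for t
    unfolding vector_derivative_circlepath unfolding circlepath by simp
  then show ?thesis unfolding contour_integral_integral by simp
qed

text \<open>Cauchy's formula writes the derivative as an integral over a fixed circle whose kernel
  is jointly continuous in the parameter and the point. The result is what differentiation under the
  integral sign in the second variable requires.\<close>

lemma continuous_on_deriv_parameter:
  fixes f :: "'a::topological_space \<Rightarrow> complex \<Rightarrow> complex"
  assumes r: "r > 0" and cont: "continuous_on (S \<times> cball w r) (\<lambda>(z, v). f z v)"
    and hol: "\<And>z. z \<in> S \<Longrightarrow> f z holomorphic_on ball w r"
  shows "continuous_on (S \<times> ball w r) (\<lambda>(z, v). deriv (f z) v)"
proof -
  let ?\<gamma> = "circlepath w r"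
  \<comment> \<open>The last factor is the velocity of the circle; it turns the contour integral
    into an ordinary integral over [0, 1].\<close>
  let ?K = "\<lambda>(p, t). f (fst p) (?\<gamma> t) / (?\<gamma> t - snd p)^2 * (2 * of_real pi * \<i> * (?\<gamma> t - w))"
  have eq: "deriv (f z) v = 1 / (2 * of_real pi * \<i>) * integral (cbox 0 1) (\<lambda>t. ?K ((z, v), t))"
    if "z \<in> S" "v \<in> ball w r" for z v
  proof -
    have "continuous_on (cball w r) (f z)"
    proof -
      have "continuous_on (cball w r) (\<lambda>v. (z, v))"
        by (intro continuous_on_Pair continuous_on_const continuous_on_id)
      then show ?thesis using continuous_on_compose2[OF cont, of "cball w r" "\<lambda>v. (z, v)"] that by auto
    qed
    from Cauchy_derivative_integral_circlepath(2)[OF this hol[OF that(1)] that(2)]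
    show ?thesis by (simp add: DERIV_imp_deriv contour_integral_circlepath)
  qed
  have ne: "?\<gamma> t - v \<noteq> 0" if "v \<in> ball w r" for v t
    using norm_circlepath[OF r, of w t] that by (auto simp: dist_norm norm_minus_commute)
  have g: "continuous_on A ?\<gamma>" for A by (simp add: circlepath continuous_intros)
  have g': "continuous_on A (\<lambda>x. ?\<gamma> (snd x))" for A :: "(('a \<times> complex) \<times> real) set"
    by (rule continuous_on_compose2[OF g[of UNIV]]) (auto intro: continuous_intros)
  have "continuous_on ((S \<times> ball w r) \<times> cbox 0 1) (\<lambda>x. f (fst (fst x)) (?\<gamma> (snd x)))"
  proof -
    have "continuous_on ((S \<times> ball w r) \<times> cbox 0 1) (\<lambda>x. (\<lambda>(z, v). f z v) (fst (fst x), ?\<gamma> (snd x)))"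
    proof (rule continuous_on_compose2[OF cont])
      show "continuous_on ((S \<times> ball w r) \<times> cbox 0 1) (\<lambda>x. (fst (fst x), ?\<gamma> (snd x)))"
        by (intro continuous_intros g')
      have "?\<gamma> t \<in> cball w r" for t
        using norm_circlepath[OF r, of w t] by (simp add: dist_norm norm_minus_commute)
      then show "(\<lambda>x. (fst (fst x), ?\<gamma> (snd x))) ` ((S \<times> ball w r) \<times> cbox 0 1) \<subseteq> S \<times> cball w r"
        by fastforce
    qed
    then show ?thesis by simp
  qed
  then have "continuous_on ((S \<times> ball w r) \<times> cbox 0 1) ?K"
    unfolding case_prod_unfold using ne by (intro continuous_intros g') auto
  then have "continuous_on (S \<times> ball w r) (\<lambda>p. integral (cbox 0 1) (\<lambda>t. ?K (p, t)))"
    using integral_continuous_on_param[of "S \<times> ball w r" 0 1 "\<lambda>p t. ?K (p, t)"] by (simp add: case_prod_unfold)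
  then have "continuous_on (S \<times> ball w r) (\<lambda>p. 1 / (2 * of_real pi * \<i>) * integral (cbox 0 1) (\<lambda>t. ?K (p, t)))"
    by (intro continuous_intros)
  then show ?thesis
    by (rule continuous_on_eq) (use eq in auto)
qed

text \<open>The quotient is \<open>1 / (2 \<pi> \<i>)\<close> times the Cauchy integral of \<open>f (\<zeta>, w) / ((\<zeta> - z\<^sub>0) (\<zeta> - z))\<close> over a
  circle about \<open>z\<^sub>0\<close>; the factor \<open>\<zeta> - z\<^sub>0\<close> cancels against \<open>d\<zeta>\<close>.\<close>

lemma hol2_at_divide_fst:
  assumes f: "hol2_at f (z\<^sub>0, w\<^sub>0)" and zero: "\<forall>\<^sub>F Q in nhds (z\<^sub>0, w\<^sub>0). fst Q = z\<^sub>0 \<longrightarrow> f Q = 0"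
  obtains h where "hol2_at h (z\<^sub>0, w\<^sub>0)" "\<forall>\<^sub>F Q in nhds (z\<^sub>0, w\<^sub>0). f Q = h Q * (fst Q - z\<^sub>0)"
proof -
  let ?d = "\<lambda>Q. \<exists>a b. (f has_derivative (\<lambda>(u, v). a * u + b * v)) (at Q)"
  have "\<forall>\<^sub>F Q in nhds (z\<^sub>0, w\<^sub>0). ?d Q \<and> (fst Q = z\<^sub>0 \<longrightarrow> f Q = 0)"
    using f zero unfolding hol2_at_def by (rule eventually_conj)
  then obtain A B where AB: "eventually A (nhds z\<^sub>0)" "eventually B (nhds w\<^sub>0)"
    "\<And>z w. A z \<Longrightarrow> B w \<Longrightarrow> ?d (z, w) \<and> (z = z\<^sub>0 \<longrightarrow> f (z, w) = 0)"
    unfolding nhds_prod eventually_prod_filter by auto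
  obtain r1 where r1: "r1 > 0" "\<And>z. dist z z\<^sub>0 < r1 \<Longrightarrow> A z" using AB(1) unfolding eventually_nhds_metric by blast
  obtain r2 where r2: "r2 > 0" "\<And>w. dist w w\<^sub>0 < r2 \<Longrightarrow> B w" using AB(2) unfolding eventually_nhds_metric by blast
  define R where "R = min r1 r2"
  \<comment> \<open>Halving the radius puts the closed discs of radius r inside the region where f
    is differentiable.\<close>
  define r where "r = R / 2"
  have R: "0 < R" "0 < r" "r < R" using r1 r2 by (auto simp: R_def r_def)
  have diff: "?d (z, w)" and fz: "f (z\<^sub>0, w) = 0" if "z \<in> ball z\<^sub>0 R" "w \<in> ball w\<^sub>0 R" for z w
    using AB(3)[of z w] AB(3)[of z\<^sub>0 w] r1(2)[of z] r1 r2(2)[of w] that by (auto simp: R_def dist_commute)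
  have sub: "cball a r \<subseteq> ball a R" "ball a r \<subseteq> ball a R" for a :: complex using R by auto
  have contf: "continuous_on (ball z\<^sub>0 R \<times> ball w\<^sub>0 R) f"
    by (rule continuous_at_imp_continuous_on) (use diff has_derivative_continuous in fastforce)
  have fw: "(\<lambda>w. f (z, w)) holomorphic_on ball w\<^sub>0 R" if z: "z \<in> ball z\<^sub>0 R" for z
  proof -
    have "(\<lambda>w. f (z, w)) field_differentiable at w" if w: "w \<in> ball w\<^sub>0 R" for w
    proof -
      obtain a b where ab: "(f has_derivative (\<lambda>(u, v). a * u + b * v)) (at (z, w))" using diff z w by blast
      have "((\<lambda>w. (z, w)) has_derivative (\<lambda>h. (0, h))) (at w)"
        by (intro has_derivative_Pair has_derivative_const has_derivative_ident)
      from has_derivative_compose[OF this ab]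
      have "((\<lambda>w. f (z, w)) has_derivative (*) b) (at w)" by simp
      then show ?thesis unfolding field_differentiable_def has_field_derivative_def by blast
    qed
    then show ?thesis unfolding holomorphic_on_def using field_differentiable_at_within by blast
  qed
  have fzh: "(\<lambda>z. f (z, w)) holomorphic_on ball z\<^sub>0 R" if w: "w \<in> ball w\<^sub>0 R" for w
  proof -
    have "(\<lambda>z. f (z, w)) field_differentiable at z" if z: "z \<in> ball z\<^sub>0 R" for z
    proof -
      obtain a b where ab: "(f has_derivative (\<lambda>(u, v). a * u + b * v)) (at (z, w))" using diff z w by blast
      have "((\<lambda>z. (z, w)) has_derivative (\<lambda>h. (h, 0))) (at z)"
        by (intro has_derivative_Pair has_derivative_const has_derivative_ident)
      from has_derivative_compose[OF this ab]
      have "((\<lambda>z. f (z, w)) has_derivative (*) a) (at z)" by simp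
      then show ?thesis unfolding field_differentiable_def has_field_derivative_def by blast
    qed
    then show ?thesis unfolding holomorphic_on_def using field_differentiable_at_within by blast
  qed
  let ?\<gamma> = "circlepath z\<^sub>0 r"
  define D where "D = (\<lambda>z w. deriv (\<lambda>v. f (z, v)) w)"
  \<comment> \<open>After both cancellations the integrand over [0, 1] carries neither the constant
    2 pi i nor the factor \<open>?\<gamma> t - z\<^sub>0\<close>.\<close>
  define h where "h = (\<lambda>z w. integral (cbox 0 1) (\<lambda>t. f (?\<gamma> t, w) / (?\<gamma> t - z)))"
  have \<gamma>in: "?\<gamma> t \<in> cball z\<^sub>0 r" "?\<gamma> t \<in> ball z\<^sub>0 R" for t
    using norm_circlepath[OF R(2), of z\<^sub>0 t] R(3) by (auto simp: dist_norm norm_minus_commute)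
  have ne: "?\<gamma> t - z \<noteq> 0" if "z \<in> ball z\<^sub>0 r" for z t
    using norm_circlepath[OF R(2), of z\<^sub>0 t] that by (auto simp: dist_norm norm_minus_commute)
  have g: "continuous_on A ?\<gamma>" for A by (simp add: circlepath continuous_intros)
  have g': "continuous_on A (\<lambda>x. ?\<gamma> (snd x))" for A :: "('q::topological_space \<times> real) set"
    by (rule continuous_on_compose2[OF g[of UNIV]]) (auto intro: continuous_intros)
  have contD: "continuous_on (cball z\<^sub>0 r \<times> ball w\<^sub>0 r) (\<lambda>(z, w). D z w)"
    unfolding D_def
  proof (rule continuous_on_deriv_parameter[OF R(2)])
    show "continuous_on (cball z\<^sub>0 r \<times> cball w\<^sub>0 r) (\<lambda>(z, w). f (z, w))"
      using continuous_on_subset[OF contf, of "cball z\<^sub>0 r \<times> cball w\<^sub>0 r"] sub by auto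
    show "(\<lambda>v. f (z, v)) holomorphic_on ball w\<^sub>0 r" if "z \<in> cball z\<^sub>0 r" for z
      using fw[of z] that sub holomorphic_on_subset by blast
  qed
  have fc: "continuous_on (T \<times> cbox 0 1) (\<lambda>x. f (?\<gamma> (snd x), k (fst x)))"
    if "continuous_on T k" "k ` T \<subseteq> ball w\<^sub>0 R" for T :: "'q::topological_space set" and k
  proof (rule continuous_on_compose2[OF contf])
    have "continuous_on (T \<times> cbox 0 1) (\<lambda>x::'q \<times> real. k (fst x))"
      by (rule continuous_on_compose2[OF that(1)]) (auto intro: continuous_intros)
    then show "continuous_on (T \<times> cbox 0 1) (\<lambda>x. (?\<gamma> (snd x), k (fst x)))"
      by (intro continuous_intros g')
    show "(\<lambda>x. (?\<gamma> (snd x), k (fst x))) ` (T \<times> cbox 0 1) \<subseteq> ball z\<^sub>0 R \<times> ball w\<^sub>0 R"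
      using \<gamma>in(2) that(2) by fastforce
  qed
  have Dc: "continuous_on (T \<times> cbox 0 1) (\<lambda>x. D (?\<gamma> (snd x)) (k (fst x)))"
    if "continuous_on T k" "k ` T \<subseteq> ball w\<^sub>0 r" for T :: "'q::topological_space set" and k
  proof -
    have "continuous_on (T \<times> cbox 0 1) (\<lambda>x::'q \<times> real. k (fst x))"
      by (rule continuous_on_compose2[OF that(1)]) (auto intro: continuous_intros)
    then have 1: "continuous_on (T \<times> cbox 0 1) (\<lambda>x. (?\<gamma> (snd x), k (fst x)))"
      by (intro continuous_intros g')
    have 2: "(\<lambda>x. (?\<gamma> (snd x), k (fst x))) ` (T \<times> cbox 0 1) \<subseteq> cball z\<^sub>0 r \<times> ball w\<^sub>0 r"
      using \<gamma>in(1) that(2) by fastforce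
    show ?thesis using continuous_on_compose2[OF contD 1 2] by simp
  qed
  have int: "(\<lambda>t. f (?\<gamma> t, w) / (?\<gamma> t - z)) integrable_on cbox 0 1" if "z \<in> ball z\<^sub>0 r" "w \<in> ball w\<^sub>0 r" for z w
  proof (rule integrable_continuous)
    have "continuous_on (cbox 0 1) (\<lambda>t. f (?\<gamma> t, w))"
    proof (rule continuous_on_compose2[OF contf])
      show "continuous_on (cbox 0 1) (\<lambda>t. (?\<gamma> t, w))" by (intro continuous_intros g)
      show "(\<lambda>t. (?\<gamma> t, w)) ` cbox 0 1 \<subseteq> ball z\<^sub>0 R \<times> ball w\<^sub>0 R" using \<gamma>in(2) that(2) sub(2) by blast
    qed
    then show "continuous_on (cbox 0 1) (\<lambda>t. f (?\<gamma> t, w) / (?\<gamma> t - z))"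
      using ne[OF that(1)] by (intro continuous_intros g) auto
  qed
  have hz: "((\<lambda>z. h z w) has_field_derivative integral (cbox 0 1) (\<lambda>t. f (?\<gamma> t, w) / (?\<gamma> t - z)^2)) (at z within ball z\<^sub>0 r)"
    if z: "z \<in> ball z\<^sub>0 r" and w: "w \<in> ball w\<^sub>0 r" for z w
    unfolding h_def
  proof (rule leibniz_rule_field_derivative[where fx = "\<lambda>z t. f (?\<gamma> t, w) / (?\<gamma> t - z)^2"])
    fix x t assume "x \<in> ball z\<^sub>0 r"
    then show "((\<lambda>x. f (?\<gamma> t, w) / (?\<gamma> t - x)) has_field_derivative f (?\<gamma> t, w) / (?\<gamma> t - x)\<^sup>2) (at x within ball z\<^sub>0 r)"
      using ne[of x t] by (auto intro!: derivative_eq_intros simp: power2_eq_square)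
  next
    have "continuous_on (ball z\<^sub>0 r \<times> cbox 0 1) (\<lambda>x. f (?\<gamma> (snd x), (\<lambda>_. w) (fst x)))"
      by (rule fc[OF continuous_on_const]) (use w sub(2) in blast)
    then show "continuous_on (ball z\<^sub>0 r \<times> cbox 0 1) (\<lambda>(x, t). f (?\<gamma> t, w) / (?\<gamma> t - x)\<^sup>2)"
      unfolding case_prod_unfold using ne by (intro continuous_intros g') auto
    show "(\<lambda>t. f (?\<gamma> t, w) / (?\<gamma> t - x)) integrable_on cbox 0 1" if "x \<in> ball z\<^sub>0 r" for x
      by (rule int[OF that w])
  qed (use z in simp_all)
  have Dder: "((\<lambda>w. f (z, w)) has_field_derivative D z w) (at w within S)" if "z \<in> cball z\<^sub>0 r" "w \<in> ball w\<^sub>0 r" for z w S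
    using fw[of z] that sub holomorphic_derivI[of "\<lambda>w. f (z, w)" "ball w\<^sub>0 R" w] unfolding D_def
    by (meson has_field_derivative_at_within open_ball subsetD)
  have hw: "((\<lambda>w. h z w) has_field_derivative integral (cbox 0 1) (\<lambda>t. D (?\<gamma> t) w / (?\<gamma> t - z))) (at w within ball w\<^sub>0 r)"
    if z: "z \<in> ball z\<^sub>0 r" and w: "w \<in> ball w\<^sub>0 r" for z w
    unfolding h_def
  proof (rule leibniz_rule_field_derivative[where fx = "\<lambda>w t. D (?\<gamma> t) w / (?\<gamma> t - z)"])
    fix x t assume "x \<in> ball w\<^sub>0 r"
    then show "((\<lambda>x. f (?\<gamma> t, x) / (?\<gamma> t - z)) has_field_derivative D (?\<gamma> t) x / (?\<gamma> t - z)) (at x within ball w\<^sub>0 r)"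
      using Dder[OF \<gamma>in(1)] by (intro DERIV_cdivide) blast
  next
    have "continuous_on (ball w\<^sub>0 r \<times> cbox 0 1) (\<lambda>x. D (?\<gamma> (snd x)) (id (fst x)))"
      by (rule Dc[OF continuous_on_id']) auto
    then show "continuous_on (ball w\<^sub>0 r \<times> cbox 0 1) (\<lambda>(x, t). D (?\<gamma> t) x / (?\<gamma> t - z))"
      unfolding case_prod_unfold using ne[OF z] by (intro continuous_intros g') auto
    show "(\<lambda>t. f (?\<gamma> t, x) / (?\<gamma> t - z)) integrable_on cbox 0 1" if "x \<in> ball w\<^sub>0 r" for x
      by (rule int[OF z that])
  qed (use w in simp_all)
  \<comment> \<open>Partial derivatives alone do not give a total derivative; joint continuity of
    the partial derivative in w closes this gap.\<close>
  have conth: "continuous_on (ball z\<^sub>0 r \<times> ball w\<^sub>0 r) (\<lambda>p. integral (cbox 0 1) (\<lambda>t. D (?\<gamma> t) (snd p) / (?\<gamma> t - fst p)))"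
  proof (rule integral_continuous_on_param)
    have "continuous_on ((ball z\<^sub>0 r \<times> ball w\<^sub>0 r) \<times> cbox 0 1) (\<lambda>x. D (?\<gamma> (snd x)) (snd (fst x)))"
      by (rule Dc) (auto intro: continuous_intros)
    then show "continuous_on ((ball z\<^sub>0 r \<times> ball w\<^sub>0 r) \<times> cbox 0 1) (\<lambda>(p, t). D (?\<gamma> t) (snd p) / (?\<gamma> t - fst p))"
      unfolding case_prod_unfold using ne by (intro continuous_intros g') auto
  qed
  have hder: "\<exists>a b. ((\<lambda>(z, w). h z w) has_derivative (\<lambda>(u, v). a * u + b * v)) (at (z, w))"
    if z: "z \<in> ball z\<^sub>0 r" and w: "w \<in> ball w\<^sub>0 r" for z w
  proof -
    let ?a = "integral (cbox 0 1) (\<lambda>t. f (?\<gamma> t, w) / (?\<gamma> t - z)^2)"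
    let ?B = "\<lambda>z w. integral (cbox 0 1) (\<lambda>t. D (?\<gamma> t) w / (?\<gamma> t - z))"
    have "((\<lambda>(z, w). h z w) has_derivative (\<lambda>(u, v). (*) ?a u + blinfun_apply (blinfun_mult_right (?B z w)) v))
        (at (z, w) within ball z\<^sub>0 r \<times> ball w\<^sub>0 r)"
    proof (rule has_derivative_partialsI)
      show "((\<lambda>x. h x w) has_derivative (*) ?a) (at z within ball z\<^sub>0 r)"
        using hz[OF z w] unfolding has_field_derivative_def .
      show "(h x has_derivative blinfun_apply (blinfun_mult_right (?B x y))) (at y within ball w\<^sub>0 r)"
        if "x \<in> ball z\<^sub>0 r" "y \<in> ball w\<^sub>0 r" for x y
        using hw[OF that] unfolding has_field_derivative_def blinfun_mult_right.rep_eq .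
      have "continuous_on (ball z\<^sub>0 r \<times> ball w\<^sub>0 r) (\<lambda>p. blinfun_mult_right (?B (fst p) (snd p)))"
        by (rule bounded_linear.continuous_on[OF bounded_linear_blinfun_mult_right conth])
      then show "continuous (at (z, w) within ball z\<^sub>0 r \<times> ball w\<^sub>0 r) (\<lambda>(x, y). blinfun_mult_right (?B x y))"
        using z w unfolding continuous_on_eq_continuous_within case_prod_unfold by blast
    qed (use w in auto)
    moreover have "at (z, w) within ball z\<^sub>0 r \<times> ball w\<^sub>0 r = at (z, w)"
      using z w by (intro at_within_open open_Times) auto
    ultimately have "((\<lambda>(z, w). h z w) has_derivative (\<lambda>(u, v). ?a * u + ?B z w * v)) (at (z, w))"
      by simp
    then show ?thesis by blast
  qed
  have prod: "f (z, w) = h z w * (z - z\<^sub>0)" if z: "z \<in> ball z\<^sub>0 r" and w: "w \<in> ball w\<^sub>0 r" for z w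
  proof (cases "z = z\<^sub>0")
    case True
    then show ?thesis using fz[of z\<^sub>0 w] w sub R by auto
  next
    case False
    \<comment> \<open>For fixed w the difference quotient, completed at z0 by the derivative, is
      holomorphic. Cauchy's formula for it produces h, because f vanishes on z = z0.\<close>
    let ?q = "\<lambda>z. if z = z\<^sub>0 then deriv (\<lambda>z. f (z, w)) z\<^sub>0 else (f (z, w) - f (z\<^sub>0, w)) / (z - z\<^sub>0)"
    have w': "w \<in> ball w\<^sub>0 R" using w sub by blast
    have "?q holomorphic_on ball z\<^sub>0 R"
      using pole_lemma_open[OF fzh[OF w'] open_ball, of z\<^sub>0] by simp
    then have "?q holomorphic_on cball z\<^sub>0 r" using sub holomorphic_on_subset by blast
    then have "((\<lambda>u. ?q u / (u - z)) has_contour_integral (2 * of_real pi * \<i> * ?q z)) (circlepath z\<^sub>0 r)"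
      by (rule Cauchy_integral_circlepath_simple) (use z in \<open>simp add: dist_norm norm_minus_commute\<close>)
    then have "2 * of_real pi * \<i> * ?q z = contour_integral (circlepath z\<^sub>0 r) (\<lambda>u. ?q u / (u - z))"
      by (simp add: contour_integral_unique)
    also have "\<dots> = integral (cbox 0 1) (\<lambda>t. ?q (?\<gamma> t) / (?\<gamma> t - z) * (2 * of_real pi * \<i> * (?\<gamma> t - z\<^sub>0)))"
      by (rule contour_integral_circlepath)
    also have "\<dots> = integral (cbox 0 1) (\<lambda>t. 2 * of_real pi * \<i> * (f (?\<gamma> t, w) / (?\<gamma> t - z)))"
    proof (rule integral_cong)
      fix t
      have "?\<gamma> t - z\<^sub>0 \<noteq> 0" using norm_circlepath[OF R(2), of z\<^sub>0 t] R by auto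
      then show "?q (?\<gamma> t) / (?\<gamma> t - z) * (2 * of_real pi * \<i> * (?\<gamma> t - z\<^sub>0)) = 2 * of_real pi * \<i> * (f (?\<gamma> t, w) / (?\<gamma> t - z))"
        using fz[of z\<^sub>0 w] w' R by simp
    qed
    also have "\<dots> = 2 * of_real pi * \<i> * h z w"
      unfolding h_def by (rule integral_mult_right)
    finally have "?q z = h z w" by simp
    then show ?thesis using False fz[of z\<^sub>0 w] w' R by (auto simp: field_simps)
  qed
  have ev: "\<forall>\<^sub>F Q in nhds (z\<^sub>0, w\<^sub>0). fst Q \<in> ball z\<^sub>0 r \<and> snd Q \<in> ball w\<^sub>0 r"
  proof -
    have "open (ball z\<^sub>0 r \<times> ball w\<^sub>0 r)" by (intro open_Times open_ball)
    then have "\<forall>\<^sub>F Q in nhds (z\<^sub>0, w\<^sub>0). Q \<in> ball z\<^sub>0 r \<times> ball w\<^sub>0 r"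
      by (rule eventually_nhds_in_open) (use R in auto)
    then show ?thesis by (rule eventually_mono) auto
  qed
  show ?thesis
  proof (rule that[of "\<lambda>(z, w). h z w"])
    show "hol2_at (\<lambda>(z, w). h z w) (z\<^sub>0, w\<^sub>0)"
      unfolding hol2_at_def using ev by (rule eventually_mono) (use hder in auto)
    show "\<forall>\<^sub>F Q in nhds (z\<^sub>0, w\<^sub>0). f Q = (\<lambda>(z, w). h z w) Q * (fst Q - z\<^sub>0)"
      using ev by (rule eventually_mono) (use prod in auto)
  qed
qed

lemma hol2_at_swap:
  assumes "hol2_at f (z, w)" shows "hol2_at (\<lambda>Q. f (snd Q, fst Q)) (w, z)"
proof -
  have "((\<lambda>Q. (snd Q, fst Q)) \<longlongrightarrow> (z, w)) (nhds (w, z))"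
    unfolding nhds_prod by (intro filterlim_Pair filterlim_fst filterlim_snd)
  then have "\<forall>\<^sub>F Q in nhds (w, z). \<exists>a b. (f has_derivative (\<lambda>(u, v). a * u + b * v)) (at (snd Q, fst Q))"
    using assms unfolding hol2_at_def nhds_prod filterlim_iff by blast
  then show ?thesis
    unfolding hol2_at_def
  proof eventually_elim
    case (elim Q)
    then obtain a b where ab: "(f has_derivative (\<lambda>(u, v). a * u + b * v)) (at (snd Q, fst Q))" by blast
    have "((\<lambda>Q. (snd Q, fst Q)) has_derivative (\<lambda>h. (snd h, fst h))) (at Q)"
      by (intro has_derivative_Pair has_derivative_snd has_derivative_fst has_derivative_ident)
    from has_derivative_compose[OF this ab]
    have "((\<lambda>Q. f (snd Q, fst Q)) has_derivative (\<lambda>(u, v). b * u + a * v)) (at Q)"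
      by (simp add: case_prod_unfold add.commute)
    then show ?case by blast
  qed
qed

lemma eventually_nhds_swap:
  assumes "\<forall>\<^sub>F Q in nhds (z, w). P Q" shows "\<forall>\<^sub>F Q in nhds (w, z). P (snd Q, fst Q)"
proof -
  have "((\<lambda>Q. (snd Q, fst Q)) \<longlongrightarrow> (z, w)) (nhds (w, z))"
    unfolding nhds_prod by (intro filterlim_Pair filterlim_fst filterlim_snd)
  then show ?thesis using assms unfolding filterlim_iff by blast
qed

text \<open>Reduced to the first variable by exchanging the two factors.\<close>

lemma hol2_at_divide_snd:
  assumes f: "hol2_at f (z\<^sub>0, w\<^sub>0)" and zero: "\<forall>\<^sub>F Q in nhds (z\<^sub>0, w\<^sub>0). snd Q = w\<^sub>0 \<longrightarrow> f Q = 0"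
  obtains h where "hol2_at h (z\<^sub>0, w\<^sub>0)" "\<forall>\<^sub>F Q in nhds (z\<^sub>0, w\<^sub>0). f Q = h Q * (snd Q - w\<^sub>0)"
proof -
  have "\<forall>\<^sub>F Q in nhds (w\<^sub>0, z\<^sub>0). fst Q = w\<^sub>0 \<longrightarrow> f (snd Q, fst Q) = 0"
    using eventually_nhds_swap[OF zero] by simp
  then obtain h where h: "hol2_at h (w\<^sub>0, z\<^sub>0)"
    "\<forall>\<^sub>F Q in nhds (w\<^sub>0, z\<^sub>0). f (snd Q, fst Q) = h Q * (fst Q - w\<^sub>0)"
    using hol2_at_divide_fst[OF hol2_at_swap[OF f]] by blast
  show ?thesis
    using that[OF hol2_at_swap[OF h(1)]] eventually_nhds_swap[OF h(2)] by simp
qed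

subsection \<open>Finite group actions on compact Riemann surfaces\<close>

locale curve_action = riemann_surface_on X + group G
  for X :: "'a surface" and G :: "('g, 'm) monoid_scheme" (structure) +
  fixes \<phi> :: "'g \<Rightarrow> 'a \<Rightarrow> 'a"
  assumes compact: "compact_space (topol X)"
    and finite_group: "finite (carrier G)"
    and faithful_on: "acts_faithfully_on G \<phi> X"
begin

sublocale faithful_action G "points X" \<phi>
  using faithful_on unfolding acts_faithfully_on_def by blast

lemma act_holomorphic: "g \<in> carrier G \<Longrightarrow> holomorphic_map X X (\<phi> g)"
  using faithful_on unfolding acts_faithfully_on_def by blast

lemma act_continuous: "g \<in> carrier G \<Longrightarrow> continuous_map (topol X) (topol X) (\<phi> g)"
  using act_holomorphic unfolding holomorphic_map_def by blast

lemma act_points: "g \<in> carrier G \<Longrightarrow> x \<in> points X \<Longrightarrow> \<phi> g x \<in> points X"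
  using element_image by blast

lemma act_one: "x \<in> points X \<Longrightarrow> \<phi> \<one> x = x"
  using id_eq_one by (metis restrict_apply')

lemma act_mult: "g \<in> carrier G \<Longrightarrow> h \<in> carrier G \<Longrightarrow> x \<in> points X \<Longrightarrow> \<phi> (g \<otimes> h) x = \<phi> g (\<phi> h x)"
  using composition_rule by blast

lemma act_inv: "g \<in> carrier G \<Longrightarrow> x \<in> points X \<Longrightarrow> \<phi> (inv g) (\<phi> g x) = x"
  using act_mult[of "inv g" g x] act_one by simp

lemma act_openin:
  assumes "g \<in> carrier G" "openin (topol X) U"
  shows "openin (topol X) {x \<in> points X. \<phi> g x \<in> U}"
  using act_continuous[OF assms(1)] assms(2) unfolding continuous_map_def by blast

lemma separate:
  assumes "p \<in> points X" "q \<in> points X" "p \<noteq> q"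
  obtains U V where "openin (topol X) U" "openin (topol X) V" "p \<in> U" "q \<in> V" "U \<inter> V = {}"
  using Hausdorff assms unfolding Hausdorff_space_def disjnt_def by metis

lemma moved_nbhd:
  assumes g: "g \<in> carrier G" and p: "p \<in> points X" and "\<phi> g p \<noteq> p"
  obtains N where "openin (topol X) N" "p \<in> N" "\<And>x. x \<in> N \<Longrightarrow> \<phi> g x \<notin> N"
proof -
  obtain U V where UV: "openin (topol X) U" "openin (topol X) V" "p \<in> U" "\<phi> g p \<in> V" "U \<inter> V = {}"
    using separate[OF p act_points[OF g p]] assms(3) by metis
  show ?thesis
  proof (rule that)
    show "openin (topol X) (U \<inter> {x \<in> points X. \<phi> g x \<in> V})"
      using UV act_openin[OF g] by blast
  qed (use UV p in auto)
qed

text \<open>Near a fixed point, the fixed points are the zeros of the analytic function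
  \<open>?F\<close>, so they are isolated or fill a neighbourhood. In the second case connectedness
  makes g act as the identity, against faithfulness.\<close>

lemma fixed_points_isolated:
  assumes g: "g \<in> carrier G" "g \<noteq> \<one>" and p: "p \<in> points X"
  shows "\<forall>\<^sub>F x in atin (topol X) p. \<phi> g x \<noteq> x"
proof -
  have "(\<forall>\<^sub>F x in nhdsin (topol X) p. \<phi> g x = x) \<or> (\<forall>\<^sub>F x in atin (topol X) p. \<not> \<phi> g x = x)"
    if p: "p \<in> points X" for p
  proof (cases "\<phi> g p = p")
    case False
    obtain N where N: "openin (topol X) N" "p \<in> N" "\<And>x. x \<in> N \<Longrightarrow> \<phi> g x \<notin> N"
      using moved_nbhd[OF g(1) p False] by blast
    have "\<forall>\<^sub>F x in nhdsin (topol X) p. x \<in> N" by (rule eventually_nhdsin_openin[OF N(1,2)])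
    then have "\<forall>\<^sub>F x in nhdsin (topol X) p. x \<noteq> p \<longrightarrow> \<phi> g x \<noteq> x"
      by (rule eventually_mono) (use N(3) in metis)
    then show ?thesis unfolding eventually_atin_nhdsin by simp
  next
    case True
    obtain c where c: "c \<in> atlas X" "p \<in> fst c" using atlas_cover[OF p] by blast
    note cc = atlas_chart[OF c(1)]
    have c': "\<phi> g p \<in> fst c" using c True by simp
    let ?F = "\<lambda>z. snd c (\<phi> g (chart_inv c z)) - z"
    have an: "?F analytic_on {snd c p}"
      by (intro analytic_intros holomorphic_map_analytic(1)[OF rs rs act_holomorphic[OF g(1)] c c(1) c'])
    have dom: "\<forall>\<^sub>F x in nhdsin (topol X) p. x \<in> fst c \<and> \<phi> g x \<in> fst c"
      by (rule holomorphic_map_eventually_domain(1)[OF rs rs act_holomorphic[OF g(1)] c c(1) c'])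
    have iff: "\<phi> g x = x \<longleftrightarrow> ?F (snd c x) = 0" if "x \<in> fst c \<and> \<phi> g x \<in> fst c" for x
      using that chart_inv_left[OF cc, of x] inj_onD[OF chart_inj[OF cc], of "\<phi> g x" x] by auto
    show ?thesis
    proof (cases "\<forall>\<^sub>F z in nhds (snd c p). ?F z = 0")
      case True
      then have "\<forall>\<^sub>F x in nhdsin (topol X) p. ?F (snd c x) = 0"
        unfolding chart_eventually_coord_iff[OF cc c(2), of "\<lambda>z. ?F z = 0"] .
      with dom have "\<forall>\<^sub>F x in nhdsin (topol X) p. \<phi> g x = x"
        by eventually_elim (use iff in blast)
      then show ?thesis ..
    next
      case False
      then obtain n where "vanishes_to ?F (snd c p) n" using analytic_at_vanishes_to[OF an] by blast
      from vanishes_to_isolated[OF this]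
      have "\<forall>\<^sub>F z in nhds (snd c p). z \<noteq> snd c p \<longrightarrow> ?F z \<noteq> 0" unfolding eventually_at_filter by simp
      then have "\<forall>\<^sub>F x in nhdsin (topol X) p. snd c x \<noteq> snd c p \<longrightarrow> ?F (snd c x) \<noteq> 0"
        unfolding chart_eventually_coord_iff[OF cc c(2), of "\<lambda>z. z \<noteq> snd c p \<longrightarrow> ?F z \<noteq> 0"] .
      with dom have "\<forall>\<^sub>F x in nhdsin (topol X) p. x \<noteq> p \<longrightarrow> \<phi> g x \<noteq> x"
      proof eventually_elim
        case (elim x)
        then show ?case using iff[OF elim(1)] inj_onD[OF chart_inj[OF cc], of x p] c(2) by blast
      qed
      then show ?thesis unfolding eventually_atin_nhdsin by simp
    qed
  qed
  then have "(\<forall>p\<in>points X. \<phi> g p = p) \<or> (\<forall>p\<in>points X. \<forall>\<^sub>F x in atin (topol X) p. \<not> \<phi> g x = x)"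
    by (rule connected_identity_principle[OF connected])
  moreover have "\<not> (\<forall>p\<in>points X. \<phi> g p = p)"
  proof
    assume "\<forall>p\<in>points X. \<phi> g p = p"
    \<comment> \<open>The action maps into bijections that are extensional on the points, so
      agreement on points is equality of functions, and injectivity of the action applies.\<close>
    then have "\<phi> g = \<phi> \<one>"
      using bij_prop0[OF g(1)] bij_prop0[OF one_closed] act_one unfolding Bij_def
      by (intro extensionalityI[of _ "points X"]) auto
    then show False using faithful g one_closed unfolding inj_on_def by blast
  qed
  ultimately show ?thesis using p by blast
qed

lemma finite_fixed_points:
  "g \<in> carrier G \<Longrightarrow> g \<noteq> \<one> \<Longrightarrow> finite {x \<in> points X. \<phi> g x = x}"
  using compact_space_discrete_finite[OF compact, of "\<lambda>x. \<phi> g x = x"] fixed_points_isolated by blast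

text \<open>The local form of faithfulness: fixed points of any other element are isolated, while no
  point of the surface is.\<close>

lemma locally_trivial_imp_one:
  assumes "g \<in> carrier G" "openin (topol X) U" "p \<in> U" "\<And>x. x \<in> U \<Longrightarrow> \<phi> g x = x"
  shows "g = \<one>"
proof (rule ccontr)
  assume "g \<noteq> \<one>"
  have p: "p \<in> points X" using assms openin_subset by blast
  have "\<forall>\<^sub>F x in nhdsin (topol X) p. x \<in> U" by (rule eventually_nhdsin_openin[OF assms(2,3)])
  moreover have "\<forall>\<^sub>F x in nhdsin (topol X) p. x \<noteq> p \<longrightarrow> \<phi> g x \<noteq> x"
    using fixed_points_isolated[OF assms(1) \<open>g \<noteq> \<one>\<close> p] unfolding eventually_atin_nhdsin .
  ultimately have "\<forall>\<^sub>F x in nhdsin (topol X) p. x \<noteq> p \<longrightarrow> False"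
    by eventually_elim (use assms(4) in blast)
  then show False using not_isolated[OF p] eventually_atin_nhdsin[of "\<lambda>_. False" "topol X" p]
    by (simp add: trivial_limit_def)
qed

section \<open>Stabilizers, multipliers and linearising coordinates\<close>

abbreviation Stab where "Stab p \<equiv> stabilizer G \<phi> p"

lemma stab_iff: "g \<in> Stab p \<longleftrightarrow> g \<in> carrier G \<and> \<phi> g p = p"
  unfolding stabilizer_def by blast

lemma finite_stab: "finite (Stab p)"
  using finite_group finite_subset stabilizer_subset by blast

text \<open>The character by which the stabilizer of p acts on the tangent line at p. As s fixes p,
  one chart can be used for both source and target.\<close>

definition multiplier :: "'a \<Rightarrow> 'g \<Rightarrow> complex" where
  "multiplier p s = deriv (\<lambda>z. snd (chart_at X p) (\<phi> s (chart_inv (chart_at X p) z))) (snd (chart_at X p) p)"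

text \<open>The chain rule for the action of g followed by that of its inverse gives the value
  1.\<close>

lemma act_regular:
  assumes g: "g \<in> carrier G" and c: "c \<in> atlas X" "p \<in> fst c" and d: "d \<in> atlas X" "\<phi> g p \<in> fst d"
  shows "deriv (\<lambda>z. snd d (\<phi> g (chart_inv c z))) (snd c p) \<noteq> 0"
proof -
  note cc = atlas_chart[OF c(1)] and dd = atlas_chart[OF d(1)]
  have p: "p \<in> points X" using atlas_points[OF c] .
  let ?F = "\<lambda>z. snd d (\<phi> g (chart_inv c z))"
  have F: "?F analytic_on {snd c p}" by (rule holomorphic_map_analytic(1)[OF rs rs act_holomorphic[OF g] c d])
  have c': "\<phi> (inv g) (\<phi> g p) \<in> fst c" using act_inv[OF g p] c by simp
  let ?H = "\<lambda>z. snd c (\<phi> (inv g) (chart_inv d z))"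
  have Fp: "?F (snd c p) = snd d (\<phi> g p)" using chart_inv_left[OF cc c(2)] by simp
  have H: "?H analytic_on {?F (snd c p)}"
    unfolding Fp by (rule holomorphic_map_analytic(1)[OF rs rs act_holomorphic[OF inv_closed[OF g]] d c(1) c'])
  have "\<forall>\<^sub>F z in nhds (snd c p). ?H (?F z) = z"
    using holomorphic_map_eventually_domain(2)[OF rs rs act_holomorphic[OF g] c d]
  proof eventually_elim
    case (elim z)
    then have "chart_inv d (?F z) = \<phi> g (chart_inv c z)" using chart_inv_left[OF dd] by simp
    moreover have "chart_inv c z \<in> points X" using elim atlas_points[OF c(1)] by simp
    ultimately show ?case using act_inv[OF g] elim chart_inv_into(1)[of z c] by simp
  qed
  then have "deriv (\<lambda>z. ?H (?F z)) (snd c p) = deriv (\<lambda>z. z) (snd c p)" by (rule deriv_cong_ev) simp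
  moreover have "deriv (\<lambda>z. ?H (?F z)) (snd c p) = deriv ?H (?F (snd c p)) * deriv ?F (snd c p)"
    by (rule deriv_compose_analytic[OF F H])
  ultimately show ?thesis by auto
qed

lemma multiplier_mult:
  assumes p: "p \<in> points X" and s: "s \<in> Stab p" and t: "t \<in> Stab p"
  shows "multiplier p (s \<otimes> t) = multiplier p s * multiplier p t"
proof -
  define c where "c = chart_at X p"
  have c: "c \<in> atlas X" "p \<in> fst c" using chart_at[OF p] unfolding c_def by auto
  note cc = atlas_chart[OF c(1)]
  have sp: "s \<in> carrier G" "\<phi> s p = p" and tp: "t \<in> carrier G" "\<phi> t p = p" using s t stab_iff by auto
  let ?F = "\<lambda>s z. snd c (\<phi> s (chart_inv c z))"
  have F: "?F t analytic_on {snd c p}"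
    by (rule holomorphic_map_analytic(1)[OF rs rs act_holomorphic[OF tp(1)] c c(1)]) (use tp c in simp)
  have Fp: "?F t (snd c p) = snd c p" using chart_inv_left[OF cc c(2)] tp by simp
  have H: "?F s analytic_on {?F t (snd c p)}"
    unfolding Fp by (rule holomorphic_map_analytic(1)[OF rs rs act_holomorphic[OF sp(1)] c c(1)]) (use sp c in simp)
  have "\<forall>\<^sub>F z in nhds (snd c p). z \<in> snd c ` fst c \<and> chart_inv c z \<in> fst c \<and> \<phi> t (chart_inv c z) \<in> fst c"
    by (rule holomorphic_map_eventually_domain(2)[OF rs rs act_holomorphic[OF tp(1)] c c(1)]) (use tp c in simp)
  then have "\<forall>\<^sub>F z in nhds (snd c p). ?F (s \<otimes> t) z = ?F s (?F t z)"
  proof eventually_elim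
    case (elim z)
    then have "chart_inv c z \<in> points X" using atlas_points[OF c(1)] by simp
    then show ?case using act_mult[OF sp(1) tp(1)] elim chart_inv_left[OF cc] by simp
  qed
  then have "deriv (?F (s \<otimes> t)) (snd c p) = deriv (\<lambda>z. ?F s (?F t z)) (snd c p)" by (rule deriv_cong_ev) simp
  also have "\<dots> = deriv (?F s) (?F t (snd c p)) * deriv (?F t) (snd c p)"
    by (rule deriv_compose_analytic[OF F H])
  finally show ?thesis unfolding multiplier_def c_def[symmetric] Fp .
qed

lemma multiplier_nonzero:
  assumes "p \<in> points X" "s \<in> Stab p" shows "multiplier p s \<noteq> 0"
  unfolding multiplier_def using assms chart_at[OF assms(1)] by (intro act_regular) (auto simp: stab_iff)

lemma multiplier_one: assumes "p \<in> points X" shows "multiplier p \<one> = 1"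
  using multiplier_mult[OF assms, of \<one> \<one>] multiplier_nonzero[OF assms, of \<one>] stabilizer_one_closed[OF assms]
  by simp

text \<open>In such a neighbourhood two points of one orbit differ by an element of the stabilizer
  of p, so near p only the stabilizer matters for the quotient. Finiteness of the group allows the
  neighbourhoods from \<open>moved_nbhd\<close> to be intersected.\<close>

lemma free_nbhd:
  assumes p: "p \<in> points X"
  obtains N where "openin (topol X) N" "p \<in> N" "\<And>g x. g \<in> carrier G \<Longrightarrow> g \<notin> Stab p \<Longrightarrow> x \<in> N \<Longrightarrow> \<phi> g x \<notin> N"
proof -
  have "\<exists>N. openin (topol X) N \<and> p \<in> N \<and> (\<forall>g\<in>F. \<forall>x\<in>N. \<phi> g x \<notin> N)"
    if "finite F" "F \<subseteq> carrier G - Stab p" for F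
    using that
  proof (induction F)
    case empty
    then show ?case using p by (intro exI[of _ "points X"]) auto
  next
    case (insert g F)
    then obtain N where N: "openin (topol X) N" "p \<in> N" "\<forall>g\<in>F. \<forall>x\<in>N. \<phi> g x \<notin> N" by auto
    obtain M where M: "openin (topol X) M" "p \<in> M" "\<And>x. x \<in> M \<Longrightarrow> \<phi> g x \<notin> M"
      using moved_nbhd[of g p] insert.prems p stab_iff by auto
    show ?case using N M by (intro exI[of _ "N \<inter> M"]) auto
  qed
  from this[of "carrier G - Stab p"] finite_group show ?thesis using that by auto
qed

text \<open>The chart coordinate centred at p, projected by a weighted sum onto the functions that
  transform by the multiplier. The sum is not divided by the order of the stabilizer; that would
  only rescale the coordinate.\<close>

definition lin_coord :: "'a \<Rightarrow> 'a \<Rightarrow> complex" where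
  "lin_coord p x = (\<Sum>s\<in>Stab p. inverse (multiplier p s) * (snd (chart_at X p) (\<phi> s x) - snd (chart_at X p) p))"

text \<open>Right translation by t permutes the stabilizer, and multiplicativity of the multiplier
  lets the factor for t be pulled out of the reindexed sum.\<close>

lemma lin_coord_equivariant:
  assumes p: "p \<in> points X" and x: "x \<in> points X" and t: "t \<in> Stab p"
  shows "lin_coord p (\<phi> t x) = multiplier p t * lin_coord p x"
proof -
  interpret S: subgroup "Stab p" G by (rule stabilizer_subgroup[OF p])
  have t': "t \<in> carrier G" using t S.subset by blast
  let ?d = "\<lambda>s. snd (chart_at X p) (\<phi> s x) - snd (chart_at X p) p"
  have "lin_coord p (\<phi> t x) = (\<Sum>s\<in>Stab p. inverse (multiplier p s) * ?d (s \<otimes> t))"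
    unfolding lin_coord_def using t' x S.subset act_mult by (intro sum.cong) (auto simp: subset_iff)
  also have "\<dots> = (\<Sum>s\<in>Stab p. multiplier p t * (inverse (multiplier p (s \<otimes> t)) * ?d (s \<otimes> t)))"
    using multiplier_mult[OF p _ t] multiplier_nonzero[OF p t] multiplier_nonzero[OF p]
    by (intro sum.cong) (auto simp: field_simps)
  also have "\<dots> = (\<Sum>s\<in>Stab p. multiplier p t * (inverse (multiplier p s) * ?d s))"
  proof (rule sum.reindex_bij_witness[of _ "\<lambda>s. s \<otimes> inv t" "\<lambda>s. s \<otimes> t"])
    fix s assume s: "s \<in> Stab p"
    then have "s \<in> carrier G" using S.subset by blast
    then show "s \<otimes> t \<otimes> inv t = s" "s \<otimes> inv t \<otimes> t = s" using t' by (simp_all add: m_assoc)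
    show "s \<otimes> t \<in> Stab p" "s \<otimes> inv t \<in> Stab p" using s t by auto
  qed auto
  finally show ?thesis unfolding lin_coord_def by (simp add: sum_distrib_left)
qed

lemma lin_coord_self: "p \<in> points X \<Longrightarrow> lin_coord p p = 0"
  unfolding lin_coord_def by (rule sum.neutral) (auto simp: stab_iff)

text \<open>Every summand contributes an inverse multiplier times the same multiplier, so the
  derivative at p is the order of the stabilizer.\<close>

lemma lin_coord_deriv:
  assumes p: "p \<in> points X" and c: "c = chart_at X p"
  shows "(\<lambda>z. lin_coord p (chart_inv c z)) analytic_on {snd c p}"
    and "deriv (\<lambda>z. lin_coord p (chart_inv c z)) (snd c p) \<noteq> 0"
proof -
  have cp: "c \<in> atlas X" "p \<in> fst c" using chart_at[OF p] c by auto
  let ?F = "\<lambda>s z. snd c (\<phi> s (chart_inv c z))"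
  have F: "?F s analytic_on {snd c p}" if "s \<in> Stab p" for s
    by (rule holomorphic_map_analytic(1)[OF rs rs act_holomorphic cp cp(1)]) (use that cp stab_iff in auto)
  have eq: "(\<lambda>z. lin_coord p (chart_inv c z)) = (\<lambda>z. \<Sum>s\<in>Stab p. inverse (multiplier p s) * (?F s z - snd c p))"
    unfolding lin_coord_def c by simp
  show "(\<lambda>z. lin_coord p (chart_inv c z)) analytic_on {snd c p}"
    unfolding eq using F by (intro analytic_intros)
  have "((\<lambda>z. \<Sum>s\<in>Stab p. inverse (multiplier p s) * (?F s z - snd c p)) has_field_derivative
      (\<Sum>s\<in>Stab p. inverse (multiplier p s) * (deriv (?F s) (snd c p) - 0))) (at (snd c p))"
  proof (intro DERIV_sum DERIV_cmult DERIV_diff DERIV_const)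
    show "(?F s has_field_derivative deriv (?F s) (snd c p)) (at (snd c p))" if "s \<in> Stab p" for s
      using analytic_on_imp_differentiable_at[OF F[OF that]] by (simp add: DERIV_deriv_iff_field_differentiable)
  qed
  then have "deriv (\<lambda>z. lin_coord p (chart_inv c z)) (snd c p) =
      (\<Sum>s\<in>Stab p. inverse (multiplier p s) * multiplier p s)"
    unfolding eq multiplier_def c[symmetric] by (simp add: DERIV_imp_deriv)
  also have "\<dots> = of_nat (card (Stab p))"
    using multiplier_nonzero[OF p] by simp
  finally show "deriv (\<lambda>z. lin_coord p (chart_inv c z)) (snd c p) \<noteq> 0"
    using finite_stab stabilizer_one_closed[OF p] card_0_eq by fastforce
qed

text \<open>Intersecting the preimages of a small set M under all elements of the stabilizer gives a
  stable set. The identity is among these elements, so the intersection lies in M, where injectivity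
  of the coordinate and freeness are already known.\<close>

lemma linearizing_nbhd:
  assumes p: "p \<in> points X" and c: "c = chart_at X p"
  obtains U where "openin (topol X) U" "p \<in> U" "U \<subseteq> fst c"
    "\<And>s x. s \<in> Stab p \<Longrightarrow> x \<in> U \<Longrightarrow> \<phi> s x \<in> U"
    "\<And>g x. g \<in> carrier G \<Longrightarrow> g \<notin> Stab p \<Longrightarrow> x \<in> U \<Longrightarrow> \<phi> g x \<notin> U"
    "inj_on (lin_coord p) U"
    "(\<lambda>z. lin_coord p (chart_inv c z)) holomorphic_on (snd c ` U)"
proof -
  have cp: "c \<in> atlas X" "p \<in> fst c" using chart_at[OF p] c by auto
  note cc = atlas_chart[OF cp(1)]
  let ?l = "\<lambda>z. lin_coord p (chart_inv c z)"
  obtain S where S: "open S" "snd c p \<in> S" "?l holomorphic_on S"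
    using lin_coord_deriv(1)[OF p c] unfolding analytic_at by blast
  obtain r where r: "r > 0" "ball (snd c p) r \<subseteq> S" "inj_on ?l (ball (snd c p) r)"
    using has_complex_derivative_locally_injective[OF S(3) S(2) S(1) lin_coord_deriv(2)[OF p c]] by blast
  obtain N where N: "openin (topol X) N" "p \<in> N"
      "\<And>g x. g \<in> carrier G \<Longrightarrow> g \<notin> Stab p \<Longrightarrow> x \<in> N \<Longrightarrow> \<phi> g x \<notin> N"
    using free_nbhd[OF p] by blast
  define M where "M = N \<inter> {x \<in> fst c. snd c x \<in> ball (snd c p) r}"
  have M: "openin (topol X) M" "p \<in> M" "M \<subseteq> fst c" "M \<subseteq> N"
    using N chart_preimage_open[OF cc open_ball] cp r unfolding M_def by auto
  define U where "U = (\<Inter>s\<in>Stab p. {x \<in> points X. \<phi> s x \<in> M})"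
  have one: "\<one> \<in> Stab p" by (rule stabilizer_one_closed[OF p])
  have U: "openin (topol X) U"
    unfolding U_def
  proof (rule openin_INT2[OF finite_stab])
    show "Stab p \<noteq> {}" using one by blast
    show "openin (topol X) {x \<in> points X. \<phi> s x \<in> M}" if "s \<in> Stab p" for s
      using act_openin[OF _ M(1)] that stab_iff by blast
  qed
  have pU: "p \<in> U" unfolding U_def using p M stab_iff by auto
  have UM: "U \<subseteq> M" using one act_one unfolding U_def by force
  have Upts: "U \<subseteq> points X" using openin_subset[OF U] .
  show ?thesis
  proof (rule that[OF U pU])
    show "U \<subseteq> fst c" using UM M by blast
    show "\<phi> s x \<in> U" if s: "s \<in> Stab p" and x: "x \<in> U" for s x
      unfolding U_def
    proof
      fix t assume t: "t \<in> Stab p"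
      have "t \<otimes> s \<in> Stab p" using stabilizer_m_closed[OF p t s] .
      then have "\<phi> (t \<otimes> s) x \<in> M" using x unfolding U_def by blast
      then show "\<phi> s x \<in> {x \<in> points X. \<phi> t x \<in> M}"
        using act_mult[of t s x] s t x Upts act_points[of s x] stab_iff by auto
    qed
    show "\<phi> g x \<notin> U" if "g \<in> carrier G" "g \<notin> Stab p" "x \<in> U" for g x
      using N(3)[OF that(1,2)] that(3) UM M(4) by blast
    show "inj_on (lin_coord p) U"
    proof (rule inj_onI)
      fix x y assume xy: "x \<in> U" "y \<in> U" "lin_coord p x = lin_coord p y"
      then have m: "x \<in> fst c" "y \<in> fst c" "snd c x \<in> ball (snd c p) r" "snd c y \<in> ball (snd c p) r"
        using UM unfolding M_def by auto
      then have "snd c x = snd c y"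
        using inj_onD[OF r(3), of "snd c x" "snd c y"] xy chart_inv_left[OF cc] by simp
      then show "x = y" using m inj_onD[OF chart_inj[OF cc]] by blast
    qed
    have "snd c ` U \<subseteq> S" using UM r(2) unfolding M_def by blast
    then show "?l holomorphic_on (snd c ` U)" using S(3) holomorphic_on_subset by blast
  qed
qed

text \<open>In the linearising coordinate an element with multiplier 1 fixes a whole neighbourhood
  of p pointwise.\<close>

lemma multiplier_inj:
  assumes p: "p \<in> points X" and t: "t \<in> Stab p" and "multiplier p t = 1"
  shows "t = \<one>"
proof -
  obtain U where U: "openin (topol X) U" "p \<in> U" "\<And>s x. s \<in> Stab p \<Longrightarrow> x \<in> U \<Longrightarrow> \<phi> s x \<in> U"
    "inj_on (lin_coord p) U"
    using linearizing_nbhd[OF p refl] by metis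
  have "\<phi> t x = x" if x: "x \<in> U" for x
    using lin_coord_equivariant[OF p _ t, of x] assms(3) inj_onD[OF U(4), of "\<phi> t x" x] U(3)[OF t x] x
      openin_subset[OF U(1)] by auto
  then show ?thesis using locally_trivial_imp_one[OF _ U(1,2)] t stab_iff by blast
qed

lemma multiplier_inj_on: assumes p: "p \<in> points X" shows "inj_on (multiplier p) (Stab p)"
proof (rule inj_onI)
  fix s t assume st: "s \<in> Stab p" "t \<in> Stab p" "multiplier p s = multiplier p t"
  have inv: "inv t \<in> Stab p" by (rule stabilizer_m_inv_closed[OF p st(2)])
  have c: "s \<in> carrier G" "t \<in> carrier G" using st stab_iff by auto
  have "multiplier p (s \<otimes> inv t) = multiplier p t * multiplier p (inv t)"
    using multiplier_mult[OF p st(1) inv] st(3) by simp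
  also have "\<dots> = 1" using multiplier_mult[OF p st(2) inv] multiplier_one[OF p] c by simp
  finally have "s \<otimes> inv t = \<one>" using multiplier_inj[OF p stabilizer_m_closed[OF p st(1) inv]] by blast
  then show "s = t" using c inv_equality[of s "inv t"] by (simp add: inv_equality)
qed

lemma multiplier_pow:
  assumes p: "p \<in> points X" and s: "s \<in> Stab p"
  shows "s [^] (n::nat) \<in> Stab p \<and> multiplier p (s [^] n) = multiplier p s ^ n"
proof (induction n)
  case 0
  then show ?case using stabilizer_one_closed[OF p] multiplier_one[OF p] by simp
next
  case (Suc n)
  then show ?case using multiplier_mult[OF p _ s] stabilizer_m_closed[OF p _ s] by (simp add: mult.commute)
qed

text \<open>Translating the product of all multipliers by s shows that each multiplier is an m-th
  root of unity, m being the order of the stabilizer. As the multiplier is injective, a count shows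
  that every root occurs.\<close>

lemma multiplier_image:
  assumes p: "p \<in> points X"
  shows "multiplier p ` Stab p = {z. z ^ card (Stab p) = 1}"
proof -
  interpret S: subgroup "Stab p" G by (rule stabilizer_subgroup[OF p])
  have m: "card (Stab p) > 0" using finite_stab S.one_closed card_gt_0_iff by blast
  have "multiplier p s ^ card (Stab p) = 1" if s: "s \<in> Stab p" for s
  proof -
    have "bij_betw (\<lambda>t. s \<otimes> t) (Stab p) (Stab p)"
    proof (rule bij_betw_byWitness[where f' = "\<lambda>t. inv s \<otimes> t"])
      have "inv s \<otimes> (s \<otimes> t) = t" "s \<otimes> (inv s \<otimes> t) = t" if "t \<in> Stab p" for t
        using S.subset s that by (auto simp: m_assoc[symmetric])
      then show "\<forall>t\<in>Stab p. inv s \<otimes> (s \<otimes> t) = t" "\<forall>t\<in>Stab p. s \<otimes> (inv s \<otimes> t) = t" by auto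
    qed (use s in auto)
    then have "(\<Prod>t\<in>Stab p. multiplier p t) = (\<Prod>t\<in>Stab p. multiplier p (s \<otimes> t))"
      by (simp add: prod.reindex_bij_betw)
    also have "\<dots> = multiplier p s ^ card (Stab p) * (\<Prod>t\<in>Stab p. multiplier p t)"
      using multiplier_mult[OF p s] by (simp add: prod.distrib)
    finally show ?thesis using multiplier_nonzero[OF p] finite_stab by (simp add: prod_zero_iff)
  qed
  then have "multiplier p ` Stab p \<subseteq> {z. z ^ card (Stab p) = 1}" by blast
  moreover have "card (multiplier p ` Stab p) = card {z::complex. z ^ card (Stab p) = 1}"
    using card_image[OF multiplier_inj_on[OF p]] card_roots_unity_eq[OF m] by simp
  ultimately show ?thesis using finite_roots_unity[of "card (Stab p)"] m by (intro card_subset_eq) auto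
qed

end

text \<open>Needed to use \<open>lin_coord\<close> as a local coordinate. The open mapping theorem
  gives the homeomorphism, and the holomorphic inverse of \<open>?k\<close> gives the second half of
  compatibility.\<close>

lemma subchart:
  assumes c: "is_chart T c" and U: "openin T U" "U \<subseteq> fst c"
    and hol: "(\<lambda>z. l (chart_inv c z)) holomorphic_on (snd c ` U)" and inj: "inj_on l U"
  shows subchart_is_chart: "is_chart T (U, l)"
    and subchart_compatible: "\<And>d. is_chart T d \<Longrightarrow> compatible c d \<Longrightarrow> compatible d (U, l)"
proof -
  let ?k = "\<lambda>z. l (chart_inv c z)"
  have k: "?k (snd c x) = l x" if "x \<in> U" for x using chart_inv_left[OF c] that U(2) by auto
  have open_img: "open (snd c ` W)" if "openin T W" "W \<subseteq> U" for W
    using chart_image_open[OF c that(1)] that(2) U(2) by (simp add: Int_absorb2 subset_trans)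
  have injk: "inj_on ?k (snd c ` U)"
    by (rule inj_on_imageI) (use inj k in \<open>simp add: inj_on_def\<close>)
  have img: "l ` W = ?k ` (snd c ` W)" if "W \<subseteq> U" for W
    using k that by (auto simp: image_image subset_iff intro!: image_cong)
  have open_l: "open (l ` W)" if W: "openin T W" "W \<subseteq> U" for W
    unfolding img[OF W(2)]
  proof (rule open_mapping_thm3)
    show "?k holomorphic_on snd c ` W" using hol W(2) by (meson holomorphic_on_subset image_mono)
    show "inj_on ?k (snd c ` W)" using injk W(2) by (meson inj_on_subset image_mono)
  qed (rule open_img[OF W])
  have Upts: "U \<subseteq> topspace T" using openin_subset[OF U(1)] .
  have sub: "openin (subtopology T U) W \<longleftrightarrow> openin T W \<and> W \<subseteq> U" for W
    by (rule openin_open_subtopology[OF U(1)])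
  have pre: "openin T {x \<in> U. l x \<in> S}" if "open S" for S
  proof -
    have "open (?k -` S \<inter> snd c ` U)"
      using continuous_open_preimage[OF holomorphic_on_imp_continuous_on[OF hol] open_img[OF U(1) subset_refl] that]
      by (simp add: Int_commute)
    then have "openin T (U \<inter> {x \<in> fst c. snd c x \<in> ?k -` S \<inter> snd c ` U})"
      using chart_preimage_open[OF c] U(1) by blast
    moreover have "U \<inter> {x \<in> fst c. snd c x \<in> ?k -` S \<inter> snd c ` U} = {x \<in> U. l x \<in> S}"
      using U(2) k by (auto dest: inj_onD[OF chart_inj[OF c]])
    ultimately show ?thesis by simp
  qed
  have "homeomorphic_map (subtopology T U) (top_of_set (l ` U)) l"
  proof (rule bijective_open_imp_homeomorphic_map)
    have "continuous_map (subtopology T U) euclidean l"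
      unfolding continuous_map_def using pre Upts by (auto simp: sub Int_absorb1)
    then show "continuous_map (subtopology T U) (top_of_set (l ` U)) l"
      by (simp add: continuous_map_in_subtopology)
    show "open_map (subtopology T U) (top_of_set (l ` U)) l"
      unfolding open_map_def sub
    proof (intro allI impI)
      fix W assume W: "openin T W \<and> W \<subseteq> U"
      then have "open (l ` W)" using open_l by blast
      then show "openin (top_of_set (l ` U)) (l ` W)" using W by (simp add: openin_open_eq open_l U(1) image_mono)
    qed
  qed (use Upts inj in \<open>auto simp: Int_absorb1\<close>)
  then show "is_chart T (U, l)" unfolding is_chart_def using U(1) open_l[OF U(1) subset_refl] by simp
  show "compatible d (U, l)" if d: "is_chart T d" "compatible c d" for d
  proof -
    have comp: "(snd d \<circ> chart_inv c) holomorphic_on snd c ` (fst c \<inter> fst d)"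
      "(snd c \<circ> chart_inv d) holomorphic_on snd d ` (fst c \<inter> fst d)"
      using d(2) unfolding compatible_def by (simp_all add: Int_commute)
    have "(?k \<circ> (snd c \<circ> chart_inv d)) holomorphic_on snd d ` (fst d \<inter> U)"
    proof (rule holomorphic_on_compose_gen[OF _ hol])
      show "(snd c \<circ> chart_inv d) holomorphic_on snd d ` (fst d \<inter> U)"
        by (rule holomorphic_on_subset[OF comp(2)]) (use U(2) in auto)
    qed (use chart_inv_left[OF d(1)] in auto)
    then have 1: "(l \<circ> chart_inv d) holomorphic_on snd d ` (fst d \<inter> U)"
      by (rule holomorphic_transform) (use chart_inv_left[OF d(1)] k in auto)
    obtain g where g: "g holomorphic_on ?k ` (snd c ` U)" "\<And>z. z \<in> snd c ` U \<Longrightarrow> g (?k z) = z"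
      using holomorphic_has_inverse[OF hol open_img[OF U(1) subset_refl] injk] by metis
    have gl: "g (l x) = snd c x" if "x \<in> U" for x using g(2)[of "snd c x"] k that by auto
    have "((snd d \<circ> chart_inv c) \<circ> g) holomorphic_on l ` (fst d \<inter> U)"
    proof (rule holomorphic_on_compose_gen[OF _ comp(1)])
      show "g holomorphic_on l ` (fst d \<inter> U)"
        by (rule holomorphic_on_subset[OF g(1)]) (use img[OF subset_refl] in auto)
    qed (use gl U(2) in auto)
    then have 2: "(snd d \<circ> chart_inv (U, l)) holomorphic_on l ` (fst d \<inter> U)"
    proof (rule holomorphic_transform)
      fix u assume "u \<in> l ` (fst d \<inter> U)"
      then obtain x where x: "x \<in> fst d" "x \<in> U" "u = l x" by blast
      have "chart_inv (U, l) u = x" using inj x unfolding chart_inv_def by simp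
      moreover have "chart_inv c (g u) = x" using gl x chart_inv_left[OF c] U(2) by auto
      ultimately show "((snd d \<circ> chart_inv c) \<circ> g) u = (snd d \<circ> chart_inv (U, l)) u" by simp
    qed
    show ?thesis unfolding compatible_def using 1 2 by (simp add: Int_commute)
  qed
qed

context curve_action
begin

text \<open>Every multiplier is a power of the primitive root, so by injectivity every element of
  the stabilizer is a power of h: the stabilizer is cyclic.\<close>

lemma exists_multiplier:
  assumes p: "p \<in> points X"
  obtains h where "h \<in> Stab p" "multiplier p h = exp (2 * of_real pi * \<i> / of_nat (card (Stab p)))"
    "generate G {h} = Stab p"
proof -
  let ?m = "card (Stab p)"
  have m: "?m > 0" using finite_stab stabilizer_one_closed[OF p] card_gt_0_iff by blast
  have "exp (2 * of_real pi * \<i> / of_nat ?m) ^ ?m = (1 :: complex)"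
    using m by (simp add: exp_of_nat_mult[symmetric])
  then have "exp (2 * of_real pi * \<i> / of_nat ?m) \<in> multiplier p ` Stab p"
    unfolding multiplier_image[OF p] by simp
  then obtain h where h: "h \<in> Stab p" "multiplier p h = exp (2 * of_real pi * \<i> / of_nat ?m)"
    by (elim imageE) simp
  have hc: "h \<in> carrier G" using h stab_iff by blast
  have "generate G {h} \<subseteq> Stab p"
    by (rule generate_subgroup_incl[OF _ stabilizer_subgroup[OF p]]) (use h in simp)
  moreover have "s \<in> generate G {h}" if s: "s \<in> Stab p" for s
  proof -
    have "multiplier p s ^ ?m = 1" using multiplier_image[OF p] s by blast
    then obtain k where "multiplier p s = exp (2 * of_real pi * \<i> * of_nat k / of_nat ?m)"
      using complex_roots_unity[of ?m] m by auto
    also have "\<dots> = multiplier p h ^ k" unfolding h(2) by (simp add: exp_of_nat_mult[symmetric] mult_ac)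
    also have "\<dots> = multiplier p (h [^] k)" using multiplier_pow[OF p h(1)] by simp
    finally have "s = h [^] k"
      using multiplier_inj_on[OF p] s multiplier_pow[OF p h(1)] unfolding inj_on_def by blast
    moreover have "h [^] (j::nat) \<in> generate G {h}" for j
    proof (induction j)
      case (Suc j)
      then show ?case using generate.eng[OF Suc generate.incl[of h "{h}"]] by simp
    qed (simp add: generate.one)
    ultimately show ?thesis by simp
  qed
  ultimately show ?thesis using that h by blast
qed

text \<open>Justifies the definite description. The linearising coordinate gives existence; for
  uniqueness, any admissible coordinate forces the same multiplier, and the multiplier determines
  the element.\<close>

lemma local_monodromy:
  assumes p: "p \<in> points X"
  shows "local_monodromy G \<phi> X p \<in> Stab p"
    and "multiplier p (local_monodromy G \<phi> X p) = exp (2 * of_real pi * \<i> / of_nat (card (Stab p)))"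
proof -
  let ?e = "exp (2 * of_real pi * \<i> / of_nat (card (Stab p))) :: complex"
  define c where "c = chart_at X p"
  have cp: "c \<in> atlas X" "p \<in> fst c" using chart_at[OF p] unfolding c_def by auto
  note cc = atlas_chart[OF cp(1)]
  let ?P = "\<lambda>h. h \<in> Stab p \<and> generate G {h} = Stab p \<and>
     (\<exists>z. local_coordinate X p z \<and> snd z p = 0 \<and>
        (\<forall>\<^sub>F x in nhdsin (topol X) p. \<phi> h x \<in> fst z \<and> snd z (\<phi> h x) = ?e * snd z x))"
  \<comment> \<open>Differentiating the linear relation at p gives the same scalar for the chart
    coordinate: the derivative of the admissible coordinate z appears on both sides and is nonzero
    by compatibility.\<close>
  have mult: "multiplier p h = ?e" if h: "?P h" for h
  proof -
    obtain z where z: "local_coordinate X p z" "snd z p = 0"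
        "\<forall>\<^sub>F x in nhdsin (topol X) p. \<phi> h x \<in> fst z \<and> snd z (\<phi> h x) = ?e * snd z x"
      using h by blast
    have hs: "h \<in> carrier G" "\<phi> h p = p" using h stab_iff by blast+
    let ?t = "\<lambda>w. snd z (chart_inv c w)" and ?F = "\<lambda>w. snd c (\<phi> h (chart_inv c w))"
    have zz: "is_chart (topol X) z" "p \<in> fst z" "compatible c z"
      using z(1) cp unfolding local_coordinate_def by blast+
    have t: "?t analytic_on {snd c p}" "deriv ?t (snd c p) \<noteq> 0"
      using compatible_analytic[OF cc zz(1,3) cp(2) zz(2)] by blast+
    have F: "?F analytic_on {snd c p}"
      by (rule holomorphic_map_analytic(1)[OF rs rs act_holomorphic[OF hs(1)] cp cp(1)]) (use hs cp in simp)
    have Fp: "?F (snd c p) = snd c p" using chart_inv_left[OF cc cp(2)] hs by simp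
    have dom: "\<forall>\<^sub>F w in nhds (snd c p). w \<in> snd c ` fst c \<and> chart_inv c w \<in> fst c \<and> \<phi> h (chart_inv c w) \<in> fst c"
      by (rule holomorphic_map_eventually_domain(2)[OF rs rs act_holomorphic[OF hs(1)] cp cp(1)]) (use hs cp in simp)
    have "\<forall>\<^sub>F w in nhds (snd c p). \<phi> h (chart_inv c w) \<in> fst z \<and> snd z (\<phi> h (chart_inv c w)) = ?e * ?t w"
      using z(3) unfolding chart_eventually_iff[OF cc cp(2)] .
    with dom have "\<forall>\<^sub>F w in nhds (snd c p). ?t (?F w) = ?e * ?t w"
      by eventually_elim (simp add: chart_inv_left[OF cc])
    then have "deriv (\<lambda>w. ?t (?F w)) (snd c p) = deriv (\<lambda>w. ?e * ?t w) (snd c p)"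
      by (rule deriv_cong_ev) simp
    moreover have "deriv (\<lambda>w. ?t (?F w)) (snd c p) = deriv ?t (?F (snd c p)) * deriv ?F (snd c p)"
      by (rule deriv_compose_analytic[OF F]) (use t Fp in simp)
    moreover have "deriv (\<lambda>w. ?e * ?t w) (snd c p) = ?e * deriv ?t (snd c p)"
      by (rule deriv_cmult) (use t analytic_on_imp_differentiable_at in blast)
    ultimately have "deriv ?F (snd c p) = ?e" using t(2) Fp by simp
    then show ?thesis unfolding multiplier_def c_def[symmetric] .
  qed
  obtain h where h: "h \<in> Stab p" "multiplier p h = ?e" "generate G {h} = Stab p"
    using exists_multiplier[OF p] by blast
  obtain U where U: "openin (topol X) U" "p \<in> U" "U \<subseteq> fst c"
    "\<And>s x. s \<in> Stab p \<Longrightarrow> x \<in> U \<Longrightarrow> \<phi> s x \<in> U"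
    "inj_on (lin_coord p) U"
    "(\<lambda>z. lin_coord p (chart_inv c z)) holomorphic_on (snd c ` U)"
    using linearizing_nbhd[OF p c_def] by metis
  have "local_coordinate X p (U, lin_coord p)"
    unfolding local_coordinate_def
    using subchart_is_chart[OF cc U(1,3,6,5)] subchart_compatible[OF cc U(1,3,6,5)] U(2)
      atlas_chart atlas_compatible[OF cp(1)] by simp
  moreover have "\<forall>\<^sub>F x in nhdsin (topol X) p. x \<in> U" by (rule eventually_nhdsin_openin[OF U(1,2)])
  then have "\<forall>\<^sub>F x in nhdsin (topol X) p. \<phi> h x \<in> U \<and> lin_coord p (\<phi> h x) = ?e * lin_coord p x"
    by (rule eventually_mono)
      (use U(4)[OF h(1)] lin_coord_equivariant[OF p _ h(1)] h(2) openin_subset[OF U(1)] in auto)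
  ultimately have Ph: "?P h"
    using h lin_coord_self[OF p] by (intro conjI exI[of _ "(U, lin_coord p)"]) simp_all
  have "local_monodromy G \<phi> X p = h"
    unfolding local_monodromy_def
  proof (rule the_equality)
    fix h' assume h': "?P h'"
    then show "h' = h" using mult[OF h'] mult[OF Ph] multiplier_inj_on[OF p] h(1) unfolding inj_on_def by metis
  qed (rule Ph)
  then show "local_monodromy G \<phi> X p \<in> Stab p" "multiplier p (local_monodromy G \<phi> X p) = ?e"
    using h by simp_all
qed

subsection \<open>Isotypic forms\<close>

lemma pullback_add: "pullback X X f (\<omega> + \<eta>) = pullback X X f \<omega> + pullback X X f \<eta>"
  and pullback_scale: "pullback X X f (\<lambda>i. k * \<omega> i) = (\<lambda>i. k * pullback X X f \<omega> i)"
  by (auto simp: pullback_def fun_eq_iff algebra_simps)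

lemma pullback_one:
  assumes "\<omega> \<in> H10 X" shows "pullback X X (\<phi> \<one>) \<omega> = \<omega>"
proof
  fix i :: "'a chart \<times> 'a"
  obtain c p where i: "i = (c, p)" by (rule prod.exhaust)
  show "pullback X X (\<phi> \<one>) \<omega> i = \<omega> i"
  proof (cases "c \<in> atlas X \<and> p \<in> fst c")
    case True
    then have c: "c \<in> atlas X" "p \<in> fst c" by auto
    note cc = atlas_chart[OF c(1)]
    have "\<forall>\<^sub>F z in nhds (snd c p). snd c (\<phi> \<one> (chart_inv c z)) = z"
      using chart_eventually_image[OF cc c(2)]
      by (rule eventually_mono) (use act_one atlas_points[OF c(1)] chart_inv_into in metis)
    then have "deriv (\<lambda>z. snd c (\<phi> \<one> (chart_inv c z))) (snd c p) = deriv (\<lambda>z. z) (snd c p)"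
      by (rule deriv_cong_ev) simp
    then show ?thesis
      using pullback_eq[OF rs rs act_holomorphic[OF one_closed] assms c c(1)] act_one[OF atlas_points[OF c]] c i
      by simp
  next
    case False
    then show ?thesis using H10_outside[OF assms] i by (auto simp: pullback_def)
  qed
qed

definition eigenforms :: "('g \<Rightarrow> complex) \<Rightarrow> 'a oneform set" where
  "eigenforms chi = {\<omega> \<in> H10 X. \<forall>g\<in>carrier G. canonical_representation G \<phi> X g \<omega> = (\<lambda>i. chi g * \<omega> i)}"

lemma subspace_eigenforms: "cfun.subspace (eigenforms chi)"
proof (rule cfun.subspaceI)
  show "0 \<in> eigenforms chi"
    using cfun.subspace_0[OF subspace_H10]
    by (auto simp: eigenforms_def canonical_representation_def pullback_def fun_eq_iff)
  show "\<omega> + \<eta> \<in> eigenforms chi" if "\<omega> \<in> eigenforms chi" "\<eta> \<in> eigenforms chi" for \<omega> \<eta>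
    using that cfun.subspace_add[OF subspace_H10]
    by (auto simp: eigenforms_def canonical_representation_def pullback_add fun_eq_iff algebra_simps)
  show "(\<lambda>i. k * \<omega> i) \<in> eigenforms chi" if "\<omega> \<in> eigenforms chi" for k \<omega>
    using that cfun.subspace_scale[OF subspace_H10]
    by (auto simp: eigenforms_def canonical_representation_def pullback_scale fun_eq_iff)
qed

lemma character_one:
  assumes "degree_one_character G chi" shows "chi \<one> = 1"
proof -
  have "chi (\<one> \<otimes> \<one>) = chi \<one> * chi \<one>" "chi \<one> \<noteq> 0"
    using assms one_closed unfolding degree_one_character_def by blast+
  then show ?thesis by simp
qed

text \<open>The trace at \<one> is the dimension, so a subspace affording a degree-one character is
  a line, and by invariance G acts on it through the trace. Conversely, a nonzero eigenform spans an
  irreducible line with this character.\<close>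

lemma H10_isotypic_eq_eigenforms:
  assumes chi: "degree_one_character G chi"
  shows "H10_isotypic G \<phi> X chi = eigenforms chi"
proof
  let ?\<rho> = "canonical_representation G \<phi> X"
  have chi1: "chi \<one> = 1" by (rule character_one[OF chi])
  have \<rho>1: "?\<rho> \<one> \<omega> = \<omega>" if "\<omega> \<in> H10 X" for \<omega>
    using pullback_one[OF that] by (simp add: canonical_representation_def)
  have \<rho>scale: "?\<rho> g (\<lambda>i. k * \<omega> i) = (\<lambda>i. k * ?\<rho> g \<omega> i)" for g k \<omega>
    by (simp add: canonical_representation_def pullback_scale)
  show "H10_isotypic G \<phi> X chi \<subseteq> eigenforms chi"
    unfolding H10_isotypic_def isotypic_component_def
  proof (rule cfun.span_minimal[OF _ subspace_eigenforms], rule Union_least)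
    fix W assume "W \<in> {W. W \<subseteq> H10 X \<and> irreducible_subspace G ?\<rho> W \<and> affords_character G ?\<rho> W chi}"
    then have W: "W \<subseteq> H10 X" "irreducible_subspace G ?\<rho> W" "affords_character G ?\<rho> W chi" by auto
    obtain B where B: "finite B" "cfun.independent B" "cfun.span B = W"
      "\<forall>g\<in>carrier G. chi g = (\<Sum>b\<in>B. cfun.representation B (?\<rho> g b) b)"
      using W(3) unfolding affords_character_def by blast
    have BW: "b \<in> W" if "b \<in> B" for b using that B(3) cfun.span_base by blast
    have "1 = (\<Sum>b\<in>B. cfun.representation B (?\<rho> \<one> b) b)" using B(4) chi1 by auto
    also have "\<dots> = (\<Sum>b\<in>B. 1)"
      by (rule sum.cong) (use BW W(1) \<rho>1 cfun.representation_basis[OF B(2)] in \<open>auto simp: subset_iff\<close>)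
    finally have "card B = 1" by simp
    then obtain b where b: "B = {b}" using card_1_singletonE by blast
    have Wb: "W = range (\<lambda>k i. k * b i)" using B(3) b cfun.span_singleton[of b] by simp
    have "?\<rho> g b = (\<lambda>i. chi g * b i)" if g: "g \<in> carrier G" for g
    proof -
      have "?\<rho> g b \<in> W"
        using W(2) g BW b unfolding irreducible_subspace_def invariant_subspace_def by blast
      then obtain k where k: "?\<rho> g b = (\<lambda>i. k * b i)" using Wb by blast
      have "chi g = cfun.representation {b} (\<lambda>i. k * b i) b" using B(4) g b k by simp
      also have "\<dots> = k * cfun.representation {b} b b"
        using cfun.representation_scale[of "{b}" b k] B(2) b cfun.span_base[of b "{b}"] by simp
      also have "\<dots> = k" using cfun.representation_basis[of "{b}" b] B(2) b by simp
      finally show ?thesis using k by simp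
    qed
    then have "b \<in> eigenforms chi" using BW W(1) b unfolding eigenforms_def by auto
    then show "W \<subseteq> eigenforms chi" unfolding Wb using cfun.subspace_scale[OF subspace_eigenforms] by blast
  qed
  show "eigenforms chi \<subseteq> H10_isotypic G \<phi> X chi"
  proof
    fix \<omega> assume \<omega>: "\<omega> \<in> eigenforms chi"
    show "\<omega> \<in> H10_isotypic G \<phi> X chi"
    proof (cases "\<omega> = 0")
      case True
      then show ?thesis unfolding H10_isotypic_def isotypic_component_def using cfun.span_zero by simp
    next
      case False
      let ?W = "cfun.span {\<omega>}"
      have W: "?W = range (\<lambda>k i. k * \<omega> i)" by (rule cfun.span_singleton)
      have \<omega>W: "\<omega> \<in> ?W" by (rule cfun.span_base) simp
      have eig: "?\<rho> g \<omega> = (\<lambda>i. chi g * \<omega> i)" if "g \<in> carrier G" for g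
        using \<omega> that unfolding eigenforms_def by blast
      have ind: "cfun.independent {\<omega>}" using cfun.dependent_single[of \<omega>] False by simp
      have "?W \<subseteq> H10 X"
        using \<omega> unfolding eigenforms_def by (intro cfun.span_minimal[OF _ subspace_H10]) auto
      moreover have "invariant_subspace G ?\<rho> ?W"
        unfolding invariant_subspace_def
      proof (intro conjI ballI cfun.subspace_span)
        fix g assume g: "g \<in> carrier G"
        have "?\<rho> g (\<lambda>i. k * \<omega> i) = (\<lambda>i. (k * chi g) * \<omega> i)" for k
          unfolding \<rho>scale[of g k \<omega>] eig[OF g] by (simp only: mult.assoc)
        then show "?\<rho> g ` ?W \<subseteq> ?W" unfolding W by blast
      qed
      moreover have "U = {0} \<or> U = ?W" if U: "invariant_subspace G ?\<rho> U" "U \<subseteq> ?W" for U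
      proof (cases "U = {0}")
        case neq: False
        have sU: "cfun.subspace U" using U unfolding invariant_subspace_def by blast
        then obtain u where u: "u \<in> U" "u \<noteq> 0" using neq cfun.subspace_0 by blast
        then obtain k where k: "u = (\<lambda>i. k * \<omega> i)" using U(2) W by blast
        then have "k \<noteq> 0" using u(2) by (auto simp: fun_eq_iff)
        then have "(\<lambda>i. inverse k * u i) = \<omega>" using k by (auto simp: fun_eq_iff)
        then have "\<omega> \<in> U" using cfun.subspace_scale[OF sU u(1), of "inverse k"] by simp
        then have "?W \<subseteq> U" by (intro cfun.span_minimal[OF _ sU]) simp
        then show ?thesis using U(2) by blast
      qed blast
      ultimately have irr: "irreducible_subspace G ?\<rho> ?W" "?W \<subseteq> H10 X"
        unfolding irreducible_subspace_def using False \<omega>W by auto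
      have "affords_character G ?\<rho> ?W chi"
        unfolding affords_character_def
      proof (intro exI[of _ "{\<omega>}"] conjI ballI)
        fix g assume g: "g \<in> carrier G"
        have "cfun.representation {\<omega>} (\<lambda>i. chi g * \<omega> i) \<omega> = chi g * cfun.representation {\<omega>} \<omega> \<omega>"
          using cfun.representation_scale[OF ind \<omega>W, of "chi g"] by simp
        then show "chi g = (\<Sum>b\<in>{\<omega>}. cfun.representation {\<omega>} (?\<rho> g b) b)"
          using eig[OF g] cfun.representation_basis[OF ind, of \<omega>] by simp
      qed (use ind in auto)
      then have "\<omega> \<in> \<Union>{W. W \<subseteq> H10 X \<and> irreducible_subspace G ?\<rho> W \<and> affords_character G ?\<rho> W chi}"
        using irr \<omega>W by blast
      then show ?thesis
        unfolding H10_isotypic_def isotypic_component_def by (rule cfun.span_base)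
    qed
  qed
qed

lemma character_inv:
  assumes "degree_one_character G chi" "g \<in> carrier G"
  shows "chi (inv g) = inverse (chi g)"
proof -
  have "chi (inv g \<otimes> g) = chi (inv g) * chi g" "chi g \<noteq> 0"
    using assms inv_closed[OF assms(2)] unfolding degree_one_character_def by blast+
  then show ?thesis using assms character_one[OF assms(1)] by (simp add: field_simps)
qed

text \<open>The canonical representation pulls back along the inverse element, so pulling back along
  g itself produces the inverse scalar.\<close>

lemma eigenform_pullback:
  assumes chi: "degree_one_character G chi" and \<omega>: "\<omega> \<in> eigenforms chi" and g: "g \<in> carrier G"
  shows "pullback X X (\<phi> g) \<omega> = (\<lambda>i. inverse (chi g) * \<omega> i)"
proof -
  have "canonical_representation G \<phi> X (inv g) \<omega> = (\<lambda>i. chi (inv g) * \<omega> i)"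
    using \<omega> g unfolding eigenforms_def by simp
  then show ?thesis using character_inv[OF chi g] g by (simp add: canonical_representation_def)
qed

text \<open>\<open>\<phi> g\<close> is regular, so pulling back keeps the order, and the pullback is
  a nonzero multiple of the same form.\<close>

lemma eigenform_order_orbit:
  assumes chi: "degree_one_character G chi" and \<omega>: "\<omega> \<in> eigenforms chi" "\<omega> \<noteq> 0"
    and g: "g \<in> carrier G" and p: "p \<in> points X" and ord: "has_vanishing_order X \<omega> (\<phi> g p) n"
  shows "has_vanishing_order X \<omega> p n"
proof -
  have H: "\<omega> \<in> H10 X" using \<omega> unfolding eigenforms_def by blast
  obtain c where c: "c \<in> atlas X" "p \<in> fst c" using atlas_cover[OF p] by blast
  obtain d where d: "d \<in> atlas X" "\<phi> g p \<in> fst d" using atlas_cover[OF act_points[OF g p]] by blast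
  have "vanishes_to (\<lambda>z. \<omega> (d, chart_inv d z)) (snd d (\<phi> g p)) n"
    using has_vanishing_order_iff[OF H \<omega>(2) d] ord by blast
  from pullback_vanishes_to[OF rs rs act_holomorphic[OF g] H c d act_regular[OF g c d] this]
  have "vanishes_to (\<lambda>z. inverse (chi g) * \<omega> (c, chart_inv c z)) (snd c p) n"
    unfolding eigenform_pullback[OF chi \<omega>(1) g] .
  moreover have "chi g \<noteq> 0" using chi g unfolding degree_one_character_def by blast
  moreover have "vanishes_to (\<lambda>_. chi g) (snd c p) 0"
    using \<open>chi g \<noteq> 0\<close> by (simp add: vanishes_to_0_iff analytic_on_const)
  ultimately have "vanishes_to (\<lambda>z. \<omega> (c, chart_inv c z)) (snd c p) n"
    using vanishes_to_mult[of "\<lambda>_. chi g" "snd c p" 0 "\<lambda>z. inverse (chi g) * \<omega> (c, chart_inv c z)" n] by simp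
  then show ?thesis using has_vanishing_order_iff[OF H \<omega>(2) c] by blast
qed

text \<open>Comparison of leading coefficients in \<open>\<phi>\<^sub>s\<^sup>* \<omega> = \<chi>(s)\<^sup>-\<^sup>1 \<omega>\<close> at the fixed point \<open>p\<close>.\<close>

lemma character_multiplier:
  assumes chi: "degree_one_character G chi" and \<omega>: "\<omega> \<in> eigenforms chi" "\<omega> \<noteq> 0"
    and p: "p \<in> points X" and s: "s \<in> Stab p" and ord: "has_vanishing_order X \<omega> p n"
  shows "chi s * multiplier p s ^ (n + 1) = 1"
proof -
  define c where "c = chart_at X p"
  have c: "c \<in> atlas X" "p \<in> fst c" using chart_at[OF p] unfolding c_def by auto
  note cc = atlas_chart[OF c(1)]
  have sp: "s \<in> carrier G" "\<phi> s p = p" using s stab_iff by auto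
  have c': "\<phi> s p \<in> fst c" using sp c by simp
  have H: "\<omega> \<in> H10 X" using \<omega> unfolding eigenforms_def by blast
  let ?F = "\<lambda>z. snd c (\<phi> s (chart_inv c z))" and ?f = "\<lambda>z. \<omega> (c, chart_inv c z)" and ?z = "snd c p"
  have F: "?F analytic_on {?z}" by (rule holomorphic_map_analytic(1)[OF rs rs act_holomorphic[OF sp(1)] c c(1) c'])
  have Fp: "?F ?z = ?z" using chart_inv_left[OF cc c(2)] sp by simp
  have mu: "deriv ?F ?z = multiplier p s" unfolding multiplier_def c_def ..
  obtain g where g: "g analytic_on {?z}" "g ?z \<noteq> 0" "\<forall>\<^sub>F z in nhds ?z. ?f z = g z * (z - ?z) ^ n"
    using ord has_vanishing_order_iff[OF H \<omega>(2) c] unfolding vanishes_to_def by blast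
  have "\<forall>\<^sub>F z in nhds ?z. inverse (chi s) * ?f z = ?f (?F z) * deriv ?F z"
    using pullback_coefficient[OF rs rs act_holomorphic[OF sp(1)] H c c(1) c']
    unfolding eigenform_pullback[OF chi \<omega>(1) sp(1)] .
  moreover have "\<forall>\<^sub>F z in nhds ?z. ?f (?F z) = g (?F z) * (?F z - ?z) ^ n"
    using analytic_at_tendsto[OF F] g(3) unfolding filterlim_iff Fp by blast
  \<comment> \<open>Division by the n-th power of \<open>z - ?z\<close> leaves factors with limits;
    the power of \<open>?F z - ?F ?z\<close> becomes a power of a difference quotient.\<close>
  ultimately have ev: "\<forall>\<^sub>F z in at ?z. inverse (chi s) * g z = g (?F z) * ((?F z - ?F ?z) / (z - ?z)) ^ n * deriv ?F z"
    using g(3) unfolding eventually_at_filter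
    by eventually_elim (auto simp: Fp power_divide field_simps)
  have isF: "(?F \<longlongrightarrow> ?z) (at ?z)" using analytic_at_imp_isCont[OF F] Fp by (simp add: isCont_def)
  have isg: "isCont g ?z" using analytic_at_imp_isCont[OF g(1)] .
  have quot: "((\<lambda>z. (?F z - ?F ?z) / (z - ?z)) \<longlongrightarrow> deriv ?F ?z) (at ?z)"
    using analytic_on_imp_differentiable_at[OF F] by (simp add: DERIV_deriv_iff_field_differentiable[symmetric] has_field_derivative_iff)
  have dF: "(deriv ?F \<longlongrightarrow> deriv ?F ?z) (at ?z)"
    using analytic_at_imp_isCont[OF analytic_deriv[OF F]] by (simp add: isCont_def)
  have "((\<lambda>z. g (?F z) * ((?F z - ?F ?z) / (z - ?z)) ^ n * deriv ?F z) \<longlongrightarrow> g ?z * deriv ?F ?z ^ n * deriv ?F ?z) (at ?z)"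
    by (intro tendsto_mult tendsto_power quot dF isCont_tendsto_compose[OF isg isF])
  moreover have "((\<lambda>z. inverse (chi s) * g z) \<longlongrightarrow> inverse (chi s) * g ?z) (at ?z)"
    using isg by (intro tendsto_mult tendsto_const) (simp add: isCont_def)
  ultimately have "inverse (chi s) * g ?z = g ?z * deriv ?F ?z ^ n * deriv ?F ?z"
    using tendsto_cong[OF ev] tendsto_unique[OF trivial_limit_at] by blast
  \<comment> \<open>Of the n + 1 factors, n come from the coefficient and one from the differential
    of the coordinate.\<close>
  then have "inverse (chi s) = multiplier p s ^ (n + 1)" using g(2) mu by simp
  moreover have "chi s \<noteq> 0" using chi sp unfolding degree_one_character_def by blast
  ultimately show ?thesis by (metis right_inverse)
qed

subsection \<open>The quotient surface\<close>

abbreviation quot where "quot \<equiv> orbit G \<phi>"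

lemma quot_iff:
  assumes "x \<in> points X" "y \<in> points X"
  shows "quot x = quot y \<longleftrightarrow> (\<exists>g\<in>carrier G. y = \<phi> g x)"
proof
  assume "quot x = quot y"
  then have "y \<in> quot x" using orbit_refl[OF assms(2)] by simp
  then show "\<exists>g\<in>carrier G. y = \<phi> g x" unfolding orbit_def by blast
next
  assume "\<exists>g\<in>carrier G. y = \<phi> g x"
  then have y: "y \<in> quot x" unfolding orbit_def by blast
  have "quot x \<in> orbits G (points X) \<phi>" "quot y \<in> orbits G (points X) \<phi>"
    using assms unfolding orbits_def by blast+
  then show "quot x = quot y" using disjoint_union y orbit_refl[OF assms(2)] by blast
qed

lemma quot_act: "g \<in> carrier G \<Longrightarrow> x \<in> points X \<Longrightarrow> quot (\<phi> g x) = quot x"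
  using quot_iff[of x "\<phi> g x"] act_points by blast

lemma quot_eq_of_mem: "p \<in> points X \<Longrightarrow> x \<in> quot p \<Longrightarrow> x \<in> points X \<and> quot x = quot p"
  using quot_act act_points unfolding orbit_def by blast

lemma finite_orbit: "finite (quot x)"
proof -
  have "quot x = (\<lambda>g. \<phi> g x) ` carrier G" unfolding orbit_def by blast
  then show ?thesis using finite_group by simp
qed

text \<open>The abstraction \<open>topology\<close> can be inverted only for a predicate that is a
  topology, so this is verified before \<open>quotient_topol\<close> is used.\<close>

lemma openin_quotient:
  "openin (quotient_topol G \<phi> X) U \<longleftrightarrow>
     U \<subseteq> orbits G (points X) \<phi> \<and> openin (topol X) {x \<in> points X. quot x \<in> U}"
proof -
  let ?L = "\<lambda>U. U \<subseteq> orbits G (points X) \<phi> \<and> openin (topol X) {x \<in> points X. quot x \<in> U}"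
  have "istopology ?L"
    unfolding istopology_def
  proof (intro conjI allI impI)
    fix S T assume ST: "?L S" "?L T"
    then have "openin (topol X) ({x \<in> points X. quot x \<in> S} \<inter> {x \<in> points X. quot x \<in> T})" by blast
    moreover have "{x \<in> points X. quot x \<in> S} \<inter> {x \<in> points X. quot x \<in> T} = {x \<in> points X. quot x \<in> S \<inter> T}"
      by blast
    ultimately show "openin (topol X) {x \<in> points X. quot x \<in> S \<inter> T}" by simp
    show "S \<inter> T \<subseteq> orbits G (points X) \<phi>" using ST by blast
  next
    fix K assume K: "\<forall>S\<in>K. ?L S"
    then have "openin (topol X) (\<Union>S\<in>K. {x \<in> points X. quot x \<in> S})" by blast
    moreover have "(\<Union>S\<in>K. {x \<in> points X. quot x \<in> S}) = {x \<in> points X. quot x \<in> \<Union>K}" by blast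
    ultimately show "openin (topol X) {x \<in> points X. quot x \<in> \<Union>K}" by simp
    show "\<Union>K \<subseteq> orbits G (points X) \<phi>" using K by blast
  qed
  then show ?thesis unfolding quotient_topol_def by (simp add: topology_inverse')
qed

lemma quotient_points: "points (quotient_surface G \<phi> X) = orbits G (points X) \<phi>"
proof -
  have "{x \<in> points X. quot x \<in> orbits G (points X) \<phi>} = points X" unfolding orbits_def by blast
  then have "openin (quotient_topol G \<phi> X) (orbits G (points X) \<phi>)"
    using openin_quotient[of "orbits G (points X) \<phi>"] by simp
  then have "orbits G (points X) \<phi> \<subseteq> topspace (quotient_topol G \<phi> X)" by (rule openin_subset)
  moreover have "topspace (quotient_topol G \<phi> X) \<subseteq> orbits G (points X) \<phi>"
    using openin_quotient openin_topspace by blast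
  ultimately show ?thesis unfolding quotient_surface_def by simp
qed

text \<open>The preimage of the image of V is the union of the translates of V.\<close>

lemma quot_open:
  assumes V: "openin (topol X) V" shows "openin (quotient_topol G \<phi> X) (quot ` V)"
proof -
  have Vp: "V \<subseteq> points X" using openin_subset[OF V] .
  have "{x \<in> points X. quot x \<in> quot ` V} = (\<Union>g\<in>carrier G. {x \<in> points X. \<phi> g x \<in> V})"
  proof (intro equalityI subsetI)
    fix x assume x: "x \<in> {x \<in> points X. quot x \<in> quot ` V}"
    then obtain v where v: "v \<in> V" "quot x = quot v" by blast
    then obtain g where "g \<in> carrier G" "v = \<phi> g x" using quot_iff[of x v] x Vp by auto
    then show "x \<in> (\<Union>g\<in>carrier G. {x \<in> points X. \<phi> g x \<in> V})" using x v by blast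
  next
    fix x assume "x \<in> (\<Union>g\<in>carrier G. {x \<in> points X. \<phi> g x \<in> V})"
    then obtain g where g: "g \<in> carrier G" "x \<in> points X" "\<phi> g x \<in> V" by blast
    then have "quot x = quot (\<phi> g x)" using quot_act by simp
    then show "x \<in> {x \<in> points X. quot x \<in> quot ` V}" using g by blast
  qed
  moreover have "openin (topol X) (\<Union>g\<in>carrier G. {x \<in> points X. \<phi> g x \<in> V})"
    using act_openin[OF _ V] by blast
  ultimately show ?thesis unfolding openin_quotient using Vp unfolding orbits_def by auto
qed

lemma atlas_quotient:
  "e \<in> atlas (quotient_surface G \<phi> X) \<longleftrightarrow> is_chart (quotient_topol G \<phi> X) e \<and>
     holomorphic_function X {x \<in> points X. quot x \<in> fst e} (snd e \<circ> quot)"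
  unfolding quotient_surface_def by simp

lemma quotient_chart_analytic:
  assumes e: "e \<in> atlas (quotient_surface G \<phi> X)" and c: "c \<in> atlas X" "p \<in> fst c" "quot p \<in> fst e"
  shows "(\<lambda>z. snd e (quot (chart_inv c z))) analytic_on {snd c p}"
    and "\<forall>\<^sub>F x in nhdsin (topol X) p. quot x \<in> fst e"
proof -
  let ?U = "{x \<in> points X. quot x \<in> fst e}"
  have ee: "is_chart (quotient_topol G \<phi> X) e" "holomorphic_function X ?U (snd e \<circ> quot)"
    using e atlas_quotient by blast+
  have U: "openin (topol X) ?U" using chart_openin[OF ee(1)] openin_quotient by blast
  have p: "p \<in> ?U" using c atlas_points by blast
  have "(\<lambda>z. snd e (quot (chart_inv c z))) holomorphic_on (snd c ` (?U \<inter> fst c))"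
    using ee(2) c(1) unfolding holomorphic_function_def by (simp add: o_def Int_commute)
  moreover have "open (snd c ` (?U \<inter> fst c))" by (rule chart_image_open[OF atlas_chart[OF c(1)] U])
  ultimately show "(\<lambda>z. snd e (quot (chart_inv c z))) analytic_on {snd c p}"
    unfolding analytic_at using p c(2) by blast
  show "\<forall>\<^sub>F x in nhdsin (topol X) p. quot x \<in> fst e"
    using eventually_nhdsin_openin[OF U p] by (rule eventually_mono) simp
qed

text \<open>In the linearising coordinate the stabilizer acts by all m-th roots of unity, so two
  points near p share an orbit exactly when the m-th powers of their coordinates agree. The m-th
  power therefore descends to an injective function on orbits, open by the open mapping
  theorem.\<close>

lemma quotient_chart:
  assumes p: "p \<in> points X"
  obtains e U where "e \<in> atlas (quotient_surface G \<phi> X)" "openin (topol X) U" "p \<in> U" "fst e = quot ` U"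
    "\<And>x. x \<in> U \<Longrightarrow> snd e (quot x) = lin_coord p x ^ card (Stab p)"
proof -
  define c where "c = chart_at X p"
  define m where "m = card (Stab p)"
  have cp: "c \<in> atlas X" "p \<in> fst c" using chart_at[OF p] unfolding c_def by auto
  note cc = atlas_chart[OF cp(1)]
  have m: "m > 0" using finite_stab stabilizer_one_closed[OF p] card_gt_0_iff unfolding m_def by blast
  obtain U where U: "openin (topol X) U" "p \<in> U" "U \<subseteq> fst c"
    "\<And>s x. s \<in> Stab p \<Longrightarrow> x \<in> U \<Longrightarrow> \<phi> s x \<in> U"
    "\<And>g x. g \<in> carrier G \<Longrightarrow> g \<notin> Stab p \<Longrightarrow> x \<in> U \<Longrightarrow> \<phi> g x \<notin> U"
    "inj_on (lin_coord p) U"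
    "(\<lambda>z. lin_coord p (chart_inv c z)) holomorphic_on (snd c ` U)"
    using linearizing_nbhd[OF p c_def] by metis
  have Up: "U \<subseteq> points X" using openin_subset[OF U(1)] .
  have L: "is_chart (topol X) (U, lin_coord p)" by (rule subchart_is_chart[OF cc U(1,3,7,6)])
  have same: "lin_coord p x ^ m = lin_coord p y ^ m \<longleftrightarrow> quot x = quot y" if xy: "x \<in> U" "y \<in> U" for x y
  proof
    assume "quot x = quot y"
    then obtain g where g: "g \<in> carrier G" "y = \<phi> g x" using quot_iff[of x y] xy Up by blast
    then have gs: "g \<in> Stab p" using U(5)[of g x] xy by blast
    then have "lin_coord p y = multiplier p g * lin_coord p x"
      using lin_coord_equivariant[OF p _ gs] g xy Up by blast
    moreover have "multiplier p g ^ m = 1" using multiplier_image[OF p] gs unfolding m_def by blast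
    ultimately show "lin_coord p x ^ m = lin_coord p y ^ m" by (simp add: power_mult_distrib)
  next
    assume eq: "lin_coord p x ^ m = lin_coord p y ^ m"
    show "quot x = quot y"
    proof (cases "lin_coord p x = 0")
      case True
      then have "lin_coord p y = lin_coord p x" using eq m by (simp add: power_0_left)
      then show ?thesis using inj_onD[OF U(6)] xy by metis
    next
      case False
      then have "lin_coord p x ^ m \<noteq> 0" by simp
      then have "(lin_coord p y / lin_coord p x) ^ m = 1" unfolding power_divide using eq by simp
      then have "lin_coord p y / lin_coord p x \<in> multiplier p ` Stab p"
        unfolding multiplier_image[OF p] m_def by simp
      then obtain s where s: "s \<in> Stab p" "lin_coord p y / lin_coord p x = multiplier p s" by blast
      then have "lin_coord p y = lin_coord p (\<phi> s x)"
        using lin_coord_equivariant[OF p _ s(1), of x] xy Up False by (auto simp: field_simps)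
      then have "y = \<phi> s x" using inj_onD[OF U(6)] xy U(4)[OF s(1)] by metis
      then show ?thesis using quot_iff[of x y] xy Up s(1) stab_iff by blast
    qed
  qed
  \<comment> \<open>The representative of the orbit is arbitrary; \<open>same\<close> makes the m-th
    power independent of it.\<close>
  define d where "d = (\<lambda>q. lin_coord p (SOME x. x \<in> U \<and> quot x = q) ^ m)"
  have d: "d (quot x) = lin_coord p x ^ m" if x: "x \<in> U" for x
  proof -
    have "(SOME y. y \<in> U \<and> quot y = quot x) \<in> U \<and> quot (SOME y. y \<in> U \<and> quot y = quot x) = quot x"
      by (rule someI[of _ x]) (use x in simp)
    then show ?thesis unfolding d_def using same x by blast
  qed
  let ?T = "quotient_topol G \<phi> X" and ?e = "(quot ` U, d)"
  have oU: "openin ?T (quot ` U)" by (rule quot_open[OF U(1)])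
  have tU: "topspace (subtopology ?T (quot ` U)) = quot ` U" using openin_subset[OF oU] by auto
  have sub: "openin (subtopology ?T (quot ` U)) W \<longleftrightarrow> openin ?T W \<and> W \<subseteq> quot ` U" for W
    by (rule openin_open_subtopology[OF oU])
  have power_open: "open ((\<lambda>z::complex. z ^ m) ` S)" if "open S" for S
  proof (rule open_mapping_thm[of "\<lambda>z. z ^ m" UNIV])
    show "\<not> (\<lambda>z::complex. z ^ m) constant_on UNIV"
      unfolding constant_on_def using m by (metis UNIV_I one_neq_zero power_one zero_power)
  qed (use that in \<open>auto intro: holomorphic_intros\<close>)
  have open_d: "open (d ` W)" if W: "openin ?T W" "W \<subseteq> quot ` U" for W
  proof -
    let ?V = "{x \<in> points X. quot x \<in> W}"
    have "openin (topol X) ?V" using W(1) openin_quotient by blast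
    from chart_image_open[OF L this] have "open (lin_coord p ` (?V \<inter> U))" by simp
    then have "open ((\<lambda>z. z ^ m) ` lin_coord p ` (?V \<inter> U))" by (rule power_open)
    moreover have "(\<lambda>z. z ^ m) ` lin_coord p ` (?V \<inter> U) = d ` W"
    proof (intro equalityI subsetI)
      fix z assume "z \<in> d ` W"
      then obtain x where "x \<in> U" "quot x \<in> W" "z = d (quot x)" using W(2) by blast
      then show "z \<in> (\<lambda>z. z ^ m) ` lin_coord p ` (?V \<inter> U)" using d Up by auto
    next
      fix z assume "z \<in> (\<lambda>z. z ^ m) ` lin_coord p ` (?V \<inter> U)"
      then obtain x where "x \<in> U" "quot x \<in> W" "z = lin_coord p x ^ m" by blast
      then show "z \<in> d ` W" using d by (metis imageI)
    qed
    ultimately show ?thesis by simp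
  qed
  have chart: "is_chart ?T ?e"
    unfolding is_chart_def fst_conv snd_conv
  proof (intro conjI oU open_d[OF oU subset_refl] bijective_open_imp_homeomorphic_map)
    have "openin ?T {q \<in> quot ` U. d q \<in> S}" if "open S" for S
    proof -
      have "open {z::complex. z ^ m \<in> S}"
        using open_vimage[OF that, of "\<lambda>z. z ^ m"] by (simp add: vimage_def continuous_intros)
      from chart_preimage_open[OF L this]
      have "openin ?T (quot ` {x \<in> U. lin_coord p x \<in> {z. z ^ m \<in> S}})" by (intro quot_open) simp
      moreover have "quot ` {x \<in> U. lin_coord p x \<in> {z. z ^ m \<in> S}} = {q \<in> quot ` U. d q \<in> S}"
        using d by auto
      ultimately show ?thesis by simp
    qed
    then have "continuous_map (subtopology ?T (quot ` U)) euclidean d"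
      unfolding continuous_map_def tU by (auto simp: sub)
    then show "continuous_map (subtopology ?T (quot ` U)) (top_of_set (d ` quot ` U)) d"
      using tU by (simp add: continuous_map_in_subtopology)
    show "open_map (subtopology ?T (quot ` U)) (top_of_set (d ` quot ` U)) d"
      unfolding open_map_def sub
    proof (intro allI impI)
      fix W assume W: "openin ?T W \<and> W \<subseteq> quot ` U"
      then show "openin (top_of_set (d ` quot ` U)) (d ` W)"
        using open_d[of W] by (intro open_subset) auto
    qed
    show "inj_on d (topspace (subtopology ?T (quot ` U)))"
      unfolding tU using d same by (auto simp: inj_on_def)
  qed (use tU in simp)
  moreover have "holomorphic_function X {x \<in> points X. quot x \<in> fst ?e} (snd ?e \<circ> quot)"
    unfolding holomorphic_function_def fst_conv snd_conv o_def
  proof (intro ballI holomorphic_onI_analytic_at)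
    fix c' z assume c': "c' \<in> atlas X" and z: "z \<in> snd c' ` (fst c' \<inter> {x \<in> points X. quot x \<in> quot ` U})"
    note cc' = atlas_chart[OF c']
    obtain x where x: "x \<in> fst c'" "x \<in> points X" "quot x \<in> quot ` U" "z = snd c' x" using z by blast
    then obtain u where u: "u \<in> U" "quot x = quot u" by blast
    \<comment> \<open>A point whose orbit meets U need not lie in U. It is moved into U by some g,
      and holomorphy is transported back along the action.\<close>
    then obtain g where g: "g \<in> carrier G" "u = \<phi> g x" using quot_iff[of x u] x Up by blast
    have gx: "\<phi> g x \<in> fst c" using g u U(3) by blast
    let ?F = "\<lambda>z. snd c (\<phi> g (chart_inv c' z))" and ?k = "\<lambda>z. lin_coord p (chart_inv c z)"
    have F: "?F analytic_on {snd c' x}"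
      by (rule holomorphic_map_analytic(1)[OF rs rs act_holomorphic[OF g(1)] c' x(1) cp(1) gx])
    have Fx: "?F (snd c' x) = snd c (\<phi> g x)" using chart_inv_left[OF cc' x(1)] by simp
    have "open (snd c ` U)" using chart_image_open[OF cc U(1)] U(3) by (simp add: Int_absorb2)
    then have "?k analytic_on {?F (snd c' x)}" unfolding Fx analytic_at using U(7) u g by blast
    then have kF: "(\<lambda>z. ?k (?F z) ^ m) analytic_on {snd c' x}"
      by (intro analytic_on_power analytic_at_compose[OF F])
    have "openin (topol X) {x \<in> points X. \<phi> g x \<in> U}" by (rule act_openin[OF g(1) U(1)])
    then have "\<forall>\<^sub>F y in nhdsin (topol X) x. y \<in> {x \<in> points X. \<phi> g x \<in> U}"
      by (rule eventually_nhdsin_openin) (use x u g in simp)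
    then have "\<forall>\<^sub>F w in nhds (snd c' x). chart_inv c' w \<in> {x \<in> points X. \<phi> g x \<in> U}"
      unfolding chart_eventually_iff[OF cc' x(1)] .
    then have "\<forall>\<^sub>F w in nhds (snd c' x). d (quot (chart_inv c' w)) = ?k (?F w) ^ m"
    proof (rule eventually_mono)
      fix w assume w: "chart_inv c' w \<in> {x \<in> points X. \<phi> g x \<in> U}"
      then have "quot (chart_inv c' w) = quot (\<phi> g (chart_inv c' w))" using quot_act[OF g(1)] by simp
      moreover have "chart_inv c (?F w) = \<phi> g (chart_inv c' w)"
        using chart_inv_left[OF cc, of "\<phi> g (chart_inv c' w)"] w U(3) by blast
      ultimately show "d (quot (chart_inv c' w)) = ?k (?F w) ^ m" using d[of "\<phi> g (chart_inv c' w)"] w by simp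
    qed
    then show "(\<lambda>w. d (quot (chart_inv c' w))) analytic_on {z}"
      unfolding x(4) by (rule analytic_at_eventually_eq[OF kF])
  qed
  ultimately have "?e \<in> atlas (quotient_surface G \<phi> X)" using atlas_quotient by blast
  then show ?thesis using that[of ?e U] U(1,2) d unfolding m_def by simp
qed

lemma lin_coord_vanishes:
  assumes c: "c \<in> atlas X" "p \<in> fst c"
  shows "vanishes_to (\<lambda>z. lin_coord p (chart_inv c z)) (snd c p) 1"
proof -
  have p: "p \<in> points X" using atlas_points[OF c] .
  define d where "d = chart_at X p"
  have d: "d \<in> atlas X" "p \<in> fst d" using chart_at[OF p] unfolding d_def by auto
  note cc = atlas_chart[OF c(1)] and dd = atlas_chart[OF d(1)]
  let ?k = "\<lambda>z. lin_coord p (chart_inv d z)" and ?t = "\<lambda>z. snd d (chart_inv c z)"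
  have "?k (snd d p) = 0" using chart_inv_left[OF dd d(2)] lin_coord_self[OF p] by simp
  then have "vanishes_to ?k (snd d p) 1"
    using vanishes_to_diff[OF lin_coord_deriv[OF p d_def]] by simp
  moreover have t: "?t analytic_on {snd c p}" "deriv ?t (snd c p) \<noteq> 0"
    using atlas_analytic[OF c(1) d(1) c(1) d(1) c(2) d(2)] by blast+
  moreover have "?t (snd c p) = snd d p" using chart_inv_left[OF cc c(2)] by simp
  ultimately have *: "vanishes_to (\<lambda>z. ?k (?t z)) (snd c p) 1"
    using vanishes_to_compose[OF t, of ?k 1] by simp
  have "\<forall>\<^sub>F z in nhds (snd c p). chart_inv c z \<in> fst d"
    using chart_eventually_domain[OF dd d(2)] unfolding chart_eventually_iff[OF cc c(2)] .
  then have "\<forall>\<^sub>F z in nhds (snd c p). lin_coord p (chart_inv c z) = ?k (?t z)"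
    by (rule eventually_mono) (simp add: chart_inv_left[OF dd])
  then show ?thesis by (rule vanishes_to_cong[OF *])
qed

text \<open>The ramification index of the quotient map at p is the order of the stabilizer: the
  chart pulls back to that power of a coordinate with a simple zero.\<close>

lemma quotient_chart_vanishes:
  assumes c: "c \<in> atlas X" "p \<in> fst c" and U: "openin (topol X) U" "p \<in> U"
    and e: "\<And>x. x \<in> U \<Longrightarrow> snd e (quot x) = lin_coord p x ^ card (Stab p)"
  shows "vanishes_to (\<lambda>z. snd e (quot (chart_inv c z))) (snd c p) (card (Stab p))"
proof -
  note cc = atlas_chart[OF c(1)]
  have "\<forall>\<^sub>F z in nhds (snd c p). chart_inv c z \<in> U"
    using eventually_nhdsin_openin[OF U] unfolding chart_eventually_iff[OF cc c(2)] .
  then have "\<forall>\<^sub>F z in nhds (snd c p). snd e (quot (chart_inv c z)) = lin_coord p (chart_inv c z) ^ card (Stab p)"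
    by (rule eventually_mono) (rule e)
  then show ?thesis
    using vanishes_to_cong[OF vanishes_to_power[OF lin_coord_vanishes[OF c], of "card (Stab p)"]] by simp
qed

lemma Crit_iff:
  "q \<in> Crit G \<phi> X \<longleftrightarrow> (\<exists>x c e. q = quot x \<and> x \<in> points X \<and> c \<in> atlas X \<and> e \<in> atlas (quotient_surface G \<phi> X) \<and>
     x \<in> fst c \<and> quot x \<in> fst e \<and> deriv (\<lambda>z. snd e (quot (chart_inv c z))) (snd c x) = 0)"
  unfolding Crit_def branch_points_def o_def by blast

lemma Crit_subset: "Crit G \<phi> X \<subseteq> orbits G (points X) \<phi>"
  unfolding Crit_iff subset_iff orbits_def by blast

text \<open>With trivial stabilizer the quotient map is injective near the point, hence regular in
  any charts. Injectivity is used instead of the chart from \<open>quotient_chart\<close> because a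
  branch point may be witnessed by any chart of the quotient.\<close>

lemma Crit_nontrivial_stab:
  assumes "q \<in> Crit G \<phi> X"
  obtains x where "x \<in> points X" "q = quot x" "Stab x \<noteq> {\<one>}"
proof -
  obtain x c e where x: "q = quot x" "x \<in> points X" and c: "c \<in> atlas X" "x \<in> fst c"
    and e: "e \<in> atlas (quotient_surface G \<phi> X)" "quot x \<in> fst e"
    and der: "deriv (\<lambda>z. snd e (quot (chart_inv c z))) (snd c x) = 0"
    using assms unfolding Crit_iff by blast
  note cc = atlas_chart[OF c(1)]
  have ee: "is_chart (quotient_topol G \<phi> X) e" using e atlas_quotient by blast
  have "Stab x \<noteq> {\<one>}"
  proof
    assume S: "Stab x = {\<one>}"
    obtain U where U: "openin (topol X) U" "x \<in> U" "U \<subseteq> fst (chart_at X x)"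
      "\<And>g y. g \<in> carrier G \<Longrightarrow> g \<notin> Stab x \<Longrightarrow> y \<in> U \<Longrightarrow> \<phi> g y \<notin> U"
      using linearizing_nbhd[OF x(2) refl] by metis
    have Up: "U \<subseteq> points X" using openin_subset[OF U(1)] .
    let ?k = "\<lambda>z. snd e (quot (chart_inv c z))"
    obtain R where R: "open R" "snd c x \<in> R" "?k holomorphic_on R"
      using quotient_chart_analytic(1)[OF e(1) c e(2)] unfolding analytic_at by blast
    have "\<forall>\<^sub>F y in nhdsin (topol X) x. y \<in> U \<and> quot y \<in> fst e"
      using eventually_conj[OF eventually_nhdsin_openin[OF U(1,2)] quotient_chart_analytic(2)[OF e(1) c e(2)]] .
    then have "\<forall>\<^sub>F z in nhds (snd c x). chart_inv c z \<in> U \<and> quot (chart_inv c z) \<in> fst e"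
      unfolding chart_eventually_iff[OF cc c(2)] .
    then have "\<forall>\<^sub>F z in nhds (snd c x). (chart_inv c z \<in> U \<and> quot (chart_inv c z) \<in> fst e) \<and> z \<in> snd c ` fst c \<and> z \<in> R"
      by (rule eventually_conj[OF _ eventually_conj[OF chart_eventually_image[OF cc c(2)] eventually_nhds_in_open[OF R(1,2)]]])
    then obtain V where V: "open V" "snd c x \<in> V"
      "\<And>z. z \<in> V \<Longrightarrow> (chart_inv c z \<in> U \<and> quot (chart_inv c z) \<in> fst e) \<and> z \<in> snd c ` fst c \<and> z \<in> R"
      unfolding eventually_nhds by blast
    have "inj_on ?k V"
    proof (rule inj_onI)
      fix z w assume zw: "z \<in> V" "w \<in> V" "?k z = ?k w"
      then have "quot (chart_inv c z) = quot (chart_inv c w)"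
        using inj_onD[OF chart_inj[OF ee]] V(3) by blast
      then obtain g where g: "g \<in> carrier G" "chart_inv c w = \<phi> g (chart_inv c z)"
        using quot_iff[of "chart_inv c z" "chart_inv c w"] V(3)[OF zw(1)] V(3)[OF zw(2)] Up by blast
      then have "g = \<one>" using U(4)[of g "chart_inv c z"] S V(3)[OF zw(1)] V(3)[OF zw(2)] by fastforce
      then have "chart_inv c w = chart_inv c z" using g act_one V(3)[OF zw(1)] Up by auto
      then show "z = w" using chart_inv_into(1)[of z c] chart_inv_into(1)[of w c] V(3)[OF zw(1)] V(3)[OF zw(2)] by metis
    qed
    moreover have "?k holomorphic_on V" using R(3) V(3) by (meson holomorphic_on_subset subsetI)
    ultimately show False using holomorphic_injective_imp_regular[OF _ V(1) _ V(2)] der by blast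
  qed
  then show ?thesis using that x by blast
qed

lemma finite_Crit: "finite (Crit G \<phi> X)"
proof -
  have "Crit G \<phi> X \<subseteq> quot ` (\<Union>g\<in>carrier G - {\<one>}. {x \<in> points X. \<phi> g x = x})"
  proof
    fix q assume "q \<in> Crit G \<phi> X"
    then obtain x where x: "x \<in> points X" "q = quot x" "Stab x \<noteq> {\<one>}"
      using Crit_nontrivial_stab by blast
    then obtain g where "g \<in> Stab x" "g \<noteq> \<one>" using stabilizer_one_closed[OF x(1)] by blast
    then show "q \<in> quot ` (\<Union>g\<in>carrier G - {\<one>}. {x \<in> points X. \<phi> g x = x})"
      using x stab_iff by blast
  qed
  moreover have "finite (\<Union>g\<in>carrier G - {\<one>}. {x \<in> points X. \<phi> g x = x})"
    using finite_group finite_fixed_points by blast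
  ultimately show ?thesis using finite_subset finite_imageI by blast
qed

text \<open>In the chart from \<open>quotient_chart\<close> the quotient map vanishes to order m,
  and a nonzero derivative would make this order 1.\<close>

lemma not_Crit_imp_trivial_stab:
  assumes p: "p \<in> points X" and "quot p \<notin> Crit G \<phi> X"
  shows "card (Stab p) = 1"
proof (rule ccontr)
  assume m: "card (Stab p) \<noteq> 1"
  obtain c where c: "c \<in> atlas X" "p \<in> fst c" using atlas_cover[OF p] by blast
  obtain e U where e: "e \<in> atlas (quotient_surface G \<phi> X)" and U: "openin (topol X) U" "p \<in> U" "fst e = quot ` U"
    and eq: "\<And>x. x \<in> U \<Longrightarrow> snd e (quot x) = lin_coord p x ^ card (Stab p)"
    using quotient_chart[OF p] by metis
  let ?k = "\<lambda>z. snd e (quot (chart_inv c z))"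
  have van: "vanishes_to ?k (snd c p) (card (Stab p))" by (rule quotient_chart_vanishes[OF c U(1,2) eq])
  have pe: "quot p \<in> fst e" using U by blast
  have an: "?k analytic_on {snd c p}" by (rule quotient_chart_analytic(1)[OF e c pe])
  have "?k (snd c p) = 0"
    using vanishes_to_0_iff[OF an] vanishes_to_unique[OF van] m
      finite_stab stabilizer_one_closed[OF p] card_0_eq by fastforce
  then have "deriv ?k (snd c p) = 0"
    using vanishes_to_diff[OF an] vanishes_to_unique[OF van] m by fastforce
  then have "quot p \<in> Crit G \<phi> X" unfolding Crit_iff using p c e pe by blast
  then show False using assms(2) by contradiction
qed

text \<open>Stabilizers along an orbit are conjugate. This makes the description in
  \<open>stabilizer_order\<close> well defined.\<close>

lemma card_stab_orbit:
  assumes p: "p \<in> points X" and "x \<in> quot p" shows "card (Stab x) = card (Stab p)"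
proof -
  obtain g where g: "g \<in> carrier G" "x = \<phi> g p" using assms(2) unfolding orbit_def by blast
  have x: "x \<in> points X" using act_points g p by simp
  have "bij_betw (\<lambda>s. g \<otimes> s \<otimes> inv g) (Stab p) (Stab x)"
  proof (rule bij_betw_byWitness[where f' = "\<lambda>s. inv g \<otimes> s \<otimes> g"])
    have "inv g \<otimes> (g \<otimes> s \<otimes> inv g) \<otimes> g = s" "g \<otimes> (inv g \<otimes> s \<otimes> g) \<otimes> inv g = s" if s: "s \<in> carrier G" for s
    proof -
      have "inv g \<otimes> (g \<otimes> s \<otimes> inv g) \<otimes> g = (inv g \<otimes> g) \<otimes> s \<otimes> (inv g \<otimes> g)"
        "g \<otimes> (inv g \<otimes> s \<otimes> g) \<otimes> inv g = (g \<otimes> inv g) \<otimes> s \<otimes> (g \<otimes> inv g)"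
        using g s by (simp_all only: m_assoc m_closed inv_closed)
      then show "inv g \<otimes> (g \<otimes> s \<otimes> inv g) \<otimes> g = s" "g \<otimes> (inv g \<otimes> s \<otimes> g) \<otimes> inv g = s"
        using g s by simp_all
    qed
    then show "\<forall>s\<in>Stab p. inv g \<otimes> (g \<otimes> s \<otimes> inv g) \<otimes> g = s" "\<forall>s\<in>Stab x. g \<otimes> (inv g \<otimes> s \<otimes> g) \<otimes> inv g = s"
      using stab_iff by blast+
    have ip: "\<phi> (inv g) x = p" using act_inv[OF g(1) p] g by simp
    show "(\<lambda>s. g \<otimes> s \<otimes> inv g) ` Stab p \<subseteq> Stab x"
      using g x p ip act_mult act_points by (auto simp: stab_iff)
    show "(\<lambda>s. inv g \<otimes> s \<otimes> g) ` Stab x \<subseteq> Stab p"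
      using g x p ip act_mult act_points by (auto simp: stab_iff)
  qed
  then show ?thesis using bij_betw_same_card by fastforce
qed

lemma stabilizer_order:
  assumes p: "p \<in> points X" shows "stabilizer_order G \<phi> (quot p) = card (Stab p)"
  unfolding stabilizer_order_def
proof (rule the_equality)
  show "\<forall>x\<in>quot p. card (Stab x) = card (Stab p)" using card_stab_orbit[OF p] by blast
  show "m = card (Stab p)" if "\<forall>x\<in>quot p. card (Stab x) = m" for m
    using that orbit_refl[OF p] by simp
qed

end

subsection \<open>Quotients isomorphic to the projective line\<close>

definition affine_chart :: "complex option chart" where "affine_chart = (range Some, the)"

definition infinity_chart :: "complex option chart" where
  "infinity_chart = (UNIV - {Some 0}, \<lambda>z. case z of None \<Rightarrow> 0 | Some w \<Rightarrow> inverse w)"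

lemma projective_line_atlas: "atlas projective_line = {affine_chart, infinity_chart}"
  unfolding projective_line_def affine_chart_def infinity_chart_def by simp

lemma projective_line_chart_open: "d \<in> atlas projective_line \<Longrightarrow> openin (topol projective_line) (fst d)"
proof -
  have "openin (Alexandroff_compactification (euclidean :: complex topology)) (UNIV - {Some 0})"
  proof -
    have "UNIV - {Some 0} = insert None (Some ` (topspace euclidean - {0 :: complex}))"
    proof (rule Set.set_eqI)
      show "x \<in> UNIV - {Some 0} \<longleftrightarrow> x \<in> insert None (Some ` (topspace euclidean - {0}))" for x :: "complex option"
        by (cases x) auto
    qed
    then show ?thesis
      unfolding openin_Alexandroff_compactification by (intro disjI2 exI[of _ "{0}"]) simp
  qed
  moreover have "openin (Alexandroff_compactification (euclidean :: complex topology)) (range Some)" by simp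
  ultimately show "d \<in> atlas projective_line \<Longrightarrow> openin (topol projective_line) (fst d)"
    unfolding projective_line_atlas affine_chart_def infinity_chart_def by (auto simp: projective_line_def)
qed

lemma projective_line_chart_inj: "d \<in> atlas projective_line \<Longrightarrow> inj_on (snd d) (fst d)"
  unfolding projective_line_atlas affine_chart_def infinity_chart_def
  by (auto simp: inj_on_def split: option.splits)

text \<open>The value of \<open>\<mu>\<close> at the pole \<open>v\<close> is junk.\<close>

lemma projective_line_simple_pole:
  fixes v :: "complex option"
  obtains \<mu> :: "complex option \<Rightarrow> complex" where
    "\<And>w. w \<noteq> v \<Longrightarrow> \<exists>d\<in>atlas projective_line. w \<in> fst d \<and>
       (\<exists>k. k analytic_on {snd d w} \<and> (\<forall>y\<in>fst d. y \<noteq> v \<longrightarrow> \<mu> y = k (snd d y)))"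
    "\<exists>d\<in>atlas projective_line. v \<in> fst d \<and> (\<forall>y\<in>fst d. y \<noteq> v \<longrightarrow> \<mu> y = inverse (snd d y - snd d v))"
proof (cases v)
  case None
  show ?thesis
  proof (rule that[of the])
    fix w :: "complex option" assume "w \<noteq> v"
    then show "\<exists>d\<in>atlas projective_line. w \<in> fst d \<and>
       (\<exists>k. k analytic_on {snd d w} \<and> (\<forall>y\<in>fst d. y \<noteq> v \<longrightarrow> the y = k (snd d y)))"
      using None unfolding projective_line_atlas affine_chart_def
      by (intro bexI[of _ "(range Some, the)"] conjI exI[of _ "\<lambda>z. z"]) auto
  next
    show "\<exists>d\<in>atlas projective_line. v \<in> fst d \<and> (\<forall>y\<in>fst d. y \<noteq> v \<longrightarrow> the y = inverse (snd d y - snd d v))"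
      using None unfolding projective_line_atlas
      by (intro bexI[of _ infinity_chart]) (auto simp: infinity_chart_def split: option.splits)
  qed
next
  case (Some a)
  define \<mu> where "\<mu> = (\<lambda>y. case y of None \<Rightarrow> 0 | Some w \<Rightarrow> inverse (w - a))"
  show ?thesis
  proof (rule that[of \<mu>])
    fix w :: "complex option" assume w: "w \<noteq> v"
    show "\<exists>d\<in>atlas projective_line. w \<in> fst d \<and>
       (\<exists>k. k analytic_on {snd d w} \<and> (\<forall>y\<in>fst d. y \<noteq> v \<longrightarrow> \<mu> y = k (snd d y)))"
    proof (cases w)
      case (Some b)
      have "(\<lambda>z. inverse (z - a)) analytic_on {b}"
        using w \<open>v = Some a\<close> Some by (intro analytic_intros) auto
      then show ?thesis
        using Some unfolding projective_line_atlas affine_chart_def \<mu>_def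
        by (intro bexI[of _ "(range Some, the)"] conjI exI[of _ "\<lambda>z. inverse (z - a)"]) auto
    next
      case None
      \<comment> \<open>With w = 1/z the function 1/(w - a) becomes z/(1 - a z), which is regular at
        infinity with value 0.\<close>
      have "(\<lambda>z. z / (1 - a * z)) analytic_on {0}" by (intro analytic_intros) auto
      moreover have "\<mu> y = snd infinity_chart y / (1 - a * snd infinity_chart y)" if "y \<in> fst infinity_chart" "y \<noteq> v" for y
        using that \<open>v = Some a\<close> unfolding \<mu>_def infinity_chart_def
        by (auto split: option.splits simp: field_simps)
      ultimately show ?thesis
        using None unfolding projective_line_atlas
        by (intro bexI[of _ infinity_chart] conjI exI[of _ "\<lambda>z. z / (1 - a * z)"]) (auto simp: infinity_chart_def)
    qed
  next
    show "\<exists>d\<in>atlas projective_line. v \<in> fst d \<and> (\<forall>y\<in>fst d. y \<noteq> v \<longrightarrow> \<mu> y = inverse (snd d y - snd d v))"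
      using Some unfolding projective_line_atlas
      by (intro bexI[of _ affine_chart]) (auto simp: affine_chart_def \<mu>_def)
  qed
qed

context curve_action
begin

text \<open>The composite with the quotient map is factored through the chart of
  \<open>quotient_chart\<close>. In that chart f is analytic, and injectivity of f makes its
  derivative nonzero, so the composite inherits the order m of the chart as a function on the
  curve.\<close>

lemma quotient_map_analytic:
  assumes f: "holomorphic_map (quotient_surface G \<phi> X) projective_line f"
    and c: "c \<in> atlas X" "p \<in> fst c" and d: "d \<in> atlas projective_line" "f (quot p) \<in> fst d"
  shows "(\<lambda>z. snd d (f (quot (chart_inv c z)))) analytic_on {snd c p}"
    and "\<forall>\<^sub>F z in nhds (snd c p). f (quot (chart_inv c z)) \<in> fst d"
    and "inj_on f (orbits G (points X) \<phi>) \<Longrightarrow>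
      vanishes_to (\<lambda>z. snd d (f (quot (chart_inv c z))) - snd d (f (quot p))) (snd c p) (card (Stab p))"
proof -
  note cc = atlas_chart[OF c(1)]
  have p: "p \<in> points X" using atlas_points[OF c] .
  let ?Q = "quotient_surface G \<phi> X"
  have topQ: "topol ?Q = quotient_topol G \<phi> X" unfolding quotient_surface_def by simp
  obtain e U where e: "e \<in> atlas ?Q" and U: "openin (topol X) U" "p \<in> U" "fst e = quot ` U"
    and eq: "\<And>x. x \<in> U \<Longrightarrow> snd e (quot x) = lin_coord p x ^ card (Stab p)"
    using quotient_chart[OF p] by metis
  have ee: "is_chart (topol ?Q) e" using e atlas_quotient topQ by simp
  have pe: "quot p \<in> fst e" using U by blast
  let ?k = "\<lambda>z. snd e (quot (chart_inv c z))" and ?\<psi> = "\<lambda>u. snd d (f (chart_inv e u))"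
  have k: "?k analytic_on {snd c p}" by (rule quotient_chart_analytic(1)[OF e c pe])
  have kp: "?k (snd c p) = snd e (quot p)" using chart_inv_left[OF cc c(2)] by simp
  have \<psi>: "?\<psi> analytic_on {snd e (quot p)}"
    and near: "\<forall>\<^sub>F q in nhdsin (topol ?Q) (quot p). q \<in> fst e \<and> f q \<in> fst d"
    by (rule holomorphic_map_analytic_chart[OF f e ee pe d(1) projective_line_chart_open[OF d(1)] d(2)])+
  have "continuous_map (topol X) (topol ?Q) quot"
    unfolding continuous_map_def topQ openin_quotient
    using quotient_points topQ by (auto simp: orbits_def)
  from continuous_map_eventually[OF this p near]
  have "\<forall>\<^sub>F z in nhds (snd c p). quot (chart_inv c z) \<in> fst e \<and> f (quot (chart_inv c z)) \<in> fst d"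
    unfolding chart_eventually_iff[OF cc c(2)] .
  note * = this
  from * show "\<forall>\<^sub>F z in nhds (snd c p). f (quot (chart_inv c z)) \<in> fst d" by (rule eventually_mono) simp
  from * have ev: "\<forall>\<^sub>F z in nhds (snd c p). snd d (f (quot (chart_inv c z))) = ?\<psi> (?k z)"
    by (rule eventually_mono) (simp add: chart_inv_left[OF ee])
  show "(\<lambda>z. snd d (f (quot (chart_inv c z)))) analytic_on {snd c p}"
    by (rule analytic_at_eventually_eq[OF analytic_at_compose[OF k] ev]) (use \<psi> kp in simp)
  show "vanishes_to (\<lambda>z. snd d (f (quot (chart_inv c z))) - snd d (f (quot p))) (snd c p) (card (Stab p))"
    if inj: "inj_on f (orbits G (points X) \<phi>)"
  proof -
    obtain R where R: "open R" "snd e (quot p) \<in> R" "?\<psi> holomorphic_on R" using \<psi> unfolding analytic_at by blast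
    have "\<forall>\<^sub>F u in nhds (snd e (quot p)). chart_inv e u \<in> fst e \<and> f (chart_inv e u) \<in> fst d"
      using near unfolding chart_eventually_iff[OF ee pe] .
    then have "\<forall>\<^sub>F u in nhds (snd e (quot p)). (chart_inv e u \<in> fst e \<and> f (chart_inv e u) \<in> fst d) \<and> u \<in> snd e ` fst e \<and> u \<in> R"
      by (rule eventually_conj[OF _ eventually_conj[OF chart_eventually_image[OF ee pe] eventually_nhds_in_open[OF R(1,2)]]])
    then obtain V where V: "open V" "snd e (quot p) \<in> V"
      "\<And>u. u \<in> V \<Longrightarrow> (chart_inv e u \<in> fst e \<and> f (chart_inv e u) \<in> fst d) \<and> u \<in> snd e ` fst e \<and> u \<in> R"
      unfolding eventually_nhds by blast
    have esub: "fst e \<subseteq> orbits G (points X) \<phi>" using chart_subset[OF ee] quotient_points by simp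
    have "inj_on ?\<psi> V"
    proof (rule inj_onI)
      fix u w assume uw: "u \<in> V" "w \<in> V" "?\<psi> u = ?\<psi> w"
      then have "f (chart_inv e u) = f (chart_inv e w)"
        using inj_onD[OF projective_line_chart_inj[OF d(1)]] V(3) by blast
      then have "chart_inv e u = chart_inv e w" using inj_onD[OF inj] V(3)[OF uw(1)] V(3)[OF uw(2)] esub by blast
      then show "u = w" using chart_inv_into(1)[of u e] chart_inv_into(1)[of w e] V(3)[OF uw(1)] V(3)[OF uw(2)] by metis
    qed
    moreover have "?\<psi> holomorphic_on V" using R(3) V(3) by (meson holomorphic_on_subset subsetI)
    ultimately have "deriv ?\<psi> (snd e (quot p)) \<noteq> 0" using holomorphic_injective_imp_regular[OF _ V(1) _ V(2)] by blast
    then have "vanishes_to (\<lambda>u. ?\<psi> u - ?\<psi> (snd e (quot p))) (snd e (quot p)) 1" using vanishes_to_diff[OF \<psi>] by blast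
    then obtain h where h: "h analytic_on {snd e (quot p)}" "h (snd e (quot p)) \<noteq> 0"
      "\<forall>\<^sub>F u in nhds (snd e (quot p)). ?\<psi> u - ?\<psi> (snd e (quot p)) = h u * (u - snd e (quot p))"
      unfolding vanishes_to_def by auto
    \<comment> \<open>The chart is centred at the image of p, because \<open>lin_coord p\<close>
      vanishes at p and the exponent is positive.\<close>
    have p0: "snd e (quot p) = 0"
      using eq[OF U(2)] lin_coord_self[OF p] finite_stab stabilizer_one_closed[OF p]
      by (simp add: power_0_left card_eq_0_iff) blast
    have hk: "(\<lambda>z. h (?k z)) analytic_on {snd c p}" by (rule analytic_at_compose[OF k]) (use h kp in simp)
    then have "vanishes_to (\<lambda>z. h (?k z)) (snd c p) 0" using vanishes_to_0_iff[OF hk] h(2) kp by simp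
    from vanishes_to_mult[OF this quotient_chart_vanishes[OF c U(1,2) eq]]
    have *: "vanishes_to (\<lambda>z. h (?k z) * ?k z) (snd c p) (card (Stab p))" by simp
    have "\<forall>\<^sub>F z in nhds (snd c p). ?\<psi> (?k z) - ?\<psi> (snd e (quot p)) = h (?k z) * (?k z - snd e (quot p))"
      using analytic_at_tendsto[OF k] h(3) unfolding filterlim_iff kp by blast
    then have "\<forall>\<^sub>F z in nhds (snd c p). snd d (f (quot (chart_inv c z))) - snd d (f (quot p)) = h (?k z) * ?k z"
      using ev
    proof eventually_elim
      case (elim z)
      then show ?case using p0 chart_inv_left[OF ee pe] by simp
    qed
    then show ?thesis by (rule vanishes_to_cong[OF *])
  qed
qed

text \<open>\<open>\<eta>\<close> is \<open>\<omega>\<close> times the pullback of a function with a simple pole at the image of \<open>p\<close>.\<close>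

lemma lower_order:
  assumes f: "holomorphic_map (quotient_surface G \<phi> X) projective_line f"
    and inj: "inj_on f (orbits G (points X) \<phi>)"
    and chi: "degree_one_character G chi" and \<omega>: "\<omega> \<in> eigenforms chi" "\<omega> \<noteq> 0"
    and p: "p \<in> points X" and ord: "has_vanishing_order X \<omega> p t" and t: "card (Stab p) \<le> t"
  obtains \<eta> where "\<eta> \<in> eigenforms chi" "\<eta> \<noteq> 0" "has_vanishing_order X \<eta> p (t - card (Stab p))"
proof -
  let ?m = "card (Stab p)" and ?v = "f (quot p)"
  have H: "\<omega> \<in> H10 X" using \<omega> unfolding eigenforms_def by blast
  obtain \<mu> where \<mu>: "\<And>w. w \<noteq> ?v \<Longrightarrow> \<exists>d\<in>atlas projective_line. w \<in> fst d \<and>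
       (\<exists>k. k analytic_on {snd d w} \<and> (\<forall>y\<in>fst d. y \<noteq> ?v \<longrightarrow> \<mu> y = k (snd d y)))"
    and \<mu>v: "\<exists>d\<in>atlas projective_line. ?v \<in> fst d \<and> (\<forall>y\<in>fst d. y \<noteq> ?v \<longrightarrow> \<mu> y = inverse (snd d y - snd d ?v))"
    using projective_line_simple_pole[of ?v] by blast
  obtain b where b: "b \<in> atlas projective_line" "?v \<in> fst b"
    and \<mu>b: "\<And>y. y \<in> fst b \<Longrightarrow> y \<noteq> ?v \<Longrightarrow> \<mu> y = inverse (snd b y - snd b ?v)"
    using \<mu>v by blast
  define M where "M = (\<lambda>x. \<mu> (f (quot x)))"
  define \<theta> where "\<theta> = (\<lambda>(c, x). M x * \<omega> (c, x))"
  let ?N = "quot p"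
  \<comment> \<open>Injectivity of f puts the poles of M exactly on the orbit of p.\<close>
  have fN: "f (quot x) = ?v \<longleftrightarrow> x \<in> ?N" if "x \<in> points X" for x
  proof -
    have "quot x = quot p \<longleftrightarrow> x \<in> quot p"
      using quot_eq_of_mem[OF p] orbit_refl[OF that] by blast
    moreover have "f (quot x) = ?v \<longleftrightarrow> quot x = quot p"
      using inj_on_eq_iff[OF inj, of "quot x" "quot p"] that p unfolding orbits_def by blast
    ultimately show ?thesis by simp
  qed
  have an: "(\<lambda>z. \<theta> (c, chart_inv c z)) analytic_on {snd c x}" if c: "c \<in> atlas X" "x \<in> fst c" and x: "x \<notin> ?N" for c x
  proof -
    note cc = atlas_chart[OF c(1)]
    have xp: "x \<in> points X" using atlas_points[OF c] .
    have xv: "f (quot x) \<noteq> ?v" using fN[OF xp] x by simp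
    obtain d k where d: "d \<in> atlas projective_line" "f (quot x) \<in> fst d"
      and k: "k analytic_on {snd d (f (quot x))}" "\<And>y. y \<in> fst d \<Longrightarrow> y \<noteq> ?v \<Longrightarrow> \<mu> y = k (snd d y)"
      using \<mu>[OF xv] by blast
    let ?l = "\<lambda>z. snd d (f (quot (chart_inv c z)))"
    have l: "?l analytic_on {snd c x}" by (rule quotient_map_analytic(1)[OF f c d])
    have kl: "(\<lambda>z. k (?l z)) analytic_on {snd c x}"
      by (rule analytic_at_compose[OF l]) (use k chart_inv_left[OF cc c(2)] in simp)
    have "\<forall>\<^sub>F y in nhdsin (topol X) x. y \<in> points X" by (rule eventually_nhdsin_openin[OF openin_topspace xp])
    moreover have "\<forall>\<^sub>F y in nhdsin (topol X) x. y \<notin> ?N"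
      by (rule eventually_avoid_finite) (use finite_orbit quot_eq_of_mem[OF p] xp x in auto)
    ultimately have "\<forall>\<^sub>F y in nhdsin (topol X) x. y \<in> points X - ?N" by eventually_elim simp
    then have "\<forall>\<^sub>F z in nhds (snd c x). chart_inv c z \<in> points X - ?N"
      unfolding chart_eventually_iff[OF cc c(2)] .
    then have "\<forall>\<^sub>F z in nhds (snd c x). \<theta> (c, chart_inv c z) = k (?l z) * \<omega> (c, chart_inv c z)"
      using quotient_map_analytic(2)[OF f c d]
    proof eventually_elim
      case (elim z)
      then have "\<mu> (f (quot (chart_inv c z))) = k (?l z)" using k(2) fN by blast
      then show ?case unfolding \<theta>_def M_def by simp
    qed
    then show ?thesis
      by (rule analytic_at_eventually_eq[OF analytic_on_mult[OF kl H10_analytic[OF H c]]])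
  qed
  \<comment> \<open>Along the whole orbit the eigenform has order t and M has a pole of order m, so
    the product extends with order t - m, a natural number since m is at most t.\<close>
  have sing: "\<exists>h. vanishes_to h (snd c x) (t - ?m) \<and> (\<forall>\<^sub>F z in at (snd c x). \<theta> (c, chart_inv c z) = h z)"
    if c: "c \<in> atlas X" "x \<in> fst c" and x: "x \<in> ?N" for c x
  proof -
    note cc = atlas_chart[OF c(1)]
    have xp: "x \<in> points X" using atlas_points[OF c] .
    have qx: "quot x = quot p" using quot_eq_of_mem[OF p x] by blast
    obtain g where "g \<in> carrier G" "p = \<phi> g x" using qx quot_iff[OF xp p] by blast
    then have "has_vanishing_order X \<omega> x t" using eigenform_order_orbit[OF chi \<omega> _ xp] ord by blast
    then have "vanishes_to (\<lambda>z. \<omega> (c, chart_inv c z)) (snd c x) t"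
      using has_vanishing_order_iff[OF H \<omega>(2) c] by blast
    then obtain u where u: "u analytic_on {snd c x}" "u (snd c x) \<noteq> 0"
      "\<forall>\<^sub>F z in nhds (snd c x). \<omega> (c, chart_inv c z) = u z * (z - snd c x) ^ t"
      unfolding vanishes_to_def by blast
    let ?l = "\<lambda>z. snd b (f (quot (chart_inv c z))) - snd b ?v"
    have bx: "f (quot x) \<in> fst b" using b qx by simp
    have vl: "vanishes_to ?l (snd c x) ?m"
      using quotient_map_analytic(3)[OF f c b(1) bx inj] card_stab_orbit[OF p x] qx by simp
    then obtain l where l: "l analytic_on {snd c x}" "l (snd c x) \<noteq> 0"
      "\<forall>\<^sub>F z in nhds (snd c x). ?l z = l z * (z - snd c x) ^ ?m"
      unfolding vanishes_to_def by blast
    have ul: "(\<lambda>z. u z / l z) analytic_on {snd c x}" using u l by (intro analytic_on_divide) auto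
    have "vanishes_to (\<lambda>z. u z / l z * (z - snd c x) ^ (t - ?m)) (snd c x) (t - ?m)"
      unfolding vanishes_to_def using ul u(2) l(2) by (intro exI[of _ "\<lambda>z. u z / l z"]) auto
    moreover have "\<forall>\<^sub>F z in at (snd c x). \<theta> (c, chart_inv c z) = u z / l z * (z - snd c x) ^ (t - ?m)"
      using quotient_map_analytic(2)[OF f c b(1) bx] u(3) l(3) analytic_at_nonzero_eventually[OF l(1,2)]
      unfolding eventually_at_filter
    proof eventually_elim
      case (elim z)
      show ?case
      proof (intro impI)
        assume z: "z \<noteq> snd c x"
        have nz: "?l z \<noteq> 0" using elim(3,4) z by simp
        then have "f (quot (chart_inv c z)) \<noteq> ?v" by auto
        then have "\<theta> (c, chart_inv c z) = inverse (?l z) * \<omega> (c, chart_inv c z)"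
          using \<mu>b elim(1) unfolding \<theta>_def M_def by simp
        also have "\<dots> = inverse (l z * (z - snd c x) ^ ?m) * (u z * (z - snd c x) ^ (?m + (t - ?m)))"
          using elim(2,3) t by simp
        also have "\<dots> = u z / l z * (z - snd c x) ^ (t - ?m)"
          using z elim(4) unfolding power_add by (simp add: field_simps)
        finally show "\<theta> (c, chart_inv c z) = u z / l z * (z - snd c x) ^ (t - ?m)" .
      qed
    qed
    ultimately show ?thesis by blast
  qed
  have trans: "\<theta> (c, x) = \<theta> (d, x) * deriv (\<lambda>z. snd d (chart_inv c z)) (snd c x)"
    if "c \<in> atlas X" "d \<in> atlas X" "x \<in> fst c" "x \<in> fst d" for c d x
    using H10_trans[OF H that] unfolding \<theta>_def by simp
  have "\<exists>\<eta>. \<eta> \<in> H10 X \<and> (\<forall>c x. c \<in> atlas X \<longrightarrow> x \<in> fst c \<longrightarrow> x \<notin> ?N \<longrightarrow> \<eta> (c, x) = \<theta> (c, x))"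
  proof (rule H10_extension[of ?N \<theta>, OF finite_orbit an])
    show "\<exists>h. h analytic_on {snd c x} \<and> (\<forall>\<^sub>F z in at (snd c x). \<theta> (c, chart_inv c z) = h z)"
      if "c \<in> atlas X" "x \<in> fst c" "x \<in> ?N" for c x
      using sing[OF that] vanishes_to_analytic by blast
  qed (use trans in blast)+
  then obtain \<eta> where \<eta>: "\<eta> \<in> H10 X" "\<And>c x. c \<in> atlas X \<Longrightarrow> x \<in> fst c \<Longrightarrow> x \<notin> ?N \<Longrightarrow> \<eta> (c, x) = \<theta> (c, x)"
    by blast
  obtain c where c: "c \<in> atlas X" "p \<in> fst c" using atlas_cover[OF p] by blast
  note cc = atlas_chart[OF c(1)]
  obtain h where h: "vanishes_to h (snd c p) (t - ?m)" "\<forall>\<^sub>F z in at (snd c p). \<theta> (c, chart_inv c z) = h z"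
    using sing[OF c orbit_refl[OF p]] by blast
  have "\<forall>\<^sub>F x in nhdsin (topol X) p. x \<notin> ?N - {p}"
    by (rule eventually_avoid_finite) (use finite_orbit quot_eq_of_mem[OF p] p in auto)
  then have "\<forall>\<^sub>F z in nhds (snd c p). chart_inv c z \<notin> ?N - {p}"
    unfolding chart_eventually_iff[OF cc c(2)] .
  then have "\<forall>\<^sub>F z in nhds (snd c p). z \<noteq> snd c p \<longrightarrow> \<eta> (c, chart_inv c z) = h z"
    using h(2)[unfolded eventually_at_filter] chart_eventually_image[OF cc c(2)]
  proof eventually_elim
    case (elim z)
    show ?case
    proof
      assume z: "z \<noteq> snd c p"
      have zz: "snd c (chart_inv c z) = z" "chart_inv c z \<in> fst c" using chart_inv_into[OF elim(3)] by auto
      then have "chart_inv c z \<notin> ?N" using elim(1) z by auto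
      then show "\<eta> (c, chart_inv c z) = h z" using \<eta>(2)[OF c(1) zz(2)] elim(2) z by simp
    qed
  qed
  then have punct: "\<forall>\<^sub>F z in at (snd c p). \<eta> (c, chart_inv c z) = h z" unfolding eventually_at_filter by simp
  have cont: "((\<lambda>z. \<eta> (c, chart_inv c z)) \<longlongrightarrow> \<eta> (c, chart_inv c (snd c p))) (at (snd c p))"
    "(h \<longlongrightarrow> h (snd c p)) (at (snd c p))"
    using analytic_at_imp_isCont[OF H10_analytic[OF \<eta>(1) c]] analytic_at_imp_isCont[OF vanishes_to_analytic[OF h(1)]]
    by (auto simp: isCont_def)
  \<comment> \<open>\<eta> and h have been compared only away from p; continuity of both supplies
    the value at p.\<close>
  have "\<eta> (c, chart_inv c (snd c p)) = h (snd c p)"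
    using tendsto_unique[OF trivial_limit_at cont(1)] cont(2) tendsto_cong[OF punct] by blast
  then have "\<forall>\<^sub>F z in nhds (snd c p). \<eta> (c, chart_inv c z) = h z"
    using punct by (simp add: eventually_nhds_conv_at)
  then have van: "vanishes_to (\<lambda>z. \<eta> (c, chart_inv c z)) (snd c p) (t - ?m)" by (rule vanishes_to_cong[OF h(1)])
  have ne: "\<eta> \<noteq> 0"
  proof
    assume "\<eta> = 0"
    then show False using vanishes_to_isolated[OF van] by simp
  qed
  have "\<eta> \<in> eigenforms chi"
    unfolding eigenforms_def
  proof (intro CollectI conjI ballI \<eta>(1))
    fix g assume g: "g \<in> carrier G"
    let ?g = "inv g"
    have g': "?g \<in> carrier G" using g by simp
    \<comment> \<open>M is constant on orbits, so pulling back affects only the factor \<omega>. The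
      comparison is made off the orbit of p, where \<eta> is this product.\<close>
    have "pullback X X (\<phi> ?g) \<eta> = (\<lambda>i. chi g * \<eta> i)"
    proof (rule forms_eqI[OF pullback_H10[OF rs rs act_holomorphic[OF g'] \<eta>(1)] cfun.subspace_scale[OF subspace_H10 \<eta>(1)] finite_orbit[of p]])
      fix c x assume c: "c \<in> atlas X" "x \<in> fst c" and x: "x \<notin> ?N"
      have xp: "x \<in> points X" using atlas_points[OF c] .
      have yp: "\<phi> ?g x \<in> points X" using act_points[OF g' xp] .
      obtain d where d: "d \<in> atlas X" "\<phi> ?g x \<in> fst d" using atlas_cover[OF yp] by blast
      have q: "quot (\<phi> ?g x) = quot x" by (rule quot_act[OF g' xp])
      have "\<phi> ?g x \<notin> ?N" using fN[OF xp] fN[OF yp] q x by simp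
      then have "pullback X X (\<phi> ?g) \<eta> (c, x) = \<theta> (d, \<phi> ?g x) * deriv (\<lambda>z. snd d (\<phi> ?g (chart_inv c z))) (snd c x)"
        using pullback_eq[OF rs rs act_holomorphic[OF g'] \<eta>(1) c d] \<eta>(2)[OF d] by simp
      also have "\<dots> = M x * pullback X X (\<phi> ?g) \<omega> (c, x)"
        using pullback_eq[OF rs rs act_holomorphic[OF g'] H c d] q unfolding \<theta>_def M_def by simp
      also have "\<dots> = chi g * \<theta> (c, x)"
        using eigenform_pullback[OF chi \<omega>(1) g'] character_inv[OF chi g] unfolding \<theta>_def by simp
      finally show "pullback X X (\<phi> ?g) \<eta> (c, x) = chi g * \<eta> (c, x)" using \<eta>(2)[OF c x] by simp
    qed
    then show "canonical_representation G \<phi> X g \<eta> = (\<lambda>i. chi g * \<eta> i)" unfolding canonical_representation_def .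
  qed
  moreover have "has_vanishing_order X \<eta> p (t - ?m)" using has_vanishing_order_iff[OF \<eta>(1) ne c] van by blast
  ultimately show ?thesis using that ne by blast
qed

end

subsection \<open>Ideals of germs on the product surface\<close>

context riemann_surface_on
begin

text \<open>One fixed coordinate per point, as a function on the surface: coefficients taken in
  different charts can be compared with the same generator.\<close>

definition centred :: "'a \<Rightarrow> 'a \<Rightarrow> complex" where
  "centred x y = snd (chart_at X x) y - snd (chart_at X x) x"

lemma centred_vanishes:
  assumes c: "c \<in> atlas X" "x \<in> fst c"
  shows "vanishes_to (\<lambda>z. centred x (chart_inv c z)) (snd c x) 1"
proof -
  define d where "d = chart_at X x"
  have d: "d \<in> atlas X" "x \<in> fst d" using chart_at[OF atlas_points[OF c]] unfolding d_def by auto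
  have "snd d (chart_inv c (snd c x)) = snd d x" using chart_inv_left[OF atlas_chart[OF c(1)] c(2)] by simp
  then show ?thesis
    using vanishes_to_diff[OF atlas_analytic[OF c(1) d(1) c(1) d(1) c(2) d(2)]]
    unfolding centred_def d_def[symmetric] by simp
qed

text \<open>The coefficient is a unit times the n-th power of the displacement in the chart, and
  \<open>centred x\<close> is a unit times the displacement itself; dividing leaves a unit.\<close>

lemma form_local:
  assumes H: "\<omega> \<in> H10 X" "\<omega> \<noteq> 0" and c: "c \<in> atlas X" "x \<in> fst c" and ord: "has_vanishing_order X \<omega> x n"
  obtains v where "v analytic_on {snd c x}" "v (snd c x) \<noteq> 0"
    "\<forall>\<^sub>F y in nhdsin (topol X) x. \<omega> (c, y) = v (snd c y) * centred x y ^ n"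
proof -
  note cc = atlas_chart[OF c(1)]
  obtain g where g: "g analytic_on {snd c x}" "g (snd c x) \<noteq> 0"
    "\<forall>\<^sub>F z in nhds (snd c x). \<omega> (c, chart_inv c z) = g z * (z - snd c x) ^ n"
    using has_vanishing_order_iff[OF H c] ord unfolding vanishes_to_def by blast
  obtain k where k: "k analytic_on {snd c x}" "k (snd c x) \<noteq> 0"
    "\<forall>\<^sub>F z in nhds (snd c x). centred x (chart_inv c z) = k z * (z - snd c x)"
    using centred_vanishes[OF c] unfolding vanishes_to_def by auto
  have "\<forall>\<^sub>F z in nhds (snd c x). \<omega> (c, chart_inv c z) =
      g (snd c (chart_inv c z)) / k (snd c (chart_inv c z)) ^ n * centred x (chart_inv c z) ^ n"
    using g(3) k(3) analytic_at_nonzero_eventually[OF k(1,2)] chart_eventually_image[OF cc c(2)]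
    by eventually_elim (simp add: chart_inv_into power_mult_distrib)
  then have "\<forall>\<^sub>F y in nhdsin (topol X) x. \<omega> (c, y) = g (snd c y) / k (snd c y) ^ n * centred x y ^ n"
    unfolding chart_eventually_iff[OF cc c(2)] .
  moreover have "(\<lambda>z. g z / k z ^ n) analytic_on {snd c x}"
    using g k by (intro analytic_on_divide analytic_on_power) auto
  moreover have "g (snd c x) / k (snd c x) ^ n \<noteq> 0" using g k by simp
  ultimately show ?thesis by (intro that[of "\<lambda>z. g z / k z ^ n"])
qed

end

lemma eventually_nhdsin_prod:
  assumes "x \<in> topspace S" "y \<in> topspace T"
  shows "eventually P (nhdsin (prod_topology S T) (x, y)) \<longleftrightarrow>
    (\<exists>A B. eventually A (nhdsin S x) \<and> eventually B (nhdsin T y) \<and> (\<forall>u v. A u \<longrightarrow> B v \<longrightarrow> P (u, v)))"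
proof
  assume "eventually P (nhdsin (prod_topology S T) (x, y))"
  then obtain W where W: "openin (prod_topology S T) W" "(x, y) \<in> W" "\<forall>Q\<in>W. P Q"
    using assms unfolding eventually_nhdsin by auto
  from W(1,2) obtain U V where UV: "openin S U" "openin T V" "x \<in> U" "y \<in> V" "U \<times> V \<subseteq> W"
    using openin_prod_topology_alt[THEN iffD1, OF W(1), rule_format, OF W(2)] by (elim exE conjE)
  show "\<exists>A B. eventually A (nhdsin S x) \<and> eventually B (nhdsin T y) \<and> (\<forall>u v. A u \<longrightarrow> B v \<longrightarrow> P (u, v))"
    by (intro exI[of _ "\<lambda>u. u \<in> U"] exI[of _ "\<lambda>v. v \<in> V"] conjI eventually_nhdsin_openin UV)
      (use UV(5) W(3) in blast)
next
  assume "\<exists>A B. eventually A (nhdsin S x) \<and> eventually B (nhdsin T y) \<and> (\<forall>u v. A u \<longrightarrow> B v \<longrightarrow> P (u, v))"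
  then obtain A B where AB: "eventually A (nhdsin S x)" "eventually B (nhdsin T y)"
    "\<And>u v. A u \<Longrightarrow> B v \<Longrightarrow> P (u, v)" by blast
  then obtain U V where UV: "openin S U" "x \<in> U" "\<forall>u\<in>U. A u" "openin T V" "y \<in> V" "\<forall>v\<in>V. B v"
    using assms unfolding eventually_nhdsin by blast
  then have "openin (prod_topology S T) (U \<times> V)" by (simp add: openin_prod_Times_iff)
  then show "eventually P (nhdsin (prod_topology S T) (x, y))"
    unfolding eventually_nhdsin using UV AB(3) by blast
qed

locale riemann_surface_pair = X: riemann_surface_on X + Y: riemann_surface_on Y
  for X :: "'a surface" and Y :: "'b surface"
begin

text \<open>The two-variable counterpart of \<open>chart_eventually_iff\<close>: a basis of product
  neighbourhoods is carried over factor by factor.\<close>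

lemma eventually_nhds2_iff:
  assumes c: "c \<in> atlas X" "x \<in> fst c" and d: "d \<in> atlas Y" "y \<in> fst d"
  shows "eventually P (nhds2 X Y (x, y)) \<longleftrightarrow>
    eventually (\<lambda>Q. P (chart_inv c (fst Q), chart_inv d (snd Q))) (nhds (snd c x, snd d y))"
proof -
  note cc = X.atlas_chart[OF c(1)] and dd = Y.atlas_chart[OF d(1)]
  note prod = eventually_nhdsin_prod[OF X.atlas_points[OF c] Y.atlas_points[OF d]]
  show ?thesis
  proof
    assume "eventually P (nhds2 X Y (x, y))"
    then obtain A B where AB: "eventually A (nhdsin (topol X) x)" "eventually B (nhdsin (topol Y) y)"
      "\<And>u v. A u \<Longrightarrow> B v \<Longrightarrow> P (u, v)" unfolding prod by blast
    have "eventually (\<lambda>z. A (chart_inv c z)) (nhds (snd c x))" "eventually (\<lambda>z. B (chart_inv d z)) (nhds (snd d y))"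
      using AB(1,2) unfolding chart_eventually_iff[OF cc c(2)] chart_eventually_iff[OF dd d(2)] .
    then have "\<forall>\<^sub>F Q in nhds (snd c x, snd d y). A (chart_inv c (fst Q)) \<and> B (chart_inv d (snd Q))"
      unfolding nhds_prod by (rule eventually_prodI)
    then show "eventually (\<lambda>Q. P (chart_inv c (fst Q), chart_inv d (snd Q))) (nhds (snd c x, snd d y))"
      by (rule eventually_mono) (use AB(3) in blast)
  next
    assume "eventually (\<lambda>Q. P (chart_inv c (fst Q), chart_inv d (snd Q))) (nhds (snd c x, snd d y))"
    then obtain A B where AB: "eventually A (nhds (snd c x))" "eventually B (nhds (snd d y))"
      "\<And>u v. A u \<Longrightarrow> B v \<Longrightarrow> P (chart_inv c u, chart_inv d v)"
      unfolding nhds_prod eventually_prod_filter by auto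
    have ev: "eventually (\<lambda>u. u \<in> fst c \<and> A (snd c u)) (nhdsin (topol X) x)"
      "eventually (\<lambda>v. v \<in> fst d \<and> B (snd d v)) (nhdsin (topol Y) y)"
      using AB(1,2) unfolding eventually_nhds_chart_iff[OF cc c(2)] eventually_nhds_chart_iff[OF dd d(2)] .
    have "P (u, v)" if "u \<in> fst c \<and> A (snd c u)" "v \<in> fst d \<and> B (snd d v)" for u v
      using AB(3)[of "snd c u" "snd d v"] that chart_inv_left[OF cc, of u] chart_inv_left[OF dd, of v] by simp
    then show "eventually P (nhds2 X Y (x, y))" unfolding prod using ev by blast
  qed
qed

lemma eventually_nhds2_fst:
  assumes "x \<in> points X" "y \<in> points Y" "\<forall>\<^sub>F u in nhdsin (topol X) x. P u"
  shows "\<forall>\<^sub>F Q in nhds2 X Y (x, y). P (fst Q)"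
  unfolding eventually_nhdsin_prod[OF assms(1,2)]
  by (intro exI[of _ P] exI[of _ "\<lambda>_. True"]) (use assms in auto)

lemma eventually_nhds2_snd:
  assumes "x \<in> points X" "y \<in> points Y" "\<forall>\<^sub>F v in nhdsin (topol Y) y. P v"
  shows "\<forall>\<^sub>F Q in nhds2 X Y (x, y). P (snd Q)"
  unfolding eventually_nhdsin_prod[OF assms(1,2)]
  by (intro exI[of _ "\<lambda>_. True"] exI[of _ P]) (use assms in auto)

lemma eventually_nhds2_points:
  assumes "x \<in> points X" "y \<in> points Y"
  shows "\<forall>\<^sub>F Q in nhds2 X Y (x, y). fst Q \<in> points X \<and> snd Q \<in> points Y"
  using eventually_conj[OF eventually_nhds2_fst[OF assms eventually_nhdsin_openin[OF openin_topspace assms(1)]]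
      eventually_nhds2_snd[OF assms eventually_nhdsin_openin[OF openin_topspace assms(2)]]] .

text \<open>The definition asks for some pair of charts. Composition with the transition maps
  carries the condition to any prescribed pair, and membership becomes a statement about
  \<open>hol2_at\<close>.\<close>

lemma hol_germs_iff:
  assumes c: "c \<in> atlas X" "x \<in> fst c" and d: "d \<in> atlas Y" "y \<in> fst d"
  shows "f \<in> hol_germs X Y (x, y) \<longleftrightarrow>
    hol2_at (\<lambda>Q. f (chart_inv c (fst Q), chart_inv d (snd Q))) (snd c x, snd d y)"
proof
  assume "f \<in> hol_germs X Y (x, y)"
  then obtain c' d' S where c': "c' \<in> atlas X" "x \<in> fst c'" and d': "d' \<in> atlas Y" "y \<in> fst d'"
    and S: "open S" "(snd c' x, snd d' y) \<in> S" "holomorphic2_on (\<lambda>(z, w). f (chart_inv c' z, chart_inv d' w)) S"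
    unfolding hol_germs_def by auto
  note cc = X.atlas_chart[OF c(1)] and dd = Y.atlas_chart[OF d(1)]
  note cc' = X.atlas_chart[OF c'(1)] and dd' = Y.atlas_chart[OF d'(1)]
  let ?f = "\<lambda>(z, w). f (chart_inv c' z, chart_inv d' w)"
  let ?F = "\<lambda>z. snd c' (chart_inv c z)" and ?G = "\<lambda>w. snd d' (chart_inv d w)"
  have "hol2_at ?f (snd c' x, snd d' y)" unfolding hol2_at_iff using S by blast
  moreover have "?F (snd c x) = snd c' x" "?G (snd d y) = snd d' y"
    using chart_inv_left[OF cc c(2)] chart_inv_left[OF dd d(2)] by auto
  moreover have "?F analytic_on {snd c x}" "?G analytic_on {snd d y}"
    using X.atlas_analytic(1)[OF c(1) c'(1) c(1) c'(1) c(2) c'(2)]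
      Y.atlas_analytic(1)[OF d(1) d'(1) d(1) d'(1) d(2) d'(2)] .
  ultimately have *: "hol2_at (\<lambda>Q. ?f (?F (fst Q), ?G (snd Q))) (snd c x, snd d y)"
    using hol2_at_compose[of ?f ?F "snd c x" ?G "snd d y"] by simp
  have "\<forall>\<^sub>F z in nhds (snd c x). chart_inv c z \<in> fst c'" "\<forall>\<^sub>F w in nhds (snd d y). chart_inv d w \<in> fst d'"
    using chart_eventually_domain[OF cc' c'(2)] chart_eventually_domain[OF dd' d'(2)]
    unfolding chart_eventually_iff[OF cc c(2)] chart_eventually_iff[OF dd d(2)] .
  then have "\<forall>\<^sub>F Q in nhds (snd c x, snd d y). chart_inv c (fst Q) \<in> fst c' \<and> chart_inv d (snd Q) \<in> fst d'"
    unfolding nhds_prod by (rule eventually_prodI)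
  then have "\<forall>\<^sub>F Q in nhds (snd c x, snd d y). f (chart_inv c (fst Q), chart_inv d (snd Q)) = ?f (?F (fst Q), ?G (snd Q))"
    by (rule eventually_mono) (simp add: chart_inv_left[OF cc'] chart_inv_left[OF dd'])
  then show "hol2_at (\<lambda>Q. f (chart_inv c (fst Q), chart_inv d (snd Q))) (snd c x, snd d y)"
    by (rule hol2_at_cong[OF *])
next
  let ?f = "\<lambda>Q. f (chart_inv c (fst Q), chart_inv d (snd Q))"
  assume "hol2_at ?f (snd c x, snd d y)"
  then obtain S where S: "open S" "(snd c x, snd d y) \<in> S" "holomorphic2_on ?f S"
    unfolding hol2_at_iff by blast
  let ?I = "(snd c ` fst c) \<times> (snd d ` fst d)"
  have I: "open ?I" using chart_open_image[OF X.atlas_chart[OF c(1)]] chart_open_image[OF Y.atlas_chart[OF d(1)]]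
    by (rule open_Times)
  have "holomorphic2_on (\<lambda>(z, w). f (chart_inv c z, chart_inv d w)) (S \<inter> ?I)"
    using S(3) unfolding holomorphic2_on_def case_prod_unfold by blast
  moreover have "open (S \<inter> ?I)" using S(1) I by (rule open_Int)
  ultimately show "f \<in> hol_germs X Y (x, y)"
    unfolding hol_germs_def using c d S(2)
    by (intro CollectI bexI[of _ c] bexI[of _ d] conjI exI[of _ "S \<inter> ?I"]) auto
qed

context
  fixes x y
  assumes x: "x \<in> points X" and y: "y \<in> points Y"
begin

abbreviation "germs \<equiv> hol_germs X Y (x, y)"
abbreviation "near \<equiv> nhds2 X Y (x, y)"

lemmas chart_pair = X.chart_at[OF x] Y.chart_at[OF y]
lemmas germs_chart_iff = hol_germs_iff[OF chart_pair]
lemmas near_chart_iff = eventually_nhds2_iff[OF chart_pair]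

lemma germs_const: "(\<lambda>_. k) \<in> germs"
  unfolding germs_chart_iff by (rule hol2_at_const)

lemma germs_add: "f \<in> germs \<Longrightarrow> g \<in> germs \<Longrightarrow> (\<lambda>Q. f Q + g Q) \<in> germs"
  unfolding germs_chart_iff by (rule hol2_at_add)

lemma germs_mult: "f \<in> germs \<Longrightarrow> g \<in> germs \<Longrightarrow> (\<lambda>Q. f Q * g Q) \<in> germs"
  unfolding germs_chart_iff by (rule hol2_at_mult)

lemma germs_power: "f \<in> germs \<Longrightarrow> (\<lambda>Q. f Q ^ n) \<in> germs"
  by (induction n) (auto intro: germs_const germs_mult)

lemma germs_fst:
  assumes c: "c \<in> atlas X" "x \<in> fst c" and v: "v analytic_on {snd c x}"
  shows "(\<lambda>Q. v (snd c (fst Q))) \<in> germs"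
proof -
  note d = Y.chart_at[OF y]
  have *: "hol2_at (\<lambda>Q. v (fst Q)) (snd c x, snd (chart_at Y y) y)" by (rule hol2_at_fst[OF v])
  have "\<forall>\<^sub>F Q in nhds (snd c x, snd (chart_at Y y) y). fst Q \<in> snd c ` fst c \<and> True"
    unfolding nhds_prod
    by (rule eventually_prodI[OF chart_eventually_image[OF X.atlas_chart[OF c(1)] c(2)]]) simp
  then have "\<forall>\<^sub>F Q in nhds (snd c x, snd (chart_at Y y) y). v (snd c (chart_inv c (fst Q))) = v (fst Q)"
    by (rule eventually_mono) (simp add: chart_inv_into)
  then show ?thesis
    unfolding hol_germs_iff[OF c d] using hol2_at_cong[OF *] by simp
qed

lemma germs_snd:
  assumes d: "d \<in> atlas Y" "y \<in> fst d" and v: "v analytic_on {snd d y}"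
  shows "(\<lambda>Q. v (snd d (snd Q))) \<in> germs"
proof -
  note c = X.chart_at[OF x]
  have *: "hol2_at (\<lambda>Q. v (snd Q)) (snd (chart_at X x) x, snd d y)" by (rule hol2_at_snd[OF v])
  have "\<forall>\<^sub>F Q in nhds (snd (chart_at X x) x, snd d y). True \<and> snd Q \<in> snd d ` fst d"
    unfolding nhds_prod
    by (rule eventually_prodI[OF _ chart_eventually_image[OF Y.atlas_chart[OF d(1)] d(2)]]) simp
  then have "\<forall>\<^sub>F Q in nhds (snd (chart_at X x) x, snd d y). v (snd d (chart_inv d (snd Q))) = v (snd Q)"
    by (rule eventually_mono) (simp add: chart_inv_into)
  then show ?thesis
    unfolding hol_germs_iff[OF c d] using hol2_at_cong[OF *] by simp
qed

lemma germs_centred: "(\<lambda>Q. X.centred x (fst Q)) \<in> germs" "(\<lambda>Q. Y.centred y (snd Q)) \<in> germs"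
proof -
  have "(\<lambda>z. z - k) analytic_on A" for k :: complex and A by (intro analytic_intros)
  then show "(\<lambda>Q. X.centred x (fst Q)) \<in> germs" "(\<lambda>Q. Y.centred y (snd Q)) \<in> germs"
    unfolding X.centred_def Y.centred_def
    by (rule germs_fst[OF X.chart_at[OF x]], rule germs_snd[OF Y.chart_at[OF y]])
qed

text \<open>The factor h must be a germ, but E is an arbitrary function; where an ideal is meant,
  \<open>germs\<close> is intersected explicitly.\<close>

definition multiples :: "('a \<times> 'b \<Rightarrow> complex) \<Rightarrow> ('a \<times> 'b \<Rightarrow> complex) set" where
  "multiples E = {f. \<exists>h\<in>germs. \<forall>\<^sub>F Q in near. f Q = h Q * E Q}"

lemma multiplesI: "h \<in> germs \<Longrightarrow> \<forall>\<^sub>F Q in near. f Q = h Q * E Q \<Longrightarrow> f \<in> multiples E"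
  unfolding multiples_def by (intro CollectI bexI)

lemma multiplesE:
  assumes "f \<in> multiples E"
  obtains h where "h \<in> germs" "\<forall>\<^sub>F Q in near. f Q = h Q * E Q"
  using assms unfolding multiples_def by (elim CollectE bexE)

lemma multiples_zero: "(\<lambda>_. 0) \<in> multiples E"
  by (rule multiplesI[OF germs_const[of 0]]) simp

lemma germs_multiples_one: "g \<in> germs \<Longrightarrow> g \<in> multiples (\<lambda>_. 1)"
  by (rule multiplesI[of g]) simp_all

lemma multiples_add:
  assumes "f \<in> multiples E" "g \<in> multiples E"
  shows "(\<lambda>Q. f Q + g Q) \<in> multiples E"
proof -
  obtain h where h: "h \<in> germs" "\<forall>\<^sub>F Q in near. f Q = h Q * E Q" by (rule multiplesE[OF assms(1)])
  obtain k where k: "k \<in> germs" "\<forall>\<^sub>F Q in near. g Q = k Q * E Q" by (rule multiplesE[OF assms(2)])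
  show ?thesis
  proof (rule multiplesI[OF germs_add[OF h(1) k(1)]])
    show "\<forall>\<^sub>F Q in near. f Q + g Q = (h Q + k Q) * E Q"
      using h(2) k(2) by eventually_elim (simp add: algebra_simps)
  qed
qed

lemma multiples_mult:
  assumes "f \<in> multiples E" "g \<in> multiples F"
  shows "(\<lambda>Q. f Q * g Q) \<in> multiples (\<lambda>Q. E Q * F Q)"
proof -
  obtain h where h: "h \<in> germs" "\<forall>\<^sub>F Q in near. f Q = h Q * E Q" by (rule multiplesE[OF assms(1)])
  obtain k where k: "k \<in> germs" "\<forall>\<^sub>F Q in near. g Q = k Q * F Q" by (rule multiplesE[OF assms(2)])
  show ?thesis
  proof (rule multiplesI[OF germs_mult[OF h(1) k(1)]])
    show "\<forall>\<^sub>F Q in near. f Q * g Q = (h Q * k Q) * (E Q * F Q)"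
      using h(2) k(2) by eventually_elim (simp add: algebra_simps)
  qed
qed

lemma multiples_prod:
  assumes "\<And>i. i \<in> I \<Longrightarrow> f i \<in> multiples (E i)"
  shows "(\<lambda>Q. \<Prod>i\<in>I. f i Q) \<in> multiples (\<lambda>Q. \<Prod>i\<in>I. E i Q)"
  using assms
proof (induction I rule: infinite_finite_induct)
  case (insert i I)
  then show ?case using multiples_mult[of "f i" "E i" "\<lambda>Q. \<Prod>i\<in>I. f i Q"] by simp
qed (use germs_multiples_one[OF germs_const[of 1]] in simp_all)

lemma multiples_scale: "f \<in> multiples E \<Longrightarrow> g \<in> germs \<Longrightarrow> (\<lambda>Q. g Q * f Q) \<in> multiples E"
  using multiples_mult[OF germs_multiples_one, of g f E] by simp

text \<open>Both stalk computations end in this criterion: a set of generators may be replaced by E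
  once E divides all of them and one of them divides E.\<close>

lemma germ_ideal_principal:
  assumes 1: "S \<subseteq> multiples E" and 2: "\<exists>s\<in>S. E \<in> multiples s"
  shows "germ_ideal X Y (x, y) S = germs \<inter> multiples E"
proof
  show "germ_ideal X Y (x, y) S \<subseteq> germs \<inter> multiples E"
  proof
    fix f assume "f \<in> germ_ideal X Y (x, y) S"
    then obtain n :: nat and a s where f: "f \<in> germs" "\<forall>i<n. a i \<in> germs \<and> s i \<in> S"
      "\<forall>\<^sub>F Q in near. f Q = (\<Sum>i<n. a i Q * s i Q)"
      unfolding germ_ideal_def by blast
    have "(\<lambda>Q. \<Sum>i<k. a i Q * s i Q) \<in> multiples E" if "k \<le> n" for k
      using that
    proof (induction k)
      case 0
      then show ?case using multiples_zero by simp
    next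
      case (Suc k)
      then have "a k \<in> germs" "s k \<in> multiples E" using f(2) 1 by (auto simp: Suc_le_eq)
      then have "(\<lambda>Q. a k Q * s k Q) \<in> multiples E" by (intro multiples_scale)
      moreover have "(\<lambda>Q. \<Sum>i<k. a i Q * s i Q) \<in> multiples E" using Suc by simp
      ultimately show ?case using multiples_add by simp
    qed
    from this[OF order_refl] obtain h where h: "h \<in> germs" "\<forall>\<^sub>F Q in near. (\<Sum>i<n. a i Q * s i Q) = h Q * E Q"
      by (rule multiplesE)
    have "\<forall>\<^sub>F Q in near. f Q = h Q * E Q" using f(3) h(2) by eventually_elim simp
    then show "f \<in> germs \<inter> multiples E" using multiplesI[OF h(1)] f(1) by simp
  qed
  show "germs \<inter> multiples E \<subseteq> germ_ideal X Y (x, y) S"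
  proof
    fix f assume f: "f \<in> germs \<inter> multiples E"
    then have "f \<in> multiples E" by simp
    then obtain h where h: "h \<in> germs" "\<forall>\<^sub>F Q in near. f Q = h Q * E Q" by (rule multiplesE)
    obtain s where s1: "s \<in> S" "E \<in> multiples s" using 2 by (elim bexE)
    obtain u where s: "u \<in> germs" "\<forall>\<^sub>F Q in near. E Q = u Q * s Q"
      by (rule multiplesE[OF s1(2)])
    have "\<forall>\<^sub>F Q in near. f Q = (\<Sum>i<(1::nat). (h Q * u Q) * s Q)"
      using h(2) s(2) by eventually_elim simp
    then show "f \<in> germ_ideal X Y (x, y) S"
      unfolding germ_ideal_def using f germs_mult[OF h(1) s(1)] s1(1)
      by (intro CollectI conjI exI[of _ "1::nat"] exI[of _ "\<lambda>_ Q. h Q * u Q"] exI[of _ "\<lambda>_. s"]) auto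
  qed
qed

definition monomial :: "nat \<Rightarrow> nat \<Rightarrow> 'a \<times> 'b \<Rightarrow> complex" where
  "monomial a b = (\<lambda>Q. X.centred x (fst Q) ^ a * Y.centred y (snd Q) ^ b)"

text \<open>The leading factors v and w are units, so the coefficient of the wedge and the monomial
  divide each other.\<close>

lemma ext_wedge_local:
  assumes \<omega>: "\<omega>\<^sub>1 \<in> H10 X" "\<omega>\<^sub>1 \<noteq> 0" "\<omega>\<^sub>2 \<in> H10 Y" "\<omega>\<^sub>2 \<noteq> 0"
    and c: "c \<in> atlas X" "x \<in> fst c" and d: "d \<in> atlas Y" "y \<in> fst d"
    and ord: "has_vanishing_order X \<omega>\<^sub>1 x n" "has_vanishing_order Y \<omega>\<^sub>2 y k"
  shows "(\<lambda>Q. ext_wedge \<omega>\<^sub>1 \<omega>\<^sub>2 ((c, d), Q)) \<in> multiples (monomial n k)"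
    and "monomial n k \<in> multiples (\<lambda>Q. ext_wedge \<omega>\<^sub>1 \<omega>\<^sub>2 ((c, d), Q))"
proof -
  obtain v where v: "v analytic_on {snd c x}" "v (snd c x) \<noteq> 0"
    "\<forall>\<^sub>F u in nhdsin (topol X) x. \<omega>\<^sub>1 (c, u) = v (snd c u) * X.centred x u ^ n"
    using X.form_local[OF \<omega>(1,2) c ord(1)] by blast
  obtain w where w: "w analytic_on {snd d y}" "w (snd d y) \<noteq> 0"
    "\<forall>\<^sub>F u in nhdsin (topol Y) y. \<omega>\<^sub>2 (d, u) = w (snd d u) * Y.centred y u ^ k"
    using Y.form_local[OF \<omega>(3,4) d ord(2)] by blast
  have ev: "\<forall>\<^sub>F Q in near. ext_wedge \<omega>\<^sub>1 \<omega>\<^sub>2 ((c, d), Q) = (v (snd c (fst Q)) * w (snd d (snd Q))) * monomial n k Q"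
    using eventually_nhds2_fst[OF x y v(3)] eventually_nhds2_snd[OF x y w(3)]
    by eventually_elim (simp add: ext_wedge_def case_prod_unfold monomial_def)
  then show "(\<lambda>Q. ext_wedge \<omega>\<^sub>1 \<omega>\<^sub>2 ((c, d), Q)) \<in> multiples (monomial n k)"
    by (rule multiplesI[OF germs_mult[OF germs_fst[OF c v(1)] germs_snd[OF d w(1)]]])
  have nz: "\<forall>\<^sub>F u in nhdsin (topol X) x. v (snd c u) \<noteq> 0" "\<forall>\<^sub>F u in nhdsin (topol Y) y. w (snd d u) \<noteq> 0"
    using analytic_at_nonzero_eventually[OF v(1,2)] analytic_at_nonzero_eventually[OF w(1,2)]
      chart_eventually_coord_iff[OF X.atlas_chart[OF c(1)] c(2), of "\<lambda>z. v z \<noteq> 0"]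
      chart_eventually_coord_iff[OF Y.atlas_chart[OF d(1)] d(2), of "\<lambda>z. w z \<noteq> 0"] by auto
  have "\<forall>\<^sub>F Q in near. monomial n k Q = (inverse (v (snd c (fst Q))) * inverse (w (snd d (snd Q)))) * ext_wedge \<omega>\<^sub>1 \<omega>\<^sub>2 ((c, d), Q)"
    using ev eventually_nhds2_fst[OF x y nz(1)] eventually_nhds2_snd[OF x y nz(2)]
    by eventually_elim (simp add: field_simps)
  moreover have "(\<lambda>z. inverse (v z)) analytic_on {snd c x}" "(\<lambda>z. inverse (w z)) analytic_on {snd d y}"
    using v w by (auto intro!: analytic_on_inverse)
  ultimately show "monomial n k \<in> multiples (\<lambda>Q. ext_wedge \<omega>\<^sub>1 \<omega>\<^sub>2 ((c, d), Q))"
    using multiplesI[OF germs_mult[OF germs_fst[OF c, of "\<lambda>z. inverse (v z)"] germs_snd[OF d, of "\<lambda>z. inverse (w z)"]]] by simp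
qed

lemma multiples_monomial_mono:
  assumes "f \<in> multiples (monomial n k)" "a \<le> n" "b \<le> k"
  shows "f \<in> multiples (monomial a b)"
proof -
  obtain h where h: "h \<in> germs" "\<forall>\<^sub>F Q in near. f Q = h Q * monomial n k Q" by (rule multiplesE[OF assms(1)])
  have "monomial n k Q = monomial (n - a) (k - b) Q * monomial a b Q" for Q
    unfolding monomial_def using assms(2,3) power_add[of "X.centred x (fst Q)" "n - a" a] power_add[of "Y.centred y (snd Q)" "k - b" b]
    by simp
  then have "\<forall>\<^sub>F Q in near. f Q = (h Q * monomial (n - a) (k - b) Q) * monomial a b Q"
    using h(2) by (simp add: mult.assoc)
  moreover have "monomial (n - a) (k - b) \<in> germs"
    unfolding monomial_def by (intro germs_mult germs_power germs_centred)
  ultimately show ?thesis using multiplesI[OF germs_mult[OF h(1)]] by simp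
qed

text \<open>The monomial divides the coefficient of every wedge, since the orders are at least a and
  b, and divisibility passes to linear combinations. The wedge of two forms attaining the minima
  divides the monomial in turn.\<close>

lemma base_scheme_stalk:
  assumes V: "V\<^sub>1 \<subseteq> H10 X" "V\<^sub>2 \<subseteq> H10 Y"
    and min1: "\<And>\<omega> n. \<omega> \<in> V\<^sub>1 \<Longrightarrow> \<omega> \<noteq> 0 \<Longrightarrow> has_vanishing_order X \<omega> x n \<Longrightarrow> a \<le> n"
    and att1: "\<exists>\<omega>\<in>V\<^sub>1. \<omega> \<noteq> 0 \<and> has_vanishing_order X \<omega> x a"
    and min2: "\<And>\<omega> n. \<omega> \<in> V\<^sub>2 \<Longrightarrow> \<omega> \<noteq> 0 \<Longrightarrow> has_vanishing_order Y \<omega> y n \<Longrightarrow> b \<le> n"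
    and att2: "\<exists>\<omega>\<in>V\<^sub>2. \<omega> \<noteq> 0 \<and> has_vanishing_order Y \<omega> y b"
  shows "base_scheme X Y (tensor_forms V\<^sub>1 V\<^sub>2) (x, y) = germs \<inter> multiples (monomial a b)"
proof -
  let ?S = "{\<lambda>Q. \<eta> ((c, d), Q) | \<eta> c d. \<eta> \<in> tensor_forms V\<^sub>1 V\<^sub>2 \<and> c \<in> atlas X \<and> d \<in> atlas Y \<and> (x, y) \<in> fst c \<times> fst d}"
  have "germ_ideal X Y (x, y) ?S = germs \<inter> multiples (monomial a b)"
  proof (rule germ_ideal_principal)
    have "(\<lambda>Q. \<eta> ((c, d), Q)) \<in> multiples (monomial a b)"
      if \<eta>: "\<eta> \<in> tensor_forms V\<^sub>1 V\<^sub>2" and c: "c \<in> atlas X" "x \<in> fst c" and d: "d \<in> atlas Y" "y \<in> fst d" for \<eta> c d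
      using \<eta> unfolding tensor_forms_def
    proof (induction rule: cfun.span_induct)
      case base
      show ?case
      proof (rule cfun.subspaceI)
        show "0 \<in> {\<eta>. (\<lambda>Q. \<eta> ((c, d), Q)) \<in> multiples (monomial a b)}" using multiples_zero by simp
      next
        fix \<eta> \<theta> assume "\<eta> \<in> {\<eta>. (\<lambda>Q. \<eta> ((c, d), Q)) \<in> multiples (monomial a b)}" "\<theta> \<in> {\<eta>. (\<lambda>Q. \<eta> ((c, d), Q)) \<in> multiples (monomial a b)}"
        then show "\<eta> + \<theta> \<in> {\<eta>. (\<lambda>Q. \<eta> ((c, d), Q)) \<in> multiples (monomial a b)}" using multiples_add by simp
      next
        fix k \<eta> assume "\<eta> \<in> {\<eta>. (\<lambda>Q. \<eta> ((c, d), Q)) \<in> multiples (monomial a b)}"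
        then show "(\<lambda>i. k * \<eta> i) \<in> {\<eta>. (\<lambda>Q. \<eta> ((c, d), Q)) \<in> multiples (monomial a b)}"
          using multiples_scale[OF _ germs_const[of k]] by simp
      qed
    next
      case (step \<eta>)
      then obtain \<omega>\<^sub>1 \<omega>\<^sub>2 where \<omega>: "\<eta> = ext_wedge \<omega>\<^sub>1 \<omega>\<^sub>2" "\<omega>\<^sub>1 \<in> V\<^sub>1" "\<omega>\<^sub>2 \<in> V\<^sub>2" by blast
      \<comment> \<open>Zero forms have no vanishing order and are treated separately.\<close>
      show ?case
      proof (cases "\<omega>\<^sub>1 = 0 \<or> \<omega>\<^sub>2 = 0")
        case True
        then have "(\<lambda>Q. \<eta> ((c, d), Q)) = (\<lambda>_. 0)" by (auto simp: \<omega>(1) ext_wedge_def)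
        then show ?thesis using multiples_zero by simp
      next
        case False
        then have ne: "\<omega>\<^sub>1 \<noteq> 0" "\<omega>\<^sub>2 \<noteq> 0" by auto
        have H: "\<omega>\<^sub>1 \<in> H10 X" "\<omega>\<^sub>2 \<in> H10 Y" using \<omega> V by blast+
        obtain n where n: "has_vanishing_order X \<omega>\<^sub>1 x n"
          using X.form_vanishing_order_exists[OF H(1) ne(1) c] X.has_vanishing_order_iff[OF H(1) ne(1) c] by metis
        obtain k where k: "has_vanishing_order Y \<omega>\<^sub>2 y k"
          using Y.form_vanishing_order_exists[OF H(2) ne(2) d] Y.has_vanishing_order_iff[OF H(2) ne(2) d] by metis
        show ?thesis
          unfolding \<omega>(1)
          by (rule multiples_monomial_mono[OF ext_wedge_local(1)[OF H(1) ne(1) H(2) ne(2) c d n k]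
                min1[OF \<omega>(2) ne(1) n] min2[OF \<omega>(3) ne(2) k]])
      qed
    qed
    then show "?S \<subseteq> multiples (monomial a b)" by auto
    obtain \<omega>\<^sub>1 where 1: "\<omega>\<^sub>1 \<in> V\<^sub>1" "\<omega>\<^sub>1 \<noteq> 0" "has_vanishing_order X \<omega>\<^sub>1 x a" using att1 by blast
    obtain \<omega>\<^sub>2 where 2: "\<omega>\<^sub>2 \<in> V\<^sub>2" "\<omega>\<^sub>2 \<noteq> 0" "has_vanishing_order Y \<omega>\<^sub>2 y b" using att2 by blast
    have "ext_wedge \<omega>\<^sub>1 \<omega>\<^sub>2 \<in> tensor_forms V\<^sub>1 V\<^sub>2" unfolding tensor_forms_def using 1 2 by (intro cfun.span_base) blast
    then have "(\<lambda>Q. ext_wedge \<omega>\<^sub>1 \<omega>\<^sub>2 ((chart_at X x, chart_at Y y), Q)) \<in> ?S" using chart_pair by blast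
    moreover have "monomial a b \<in> multiples (\<lambda>Q. ext_wedge \<omega>\<^sub>1 \<omega>\<^sub>2 ((chart_at X x, chart_at Y y), Q))"
      using ext_wedge_local(2)[OF _ 1(2) _ 2(2) chart_pair 1(3) 2(3)] V 1(1) 2(1) by blast
    ultimately show "\<exists>s\<in>?S. monomial a b \<in> multiples s" by blast
  qed
  then show ?thesis unfolding base_scheme_def using x y by simp
qed

text \<open>The fibre q is finite, so near x it consists of x alone and the curve is given by the
  vanishing of one coordinate. Division of a germ by that coordinate is
  \<open>hol2_at_divide_fst\<close>.\<close>

lemma reduced_ideal_vert:
  assumes q: "finite q" "q \<subseteq> points X" "x \<in> q"
  shows "reduced_ideal X Y (R_vert Y q) (x, y) \<subseteq> multiples (\<lambda>Q. X.centred x (fst Q))"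
    and "(\<lambda>Q. X.centred x (fst Q)) \<in> reduced_ideal X Y (R_vert Y q) (x, y)"
proof
  note c = X.chart_at[OF x] and d = Y.chart_at[OF y]
  note cc = X.atlas_chart[OF c(1)] and dd = Y.atlas_chart[OF d(1)]
  fix f assume "f \<in> reduced_ideal X Y (R_vert Y q) (x, y)"
  then have f: "f \<in> germs" "\<forall>\<^sub>F Q in near. Q \<in> R_vert Y q \<longrightarrow> f Q = 0" unfolding reduced_ideal_def by auto
  let ?f = "\<lambda>Q. f (chart_inv (chart_at X x) (fst Q), chart_inv (chart_at Y y) (snd Q))"
  let ?P = "(snd (chart_at X x) x, snd (chart_at Y y) y)"
  have "\<forall>\<^sub>F Q in near. (Q \<in> R_vert Y q \<longrightarrow> f Q = 0) \<and> fst Q \<in> points X \<and> snd Q \<in> points Y"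
    using f(2) eventually_nhds2_points[OF x y] by (rule eventually_conj)
  then have "\<forall>\<^sub>F Q in nhds ?P. fst Q = snd (chart_at X x) x \<longrightarrow> ?f Q = 0"
    unfolding near_chart_iff
    by (rule eventually_mono) (use q(3) chart_inv_left[OF cc c(2)] in \<open>auto simp: R_vert_def\<close>)
  with f(1)[unfolded germs_chart_iff] obtain h where h: "hol2_at h ?P"
    "\<forall>\<^sub>F Q in nhds ?P. ?f Q = h Q * (fst Q - snd (chart_at X x) x)"
    by (rule hol2_at_divide_fst)
  let ?h = "\<lambda>Q. h (snd (chart_at X x) (fst Q), snd (chart_at Y y) (snd Q))"
  have img: "\<forall>\<^sub>F Q in nhds ?P. fst Q \<in> snd (chart_at X x) ` fst (chart_at X x) \<and> snd Q \<in> snd (chart_at Y y) ` fst (chart_at Y y)"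
    unfolding nhds_prod by (rule eventually_prodI[OF chart_eventually_image[OF cc c(2)] chart_eventually_image[OF dd d(2)]])
  then have "\<forall>\<^sub>F Q in nhds ?P. ?h (chart_inv (chart_at X x) (fst Q), chart_inv (chart_at Y y) (snd Q)) = h Q"
    by (rule eventually_mono) (simp add: chart_inv_into)
  then have "?h \<in> germs" unfolding germs_chart_iff by (rule hol2_at_cong[OF h(1)])
  moreover have "\<forall>\<^sub>F Q in near. f Q = ?h Q * X.centred x (fst Q)"
    unfolding near_chart_iff X.centred_def
    using h(2) img by eventually_elim (simp add: chart_inv_into)
  ultimately show "f \<in> multiples (\<lambda>Q. X.centred x (fst Q))" by (rule multiplesI)
next
  have "\<forall>\<^sub>F u in nhdsin (topol X) x. u \<notin> q - {x}"
    by (rule X.eventually_avoid_finite) (use q x in auto)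
  from eventually_nhds2_fst[OF x y this]
  have "\<forall>\<^sub>F Q in near. Q \<in> R_vert Y q \<longrightarrow> X.centred x (fst Q) = 0"
    by (rule eventually_mono) (auto simp: R_vert_def X.centred_def)
  then show "(\<lambda>Q. X.centred x (fst Q)) \<in> reduced_ideal X Y (R_vert Y q) (x, y)"
    unfolding reduced_ideal_def using germs_centred(1) by blast
qed

lemma reduced_ideal_hor:
  assumes l: "finite l" "l \<subseteq> points Y" "y \<in> l"
  shows "reduced_ideal X Y (R_hor X l) (x, y) \<subseteq> multiples (\<lambda>Q. Y.centred y (snd Q))"
    and "(\<lambda>Q. Y.centred y (snd Q)) \<in> reduced_ideal X Y (R_hor X l) (x, y)"
proof
  note c = X.chart_at[OF x] and d = Y.chart_at[OF y]
  note cc = X.atlas_chart[OF c(1)] and dd = Y.atlas_chart[OF d(1)]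
  fix f assume "f \<in> reduced_ideal X Y (R_hor X l) (x, y)"
  then have f: "f \<in> germs" "\<forall>\<^sub>F Q in near. Q \<in> R_hor X l \<longrightarrow> f Q = 0" unfolding reduced_ideal_def by auto
  let ?f = "\<lambda>Q. f (chart_inv (chart_at X x) (fst Q), chart_inv (chart_at Y y) (snd Q))"
  let ?P = "(snd (chart_at X x) x, snd (chart_at Y y) y)"
  have "\<forall>\<^sub>F Q in near. (Q \<in> R_hor X l \<longrightarrow> f Q = 0) \<and> fst Q \<in> points X \<and> snd Q \<in> points Y"
    using f(2) eventually_nhds2_points[OF x y] by (rule eventually_conj)
  then have "\<forall>\<^sub>F Q in nhds ?P. snd Q = snd (chart_at Y y) y \<longrightarrow> ?f Q = 0"
    unfolding near_chart_iff
    by (rule eventually_mono) (use l(3) chart_inv_left[OF dd d(2)] in \<open>auto simp: R_hor_def\<close>)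
  with f(1)[unfolded germs_chart_iff] obtain h where h: "hol2_at h ?P"
    "\<forall>\<^sub>F Q in nhds ?P. ?f Q = h Q * (snd Q - snd (chart_at Y y) y)"
    by (rule hol2_at_divide_snd)
  let ?h = "\<lambda>Q. h (snd (chart_at X x) (fst Q), snd (chart_at Y y) (snd Q))"
  have img: "\<forall>\<^sub>F Q in nhds ?P. fst Q \<in> snd (chart_at X x) ` fst (chart_at X x) \<and> snd Q \<in> snd (chart_at Y y) ` fst (chart_at Y y)"
    unfolding nhds_prod by (rule eventually_prodI[OF chart_eventually_image[OF cc c(2)] chart_eventually_image[OF dd d(2)]])
  then have "\<forall>\<^sub>F Q in nhds ?P. ?h (chart_inv (chart_at X x) (fst Q), chart_inv (chart_at Y y) (snd Q)) = h Q"
    by (rule eventually_mono) (simp add: chart_inv_into)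
  then have "?h \<in> germs" unfolding germs_chart_iff by (rule hol2_at_cong[OF h(1)])
  moreover have "\<forall>\<^sub>F Q in near. f Q = ?h Q * Y.centred y (snd Q)"
    unfolding near_chart_iff Y.centred_def
    using h(2) img by eventually_elim (simp add: chart_inv_into)
  ultimately show "f \<in> multiples (\<lambda>Q. Y.centred y (snd Q))" by (rule multiplesI)
next
  have "\<forall>\<^sub>F u in nhdsin (topol Y) y. u \<notin> l - {y}"
    by (rule Y.eventually_avoid_finite) (use l y in auto)
  from eventually_nhds2_snd[OF x y this]
  have "\<forall>\<^sub>F Q in near. Q \<in> R_hor X l \<longrightarrow> Y.centred y (snd Q) = 0"
    by (rule eventually_mono) (auto simp: R_hor_def Y.centred_def)
  then show "(\<lambda>Q. Y.centred y (snd Q)) \<in> reduced_ideal X Y (R_hor X l) (x, y)"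
    unfolding reduced_ideal_def using germs_centred(2) by blast
qed

text \<open>A curve that misses the point misses a neighbourhood of it, so its ideal there is the
  unit ideal.\<close>

lemma one_in_reduced_ideal:
  "finite q \<Longrightarrow> q \<subseteq> points X \<Longrightarrow> x \<notin> q \<Longrightarrow> (\<lambda>_. 1) \<in> reduced_ideal X Y (R_vert Y q) (x, y)"
  "finite l \<Longrightarrow> l \<subseteq> points Y \<Longrightarrow> y \<notin> l \<Longrightarrow> (\<lambda>_. 1) \<in> reduced_ideal X Y (R_hor X l) (x, y)"
proof -
  assume "finite q" "q \<subseteq> points X" "x \<notin> q"
  from eventually_nhds2_fst[OF x y X.eventually_avoid_finite[OF this(1,2) x this(3)]]
  have "\<forall>\<^sub>F Q in near. Q \<in> R_vert Y q \<longrightarrow> (1::complex) = 0"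
    by (rule eventually_mono) (auto simp: R_vert_def)
  then show "(\<lambda>_. 1) \<in> reduced_ideal X Y (R_vert Y q) (x, y)"
    unfolding reduced_ideal_def using germs_const by blast
next
  assume "finite l" "l \<subseteq> points Y" "y \<notin> l"
  from eventually_nhds2_snd[OF x y Y.eventually_avoid_finite[OF this(1,2) y this(3)]]
  have "\<forall>\<^sub>F Q in near. Q \<in> R_hor X l \<longrightarrow> (1::complex) = 0"
    by (rule eventually_mono) (auto simp: R_hor_def)
  then show "(\<lambda>_. 1) \<in> reduced_ideal X Y (R_hor X l) (x, y)"
    unfolding reduced_ideal_def using germs_const by blast
qed

end

end

section \<open>Stalks of fibre divisors\<close>

lemma prod_mset_sum_replicate:
  assumes "finite A"
  shows "prod_mset (image_mset g (\<Sum>q\<in>A. replicate_mset (t q) (V q))) = (\<Prod>q\<in>A. g (V q) ^ t q)"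
  using assms by (induction A rule: finite_induct) auto

lemma set_mset_fibre_divisor:
  assumes "finite A" "finite B" "Z \<in># fibre_divisor X Y A t B u"
  shows "(\<exists>q\<in>A. Z = R_vert Y q) \<or> (\<exists>l\<in>B. Z = R_hor X l)"
proof -
  have *: "(\<exists>q\<in>A. Z = V q)" if "finite A" "Z \<in># (\<Sum>q\<in>A. replicate_mset (t q) (V q))"
    for A :: "'c set" and t V and Z :: "('a \<times> 'b) set"
    using that by (induction A rule: finite_induct) (auto split: if_splits)
  show ?thesis using assms *[of A] *[of B] unfolding fibre_divisor_def by auto
qed

context riemann_surface_pair
begin

context
  fixes x y
  assumes x: "x \<in> points X" and y: "y \<in> points Y"
begin

text \<open>Only the fibres through x and y have a nontrivial local equation. The alternatives with
  multiplicity 0 cover points whose fibre is not among the indices.\<close>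

lemma divisor_scheme_stalk:
  assumes A: "finite A" "\<And>q. q \<in> A \<Longrightarrow> finite q \<and> q \<subseteq> points X" "\<And>q. q \<in> A \<Longrightarrow> x \<in> q \<longleftrightarrow> q = q\<^sub>0"
    and q\<^sub>0: "finite q\<^sub>0" "q\<^sub>0 \<subseteq> points X" "x \<in> q\<^sub>0" "q\<^sub>0 \<in> A \<or> t q\<^sub>0 = 0"
    and B: "finite B" "\<And>l. l \<in> B \<Longrightarrow> finite l \<and> l \<subseteq> points Y" "\<And>l. l \<in> B \<Longrightarrow> y \<in> l \<longleftrightarrow> l = l\<^sub>0"
    and l\<^sub>0: "finite l\<^sub>0" "l\<^sub>0 \<subseteq> points Y" "y \<in> l\<^sub>0" "l\<^sub>0 \<in> B \<or> u l\<^sub>0 = 0"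
  shows "divisor_scheme X Y (fibre_divisor X Y A t B u) (x, y) =
     hol_germs X Y (x, y) \<inter> multiples x y (monomial x y (t q\<^sub>0) (u l\<^sub>0))"
proof -
  let ?D = "fibre_divisor X Y A t B u" and ?I = "\<lambda>Z. reduced_ideal X Y Z (x, y)"
  let ?E = "monomial x y (t q\<^sub>0) (u l\<^sub>0)" and ?M = "multiples x y"
  let ?zx = "\<lambda>Q::'a \<times> 'b. X.centred x (fst Q)" and ?zy = "\<lambda>Q::'a \<times> 'b. Y.centred y (snd Q)"
  \<comment> \<open>A local equation for each component. Components are bare sets without a label
    for their direction, so the definition compares sets, and the next facts ensure that the cases
    do not overlap.\<close>
  define gen where "gen = (\<lambda>Z Q. if Z = R_vert Y q\<^sub>0 then ?zx Q else if Z = R_hor X l\<^sub>0 then ?zy Q else 1)"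
  have vert_inj: "R_vert Y q = R_vert Y q' \<longleftrightarrow> q = q'" for q q' :: "'a set"
    using y unfolding R_vert_def by (auto simp: times_eq_iff)
  have hor_inj: "R_hor X l = R_hor X l' \<longleftrightarrow> l = l'" for l l' :: "'b set"
    using x unfolding R_hor_def by (auto simp: times_eq_iff)
  \<comment> \<open>If both curves are nonempty, projection to the first factor would equate the
    finite set q with the infinite curve.\<close>
  have vert_hor: "R_vert Y q \<noteq> R_hor X l" if "finite q" "q \<noteq> {} \<or> l \<noteq> {}" for q :: "'a set" and l :: "'b set"
  proof
    assume "R_vert Y q = R_hor X l"
    then have "fst ` (q \<times> points Y) = fst ` (points X \<times> l)" "snd ` (q \<times> points Y) = snd ` (points X \<times> l)"
      unfolding R_vert_def R_hor_def by simp_all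
    then show False using that x y X.infinite_points by (auto simp: fst_image_times snd_image_times split: if_splits)
  qed
  have "R_vert Y q\<^sub>0 \<noteq> R_hor X l\<^sub>0" using vert_hor[OF q\<^sub>0(1), of l\<^sub>0] q\<^sub>0(3) by blast
  then have gen_eq: "gen (R_vert Y q\<^sub>0) = ?zx" "gen (R_hor X l\<^sub>0) = ?zy"
    unfolding gen_def by auto
  have gen_I: "gen Z \<in> ?I Z" and I_gen: "?I Z \<subseteq> ?M (gen Z)" if Z: "Z \<in># ?D" for Z
  proof -
    have "gen Z \<in> ?I Z \<and> ?I Z \<subseteq> ?M (gen Z)"
    proof (cases "Z = R_vert Y q\<^sub>0 \<or> Z = R_hor X l\<^sub>0")
      case True
      then show ?thesis
        using reduced_ideal_vert[OF x y q\<^sub>0(1-3)] reduced_ideal_hor[OF x y l\<^sub>0(1-3)] gen_eq by auto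
    next
      case False
      then have g: "gen Z = (\<lambda>_. 1)" unfolding gen_def by auto
      have "(\<lambda>_. 1) \<in> ?I Z"
        using set_mset_fibre_divisor[OF A(1) B(1) Z]
      proof
        assume "\<exists>q\<in>A. Z = R_vert Y q"
        then obtain q where q: "q \<in> A" "Z = R_vert Y q" by blast
        then have "x \<notin> q" using A(3)[OF q(1)] False by blast
        then show ?thesis using one_in_reduced_ideal(1)[OF x y] A(2)[OF q(1)] q(2) by blast
      next
        assume "\<exists>l\<in>B. Z = R_hor X l"
        then obtain l where l: "l \<in> B" "Z = R_hor X l" by blast
        then have "y \<notin> l" using B(3)[OF l(1)] False by blast
        then show ?thesis using one_in_reduced_ideal(2)[OF x y] B(2)[OF l(1)] l(2) by blast
      qed
      moreover have "?I Z \<subseteq> ?M (\<lambda>_. 1)"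
        unfolding reduced_ideal_def using germs_multiples_one[OF x y] by auto
      ultimately show ?thesis unfolding g by blast
    qed
    then show "gen Z \<in> ?I Z" "?I Z \<subseteq> ?M (gen Z)" by auto
  qed
  \<comment> \<open>The list Zs is only an enumeration of the multiset; the product of the local
    equations depends on the multiset alone.\<close>
  have prod_gen: "(\<Prod>i<length Zs. gen (Zs ! i) Q) = ?E Q" if "mset Zs = ?D" for Zs Q
  proof -
    have "(\<Prod>i<length Zs. gen (Zs ! i) Q) = prod_list (map (\<lambda>Z. gen Z Q) Zs)"
      by (simp add: prod.list_conv_set_nth atLeast0LessThan)
    also have "\<dots> = prod_mset (image_mset (\<lambda>Z. gen Z Q) ?D)"
      unfolding that[symmetric] by (simp flip: prod_mset_prod_list)
    also have "\<dots> = (\<Prod>q\<in>A. gen (R_vert Y q) Q ^ t q) * (\<Prod>l\<in>B. gen (R_hor X l) Q ^ u l)"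
      unfolding fibre_divisor_def by (simp add: prod_mset_sum_replicate A(1) B(1))
    also have "(\<Prod>q\<in>A. gen (R_vert Y q) Q ^ t q) = (\<Prod>q\<in>A. if q = q\<^sub>0 then ?zx Q ^ t q\<^sub>0 else 1)"
    proof (rule prod.cong[OF refl])
      fix q assume "q \<in> A"
      then have "R_vert Y q \<noteq> R_hor X l\<^sub>0" using vert_hor[of q l\<^sub>0] A(2) l\<^sub>0(3) by blast
      then show "gen (R_vert Y q) Q ^ t q = (if q = q\<^sub>0 then ?zx Q ^ t q\<^sub>0 else 1)"
        using vert_inj[of q q\<^sub>0] unfolding gen_def by simp
    qed
    \<comment> \<open>If \<open>q\<^sub>0\<close> is not in A the product is 1, and so is the right
      side, because the exponent is then 0.\<close>
    also have "\<dots> = ?zx Q ^ t q\<^sub>0" using A(1) q\<^sub>0(4) by (auto simp: prod.delta)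
    also have "(\<Prod>l\<in>B. gen (R_hor X l) Q ^ u l) = (\<Prod>l\<in>B. if l = l\<^sub>0 then ?zy Q ^ u l\<^sub>0 else 1)"
    proof (rule prod.cong[OF refl])
      fix l
      have "R_hor X l \<noteq> R_vert Y q\<^sub>0" using vert_hor[of q\<^sub>0 l] q\<^sub>0(1,3) by blast
      then show "gen (R_hor X l) Q ^ u l = (if l = l\<^sub>0 then ?zy Q ^ u l\<^sub>0 else 1)"
        using hor_inj[of l l\<^sub>0] unfolding gen_def by simp
    qed
    also have "\<dots> = ?zy Q ^ u l\<^sub>0" using B(1) l\<^sub>0(4) by (auto simp: prod.delta)
    finally show ?thesis unfolding monomial_def[OF x y] .
  qed
  let ?S = "{\<lambda>Q. \<Prod>i<length Zs. s i Q | Zs s. mset Zs = ?D \<and> (\<forall>i<length Zs. s i \<in> ?I (Zs ! i))}"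
  have mem: "Zs ! i \<in># ?D" if "mset Zs = ?D" "i < length Zs" for Zs i
    using that nth_mem_mset[of i Zs] by simp
  have "germ_ideal X Y (x, y) ?S = hol_germs X Y (x, y) \<inter> ?M ?E"
  proof (rule germ_ideal_principal[OF x y])
    show "?S \<subseteq> ?M ?E"
    proof
      fix f assume "f \<in> ?S"
      then obtain Zs s where f: "f = (\<lambda>Q. \<Prod>i<length Zs. s i Q)" "mset Zs = ?D" "\<forall>i<length Zs. s i \<in> ?I (Zs ! i)"
        by blast
      have "(\<lambda>Q. \<Prod>i<length Zs. s i Q) \<in> ?M (\<lambda>Q. \<Prod>i<length Zs. gen (Zs ! i) Q)"
        by (rule multiples_prod[OF x y]) (use f(3) I_gen mem[OF f(2)] in auto)
      then show "f \<in> ?M ?E" unfolding f(1) prod_gen[OF f(2)] .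
    qed
    obtain Zs where Zs: "mset Zs = ?D" using ex_mset by blast
    have "(\<lambda>Q. \<Prod>i<length Zs. gen (Zs ! i) Q) \<in> ?S"
      by (intro CollectI exI[of _ Zs] exI[of _ "\<lambda>i. gen (Zs ! i)"] conjI refl Zs allI impI gen_I mem[OF Zs])
    moreover have "?E \<in> ?M ?E"
      by (rule multiplesI[OF x y germs_const[OF x y, of 1]]) simp
    ultimately show "\<exists>s\<in>?S. ?E \<in> ?M s" unfolding prod_gen[OF Zs] by blast
  qed
  then show ?thesis unfolding divisor_scheme_def using x y by simp
qed

end

end

section \<open>Characters, invariance and minimal orders\<close>

lemma degree_one_character_norm:
  assumes "group G" "finite (carrier G)" "degree_one_character G chi" "g \<in> carrier G"
  shows "norm (chi g) = 1"
proof -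
  interpret group G by fact
  have n: "card (carrier G) > 0" using assms(2) one_closed card_gt_0_iff by blast
  have "bij_betw (\<lambda>h. g \<otimes>\<^bsub>G\<^esub> h) (carrier G) (carrier G)"
    by (rule bij_betw_byWitness[where f' = "\<lambda>h. inv\<^bsub>G\<^esub> g \<otimes>\<^bsub>G\<^esub> h"])
      (use assms(4) in \<open>auto simp: m_assoc[symmetric]\<close>)
  \<comment> \<open>Translating the product of all values by g shows that \<open>chi g\<close> is a
    root of unity.\<close>
  then have "(\<Prod>h\<in>carrier G. chi h) = (\<Prod>h\<in>carrier G. chi (g \<otimes>\<^bsub>G\<^esub> h))"
    by (simp add: prod.reindex_bij_betw)
  also have "\<dots> = chi g ^ card (carrier G) * (\<Prod>h\<in>carrier G. chi h)"
    using assms(3,4) unfolding degree_one_character_def by (simp add: prod.distrib)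
  finally have one: "chi g ^ card (carrier G) = 1"
    using assms(2,3) unfolding degree_one_character_def by (simp add: prod_zero_iff)
  show ?thesis using power_eq_1_iff[OF one] n by simp
qed

lemma degree_one_character_cnj:
  "degree_one_character G chi \<Longrightarrow> degree_one_character G (\<lambda>g. cnj (chi g))"
  unfolding degree_one_character_def by simp

lemma pullback2_ext_wedge:
  "pullback2 X Y f g (ext_wedge \<omega>\<^sub>1 \<omega>\<^sub>2) = ext_wedge (pullback X X f \<omega>\<^sub>1) (pullback Y Y g \<omega>\<^sub>2)"
  by (auto simp: pullback2_def ext_wedge_def pullback_def fun_eq_iff)

text \<open>Reduces invariance on the tensor product to its spanning wedges.\<close>

lemma subspace_pullback2_fixed: "cfun.subspace {\<eta>. pullback2 X Y f g \<eta> = \<eta>}"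
proof (rule cfun.subspaceI)
  have add: "pullback2 X Y f g (\<eta> + \<theta>) = pullback2 X Y f g \<eta> + pullback2 X Y f g \<theta>"
    and scale: "pullback2 X Y f g (\<lambda>i. k * \<eta> i) = (\<lambda>i. k * pullback2 X Y f g \<eta> i)" for \<eta> \<theta> k
    by (auto simp: pullback2_def fun_eq_iff algebra_simps)
  show "0 \<in> {\<eta>. pullback2 X Y f g \<eta> = \<eta>}" by (auto simp: pullback2_def fun_eq_iff)
  show "\<eta> + \<theta> \<in> {\<eta>. pullback2 X Y f g \<eta> = \<eta>}"
    if "\<eta> \<in> {\<eta>. pullback2 X Y f g \<eta> = \<eta>}" "\<theta> \<in> {\<eta>. pullback2 X Y f g \<eta> = \<eta>}" for \<eta> \<theta>
    using that add by simp
  show "(\<lambda>i. k * \<eta> i) \<in> {\<eta>. pullback2 X Y f g \<eta> = \<eta>}" if "\<eta> \<in> {\<eta>. pullback2 X Y f g \<eta> = \<eta>}" for k \<eta>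
    using that scale by simp
qed

text \<open>n + 1 and t + 1 both lie in 1, ..., m, a full set of residues modulo m.\<close>

lemma root_of_unity_exponent_unique:
  assumes "n < m" "t < m" and "exp (2 * of_real pi * \<i> / of_nat m) ^ (n + 1) = exp (2 * of_real pi * \<i> / of_nat m) ^ (t + 1)"
  shows "n = t"
proof -
  have m: "1 \<le> m" using assms by simp
  have "exp (2 * of_real pi * \<i> * of_nat (n + 1) / of_nat m) = exp (2 * of_real pi * \<i> * of_nat (t + 1) / of_nat m)"
    using assms(3) unfolding exp_of_nat_mult[symmetric] by (simp add: mult_ac)
  then have "(n + 1) mod m = (t + 1) mod m"
    using complex_root_unity_eq[OF m, of "n + 1" "t + 1"] by (simp add: cong_def)
  then show ?thesis using assms(1,2) by (auto simp: mod_Suc split: if_splits)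
qed

context curve_action
begin

text \<open>The minimum in the definition runs over all points of the fibre. An eigenform has the
  same order along an orbit, so the minimum is attained at any prescribed point p.\<close>

lemma min_vanishing_order_attained:
  assumes chi: "degree_one_character G chi" and ne: "eigenforms chi \<noteq> {0}" and p: "p \<in> points X"
  shows "\<exists>\<omega>\<in>eigenforms chi. \<omega> \<noteq> 0 \<and> has_vanishing_order X \<omega> p (min_vanishing_order G \<phi> X chi (quot p))"
    and "\<And>\<omega> n. \<omega> \<in> eigenforms chi \<Longrightarrow> \<omega> \<noteq> 0 \<Longrightarrow> has_vanishing_order X \<omega> p n \<Longrightarrow>
      min_vanishing_order G \<phi> X chi (quot p) \<le> n"
proof -
  let ?P = "\<lambda>n. \<exists>\<omega>\<in>eigenforms chi - {0}. \<exists>x\<in>quot p. has_vanishing_order X \<omega> x n"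
  have t: "min_vanishing_order G \<phi> X chi (quot p) = (LEAST n. ?P n)"
    unfolding min_vanishing_order_def H10_isotypic_eq_eigenforms[OF chi] ..
  show "min_vanishing_order G \<phi> X chi (quot p) \<le> n"
    if "\<omega> \<in> eigenforms chi" "\<omega> \<noteq> 0" "has_vanishing_order X \<omega> p n" for \<omega> n
    unfolding t by (rule Least_le) (use that orbit_refl[OF p] in blast)
  obtain \<omega> where \<omega>: "\<omega> \<in> eigenforms chi" "\<omega> \<noteq> 0"
    using ne cfun.subspace_0[OF subspace_eigenforms] by blast
  have H: "\<omega> \<in> H10 X" using \<omega> unfolding eigenforms_def by blast
  obtain c where c: "c \<in> atlas X" "p \<in> fst c" using atlas_cover[OF p] by blast
  \<comment> \<open>A nonzero eigenform has some order at p, so \<open>LEAST\<close> is taken over a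
    nonempty set.\<close>
  obtain n where "has_vanishing_order X \<omega> p n"
    using form_vanishing_order_exists[OF H \<omega>(2) c] has_vanishing_order_iff[OF H \<omega>(2) c] by metis
  then have "?P n" using \<omega> orbit_refl[OF p] by blast
  from LeastI[of ?P, OF this] obtain \<eta> x where \<eta>: "\<eta> \<in> eigenforms chi" "\<eta> \<noteq> 0" "x \<in> quot p"
    "has_vanishing_order X \<eta> x (min_vanishing_order G \<phi> X chi (quot p))"
    unfolding t by blast
  obtain g where "g \<in> carrier G" "x = \<phi> g p" using \<eta>(3) unfolding orbit_def by blast
  then have "has_vanishing_order X \<eta> p (min_vanishing_order G \<phi> X chi (quot p))"
    using eigenform_order_orbit[OF chi \<eta>(1,2) _ p] \<eta>(4) by blast
  then show "\<exists>\<omega>\<in>eigenforms chi. \<omega> \<noteq> 0 \<and> has_vanishing_order X \<omega> p (min_vanishing_order G \<phi> X chi (quot p))"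
    using \<eta> by blast
qed

text \<open>A fibre of positive minimal order lies in the zero set of any one nonzero eigenform,
  which is finite by compactness.\<close>

lemma finite_base_fibres:
  assumes chi: "degree_one_character G chi" and ne: "eigenforms chi \<noteq> {0}"
  shows "finite {q \<in> orbits G (points X) \<phi>. min_vanishing_order G \<phi> X chi q \<noteq> 0}"
proof -
  obtain \<omega> where \<omega>: "\<omega> \<in> eigenforms chi" "\<omega> \<noteq> 0"
    using ne cfun.subspace_0[OF subspace_eigenforms] by blast
  have H: "\<omega> \<in> H10 X" using \<omega> unfolding eigenforms_def by blast
  let ?Z = "{x \<in> points X. \<exists>c\<in>atlas X. x \<in> fst c \<and> \<omega> (c, x) = 0}"
  have "{q \<in> orbits G (points X) \<phi>. min_vanishing_order G \<phi> X chi q \<noteq> 0} \<subseteq> quot ` ?Z"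
  proof
    fix q assume "q \<in> {q \<in> orbits G (points X) \<phi>. min_vanishing_order G \<phi> X chi q \<noteq> 0}"
    then obtain p where p: "p \<in> points X" "q = quot p" "min_vanishing_order G \<phi> X chi (quot p) \<noteq> 0"
      unfolding orbits_def by blast
    obtain c where c: "c \<in> atlas X" "p \<in> fst c" using atlas_cover[OF p(1)] by blast
    have "\<not> has_vanishing_order X \<omega> p 0"
      using min_vanishing_order_attained(2)[OF chi ne p(1) \<omega>] p(3) by fastforce
    then have "\<not> vanishes_to (\<lambda>z. \<omega> (c, chart_inv c z)) (snd c p) 0"
      using has_vanishing_order_iff[OF H \<omega>(2) c] by blast
    then have "\<omega> (c, p) = 0"
      using vanishes_to_0_iff[OF H10_analytic[OF H c]] chart_inv_left[OF atlas_chart[OF c(1)] c(2)] by simp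
    then show "q \<in> quot ` ?Z" using p c by blast
  qed
  moreover have "finite ?Z"
    by (rule compact_space_discrete_finite[OF compact]) (rule form_zeros_isolated[OF H \<omega>(2)])
  ultimately show ?thesis using finite_subset finite_imageI by blast
qed

lemma min_vanishing_order_monodromy:
  assumes chi: "degree_one_character G chi" and ne: "eigenforms chi \<noteq> {0}" and p: "p \<in> points X"
  shows "chi (local_monodromy G \<phi> X p) *
     exp (2 * of_real pi * \<i> / of_nat (card (Stab p))) ^ (min_vanishing_order G \<phi> X chi (quot p) + 1) = 1"
  using min_vanishing_order_attained(1)[OF chi ne p] character_multiplier[OF chi _ _ p local_monodromy(1)[OF p]]
  unfolding local_monodromy(2)[OF p] by blast

lemma min_vanishing_order_less:
  assumes bih: "biholomorphic (quotient_surface G \<phi> X) projective_line"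
    and chi: "degree_one_character G chi" and ne: "eigenforms chi \<noteq> {0}" and p: "p \<in> points X"
  shows "min_vanishing_order G \<phi> X chi (quot p) < card (Stab p)"
proof (rule ccontr)
  assume "\<not> ?thesis"
  then have t: "card (Stab p) \<le> min_vanishing_order G \<phi> X chi (quot p)" by simp
  obtain f g where f: "holomorphic_map (quotient_surface G \<phi> X) projective_line f"
    "\<forall>x\<in>points (quotient_surface G \<phi> X). g (f x) = x"
    using bih unfolding biholomorphic_def by blast
  have inj: "inj_on f (orbits G (points X) \<phi>)"
    by (rule inj_on_inverseI[of _ g]) (use f(2) quotient_points in simp)
  obtain \<omega> where \<omega>: "\<omega> \<in> eigenforms chi" "\<omega> \<noteq> 0"
    "has_vanishing_order X \<omega> p (min_vanishing_order G \<phi> X chi (quot p))"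
    using min_vanishing_order_attained(1)[OF chi ne p] by blast
  obtain \<eta> where \<eta>: "\<eta> \<in> eigenforms chi" "\<eta> \<noteq> 0"
    "has_vanishing_order X \<eta> p (min_vanishing_order G \<phi> X chi (quot p) - card (Stab p))"
    using lower_order[OF f(1) inj chi \<omega>(1,2) p \<omega>(3) t] by blast
  have "card (Stab p) > 0" using finite_stab stabilizer_one_closed[OF p] card_gt_0_iff by blast
  then show False using min_vanishing_order_attained(2)[OF chi ne p \<eta>] t by linarith
qed

lemma min_vanishing_order_characterisation:
  assumes bih: "biholomorphic (quotient_surface G \<phi> X) projective_line"
    and chi: "degree_one_character G chi" and ne: "eigenforms chi \<noteq> {0}" and p: "p \<in> points X"
  shows "n \<le> card (Stab p) - 1 \<and>
      chi (local_monodromy G \<phi> X p) * exp (2 * of_real pi * \<i> / of_nat (card (Stab p))) ^ (n + 1) = 1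
    \<longleftrightarrow> n = min_vanishing_order G \<phi> X chi (quot p)"
proof -
  let ?h = "local_monodromy G \<phi> X p" and ?t = "min_vanishing_order G \<phi> X chi (quot p)"
  have less: "?t < card (Stab p)" by (rule min_vanishing_order_less[OF assms])
  note t = min_vanishing_order_monodromy[OF chi ne p]
  show ?thesis
  proof
    assume n: "n \<le> card (Stab p) - 1 \<and> chi ?h * exp (2 * of_real pi * \<i> / of_nat (card (Stab p))) ^ (n + 1) = 1"
    have "chi ?h \<noteq> 0" using t by auto
    then show "n = ?t" using root_of_unity_exponent_unique[of n "card (Stab p)" ?t] n t less
      by (metis Suc_pred' less_Suc_eq_le mult_left_cancel not_less_zero gr0I)
  qed (use t less in auto)
qed

end

text \<open>The exponents m - n - 1 and n + 1 add up to m. The subtraction takes place in the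
  complex numbers, so nothing is truncated.\<close>

lemma exp_complementary_exponent:
  assumes "m > 0"
  shows "w = exp (2 * of_real pi * \<i> / of_nat m * (of_nat m - of_nat n - 1)) \<longleftrightarrow>
     w * exp (2 * of_real pi * \<i> / of_nat m) ^ (n + 1) = 1"
proof -
  have "2 * of_real pi * \<i> / of_nat m * (of_nat m - of_nat n - 1) + of_nat (n + 1) * (2 * of_real pi * \<i> / of_nat m) =
      (2 * of_real pi * \<i> :: complex)"
    using assms by (simp add: field_simps)
  then have "exp (2 * of_real pi * \<i> / of_nat m * (of_nat m - of_nat n - 1)) *
      exp (2 * of_real pi * \<i> / of_nat m) ^ (n + 1) = (1 :: complex)"
    unfolding exp_of_nat_mult[symmetric] exp_add[symmetric] by simp
  then show ?thesis by (metis mult_right_cancel power_not_zero exp_not_eq_zero)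
qed

text \<open>On the unit circle conjugation is inversion, which turns the relation for the conjugate
  character into a formula for the character itself.\<close>

lemma exp_conjugate_exponent:
  assumes "norm w = 1"
  shows "w = exp (2 * of_real pi * \<i> / of_nat m * (of_nat n + 1)) \<longleftrightarrow>
     cnj w * exp (2 * of_real pi * \<i> / of_nat m) ^ (n + 1) = 1"
proof -
  have "exp (2 * of_real pi * \<i> / of_nat m) ^ (n + 1) = (exp (2 * of_real pi * \<i> / of_nat m * (of_nat n + 1)) :: complex)"
    unfolding exp_of_nat_mult[symmetric] by (simp add: mult.commute add.commute)
  moreover have w: "w * cnj w = 1" using assms complex_norm_square[of w] by simp
  have "w = E \<longleftrightarrow> cnj w * E = 1" for E
  proof
    assume "cnj w * E = 1"
    then have "w * (cnj w * E) = w" by simp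
    then show "w = E" unfolding mult.assoc[symmetric] w by simp
  qed (use w in \<open>simp add: mult.commute\<close>)
  ultimately show ?thesis by simp
qed

text \<open>The index sets are left free, as long as they are finite and contain every fibre of
  positive minimal order; both divisor formulas of the theorem are instances.\<close>

lemma base_scheme_isotypic:
  assumes X: "curve_action X G \<phi>" and Y: "curve_action Y G \<psi>"
    and chi: "degree_one_character G \<chi>\<^sub>1" "degree_one_character G \<chi>\<^sub>2"
    and V: "H10_isotypic G \<phi> X \<chi>\<^sub>1 \<noteq> {0}" "H10_isotypic G \<psi> Y \<chi>\<^sub>2 \<noteq> {0}"
    and A: "finite A" "A \<subseteq> orbits G (points X) \<phi>"
      "\<And>q. q \<in> orbits G (points X) \<phi> \<Longrightarrow> q \<notin> A \<Longrightarrow> min_vanishing_order G \<phi> X \<chi>\<^sub>1 q = 0"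
    and B: "finite B" "B \<subseteq> orbits G (points Y) \<psi>"
      "\<And>l. l \<in> orbits G (points Y) \<psi> \<Longrightarrow> l \<notin> B \<Longrightarrow> min_vanishing_order G \<psi> Y \<chi>\<^sub>2 l = 0"
  shows "base_scheme X Y (tensor_forms (H10_isotypic G \<phi> X \<chi>\<^sub>1) (H10_isotypic G \<psi> Y \<chi>\<^sub>2)) =
    divisor_scheme X Y (fibre_divisor X Y A (min_vanishing_order G \<phi> X \<chi>\<^sub>1) B (min_vanishing_order G \<psi> Y \<chi>\<^sub>2))"
proof -
  interpret A: curve_action X G \<phi> by fact
  interpret B: curve_action Y G \<psi> by fact
  interpret P: riemann_surface_pair X Y by unfold_locales
  note V1 = A.H10_isotypic_eq_eigenforms[OF chi(1)] and V2 = B.H10_isotypic_eq_eigenforms[OF chi(2)]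
  let ?b = "base_scheme X Y (tensor_forms (H10_isotypic G \<phi> X \<chi>\<^sub>1) (H10_isotypic G \<psi> Y \<chi>\<^sub>2))"
  let ?t = "min_vanishing_order G \<phi> X \<chi>\<^sub>1" and ?u = "min_vanishing_order G \<psi> Y \<chi>\<^sub>2"
  have ne: "A.eigenforms \<chi>\<^sub>1 \<noteq> {0}" "B.eigenforms \<chi>\<^sub>2 \<noteq> {0}" using V V1 V2 by simp_all
  have "?b (x, y) = divisor_scheme X Y (fibre_divisor X Y A ?t B ?u) (x, y)"
    if x: "x \<in> points X" and y: "y \<in> points Y" for x y
  proof -
    have memA: "x \<in> q \<longleftrightarrow> q = orbit G \<phi> x" if "q \<in> A" for q
      using that A(2) x A.quot_eq_of_mem A.orbit_refl unfolding orbits_def by blast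
    have memB: "y \<in> l \<longleftrightarrow> l = orbit G \<psi> y" if "l \<in> B" for l
      using that B(2) y B.quot_eq_of_mem B.orbit_refl unfolding orbits_def by blast
    have finA: "finite q \<and> q \<subseteq> points X" if "q \<in> orbits G (points X) \<phi>" for q
      using that A.finite_orbit A.quot_eq_of_mem unfolding orbits_def by blast
    have finB: "finite l \<and> l \<subseteq> points Y" if "l \<in> orbits G (points Y) \<psi>" for l
      using that B.finite_orbit B.quot_eq_of_mem unfolding orbits_def by blast
    have o: "orbit G \<phi> x \<in> orbits G (points X) \<phi>" "orbit G \<psi> y \<in> orbits G (points Y) \<psi>"
      using x y unfolding orbits_def by blast+
    have "?b (x, y) = hol_germs X Y (x, y) \<inter> P.multiples x y (P.monomial x y (?t (orbit G \<phi> x)) (?u (orbit G \<psi> y)))"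
      unfolding V1 V2
    proof (rule P.base_scheme_stalk[OF x y])
      show "A.eigenforms \<chi>\<^sub>1 \<subseteq> H10 X" "B.eigenforms \<chi>\<^sub>2 \<subseteq> H10 Y"
        unfolding A.eigenforms_def B.eigenforms_def by auto
    qed (use A.min_vanishing_order_attained[OF chi(1) ne(1) x] B.min_vanishing_order_attained[OF chi(2) ne(2) y] in blast)+
    also have "\<dots> = divisor_scheme X Y (fibre_divisor X Y A ?t B ?u) (x, y)"
    proof (rule P.divisor_scheme_stalk[OF x y, symmetric])
      show "orbit G \<phi> x \<in> A \<or> ?t (orbit G \<phi> x) = 0" by (rule disjCI) (rule ccontr, use A(3)[OF o(1)] in simp)
      show "orbit G \<psi> y \<in> B \<or> ?u (orbit G \<psi> y) = 0" by (rule disjCI) (rule ccontr, use B(3)[OF o(2)] in simp)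
    qed (use A(1,2) B(1,2) memA memB finA finB o A.orbit_refl[OF x] B.orbit_refl[OF y] in \<open>auto simp: subset_iff\<close>)
    finally show ?thesis .
  qed
  \<comment> \<open>Both families of stalks are restricted to pairs of points and take the same
    default value elsewhere, so agreement at these pairs is equality.\<close>
  then show ?thesis
    by (intro ext) (auto simp: base_scheme_def divisor_scheme_def restrict_def)
qed

theorem corollary4p23:
  fixes G :: "('g, 'm) monoid_scheme"
    and C\<^sub>1 :: "'a surface" and C\<^sub>2 :: "'b surface"
    and \<phi>\<^sub>1 :: "'g \<Rightarrow> 'a \<Rightarrow> 'a" and \<phi>\<^sub>2 :: "'g \<Rightarrow> 'b \<Rightarrow> 'b"
    and chi :: "'g \<Rightarrow> complex"
  assumes "group G" and "finite (carrier G)"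
    and "smooth_projective_curve C\<^sub>1" and "genus C\<^sub>1 \<ge> 2" and "acts_faithfully_on G \<phi>\<^sub>1 C\<^sub>1"
    and "smooth_projective_curve C\<^sub>2" and "genus C\<^sub>2 \<ge> 2" and "acts_faithfully_on G \<phi>\<^sub>2 C\<^sub>2"
    and "degree_one_character G chi"
  shows
    "let chibar = (\<lambda>g. cnj (chi g));
         V\<^sub>1 = H10_isotypic G \<phi>\<^sub>1 C\<^sub>1 chi;
         V\<^sub>2 = H10_isotypic G \<phi>\<^sub>2 C\<^sub>2 chibar;
         V = tensor_forms V\<^sub>1 V\<^sub>2;
         VG = diagonal_invariants G \<phi>\<^sub>1 \<phi>\<^sub>2 C\<^sub>1 C\<^sub>2 V;
         t = min_vanishing_order G \<phi>\<^sub>1 C\<^sub>1 chi;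
         u = min_vanishing_order G \<phi>\<^sub>2 C\<^sub>2 chibar;
         Q\<^sub>1 = quotient_surface G \<phi>\<^sub>1 C\<^sub>1;
         Q\<^sub>2 = quotient_surface G \<phi>\<^sub>2 C\<^sub>2;
         B\<^sub>1 = {q \<in> points Q\<^sub>1. t q \<noteq> 0};
         B\<^sub>2 = {l \<in> points Q\<^sub>2. u l \<noteq> 0}
     in VG = V \<and>
        (V\<^sub>1 \<noteq> {0} \<and> V\<^sub>2 \<noteq> {0} \<longrightarrow>
           finite B\<^sub>1 \<and> finite B\<^sub>2 \<and>
           base_scheme C\<^sub>1 C\<^sub>2 VG = divisor_scheme C\<^sub>1 C\<^sub>2
             (fibre_divisor C\<^sub>1 C\<^sub>2 (Crit G \<phi>\<^sub>1 C\<^sub>1 \<union> B\<^sub>1) t (Crit G \<phi>\<^sub>2 C\<^sub>2 \<union> B\<^sub>2) u)) \<and>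
        finite (Crit G \<phi>\<^sub>1 C\<^sub>1) \<and> finite (Crit G \<phi>\<^sub>2 C\<^sub>2) \<and>
        (biholomorphic Q\<^sub>1 projective_line \<and> biholomorphic Q\<^sub>2 projective_line \<longrightarrow>
           (V\<^sub>1 \<noteq> {0} \<and> V\<^sub>2 \<noteq> {0} \<longrightarrow>
              base_scheme C\<^sub>1 C\<^sub>2 VG = divisor_scheme C\<^sub>1 C\<^sub>2
                (fibre_divisor C\<^sub>1 C\<^sub>2 (Crit G \<phi>\<^sub>1 C\<^sub>1) t (Crit G \<phi>\<^sub>2 C\<^sub>2) u)) \<and>
           (V\<^sub>1 \<noteq> {0} \<longrightarrow>
              (\<forall>q \<in> Crit G \<phi>\<^sub>1 C\<^sub>1. \<forall>p \<in> q. \<forall>n::nat.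
                 (let m = stabilizer_order G \<phi>\<^sub>1 q; h = local_monodromy G \<phi>\<^sub>1 C\<^sub>1 p in
                    n \<le> m - 1 \<and>
                    chi h = exp (2 * of_real pi * \<i> / of_nat m * (of_nat m - of_nat n - 1)))
                 \<longleftrightarrow> n = t q)) \<and>
           (V\<^sub>2 \<noteq> {0} \<longrightarrow>
              (\<forall>l \<in> Crit G \<phi>\<^sub>2 C\<^sub>2. \<forall>p \<in> l. \<forall>n::nat.
                 (let m = stabilizer_order G \<phi>\<^sub>2 l; g = local_monodromy G \<phi>\<^sub>2 C\<^sub>2 p in
                    n \<le> m - 1 \<and>
                    chi g = exp (2 * of_real pi * \<i> / of_nat m * (of_nat n + 1)))
                 \<longleftrightarrow> n = u l)))"
proof -
  define chibar where "chibar = (\<lambda>g. cnj (chi g))"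
  interpret A: curve_action C\<^sub>1 G \<phi>\<^sub>1
    using assms unfolding smooth_projective_curve_def
    by (intro curve_action.intro riemann_surface_on.intro curve_action_axioms.intro) simp_all
  interpret B: curve_action C\<^sub>2 G \<phi>\<^sub>2
    using assms unfolding smooth_projective_curve_def
    by (intro curve_action.intro riemann_surface_on.intro curve_action_axioms.intro) simp_all
  note chi = \<open>degree_one_character G chi\<close>
  have chibar: "degree_one_character G chibar"
    unfolding chibar_def by (rule degree_one_character_cnj[OF chi])
  have norm: "norm (chi g) = 1" if "g \<in> carrier G" for g
    by (rule degree_one_character_norm[OF assms(1,2) chi that])
  define V\<^sub>1 where "V\<^sub>1 = H10_isotypic G \<phi>\<^sub>1 C\<^sub>1 chi"
  define V\<^sub>2 where "V\<^sub>2 = H10_isotypic G \<phi>\<^sub>2 C\<^sub>2 chibar"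
  define t where "t = min_vanishing_order G \<phi>\<^sub>1 C\<^sub>1 chi"
  define u where "u = min_vanishing_order G \<phi>\<^sub>2 C\<^sub>2 chibar"
  have V1: "V\<^sub>1 = A.eigenforms chi" and V2: "V\<^sub>2 = B.eigenforms chibar"
    unfolding V\<^sub>1_def V\<^sub>2_def by (rule A.H10_isotypic_eq_eigenforms[OF chi], rule B.H10_isotypic_eq_eigenforms[OF chibar])
  let ?V = "tensor_forms V\<^sub>1 V\<^sub>2"
  let ?VG = "diagonal_invariants G \<phi>\<^sub>1 \<phi>\<^sub>2 C\<^sub>1 C\<^sub>2 ?V"
  let ?Q\<^sub>1 = "quotient_surface G \<phi>\<^sub>1 C\<^sub>1" and ?Q\<^sub>2 = "quotient_surface G \<phi>\<^sub>2 C\<^sub>2"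
  let ?B\<^sub>1 = "{q \<in> points ?Q\<^sub>1. t q \<noteq> 0}" and ?B\<^sub>2 = "{l \<in> points ?Q\<^sub>2. u l \<noteq> 0}"
  have VG: "?VG = ?V"
  proof -
    have "pullback2 C\<^sub>1 C\<^sub>2 (\<phi>\<^sub>1 (inv\<^bsub>G\<^esub> g)) (\<phi>\<^sub>2 (inv\<^bsub>G\<^esub> g)) \<eta> = \<eta>" if g: "g \<in> carrier G" and \<eta>: "\<eta> \<in> ?V" for g \<eta>
      using \<eta> unfolding tensor_forms_def
    proof (induction rule: cfun.span_induct)
      case base
      show ?case by (rule subspace_pullback2_fixed)
    next
      case (step \<eta>)
      then obtain \<omega>\<^sub>1 \<omega>\<^sub>2 where \<omega>: "\<eta> = ext_wedge \<omega>\<^sub>1 \<omega>\<^sub>2" "\<omega>\<^sub>1 \<in> V\<^sub>1" "\<omega>\<^sub>2 \<in> V\<^sub>2" by blast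
      have 1: "pullback C\<^sub>1 C\<^sub>1 (\<phi>\<^sub>1 (inv\<^bsub>G\<^esub> g)) \<omega>\<^sub>1 = (\<lambda>i. chi g * \<omega>\<^sub>1 i)"
        using \<omega>(2) g unfolding V1 A.eigenforms_def canonical_representation_def by blast
      have 2: "pullback C\<^sub>2 C\<^sub>2 (\<phi>\<^sub>2 (inv\<^bsub>G\<^esub> g)) \<omega>\<^sub>2 = (\<lambda>i. cnj (chi g) * \<omega>\<^sub>2 i)"
        using \<omega>(3) g unfolding V2 B.eigenforms_def canonical_representation_def chibar_def by blast
      have "chi g * cnj (chi g) = 1" using norm[OF g] complex_norm_square[of "chi g"] by simp
      then have scale: "(chi g * a) * (cnj (chi g) * b) = a * b" for a b
        by (metis mult.assoc mult.left_commute mult.left_neutral)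
      show ?case
        unfolding \<omega>(1) pullback2_ext_wedge 1 2 by (simp only: ext_wedge_def scale)
    qed
    then show ?thesis unfolding diagonal_invariants_def by blast
  qed
  have fin: "finite ?B\<^sub>1" if "V\<^sub>1 \<noteq> {0}"
    using A.finite_base_fibres[OF chi] that unfolding V1 A.quotient_points t_def by simp
  have fin': "finite ?B\<^sub>2" if "V\<^sub>2 \<noteq> {0}"
    using B.finite_base_fibres[OF chibar] that unfolding V2 B.quotient_points u_def by simp
  \<comment> \<open>Used once with the branch points joined with the fibres of positive order, and
    once with the branch points alone.\<close>
  have base: "base_scheme C\<^sub>1 C\<^sub>2 ?VG = divisor_scheme C\<^sub>1 C\<^sub>2 (fibre_divisor C\<^sub>1 C\<^sub>2 A t B u)"
    if "V\<^sub>1 \<noteq> {0}" "V\<^sub>2 \<noteq> {0}" "finite A" "A \<subseteq> points ?Q\<^sub>1" "?B\<^sub>1 \<subseteq> A" "finite B" "B \<subseteq> points ?Q\<^sub>2" "?B\<^sub>2 \<subseteq> B" for A B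
    unfolding VG unfolding V\<^sub>1_def V\<^sub>2_def t_def u_def
    by (rule base_scheme_isotypic[OF A.curve_action_axioms B.curve_action_axioms chi chibar])
      (use that in \<open>auto simp: V\<^sub>1_def V\<^sub>2_def t_def u_def A.quotient_points B.quotient_points\<close>)
  have crit: "Crit G \<phi>\<^sub>1 C\<^sub>1 \<subseteq> points ?Q\<^sub>1" "Crit G \<phi>\<^sub>2 C\<^sub>2 \<subseteq> points ?Q\<^sub>2"
    using A.Crit_subset B.Crit_subset unfolding A.quotient_points B.quotient_points by blast+
  \<comment> \<open>A positive minimal order below m forces m to be at least 2, so the fibre lies
    over a branch point.\<close>
  have rational: "?B\<^sub>1 \<subseteq> Crit G \<phi>\<^sub>1 C\<^sub>1" if "biholomorphic ?Q\<^sub>1 projective_line" "V\<^sub>1 \<noteq> {0}"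
  proof
    fix q assume "q \<in> ?B\<^sub>1"
    then obtain p where p: "p \<in> points C\<^sub>1" "q = orbit G \<phi>\<^sub>1 p" "t q \<noteq> 0"
      unfolding A.quotient_points orbits_def by blast
    then have "card (A.Stab p) \<noteq> 1"
      using A.min_vanishing_order_less[OF that(1) chi _ p(1)] that(2) unfolding V1 t_def by simp
    then show "q \<in> Crit G \<phi>\<^sub>1 C\<^sub>1" using A.not_Crit_imp_trivial_stab[OF p(1)] p(2) by blast
  qed
  have rational': "?B\<^sub>2 \<subseteq> Crit G \<phi>\<^sub>2 C\<^sub>2" if "biholomorphic ?Q\<^sub>2 projective_line" "V\<^sub>2 \<noteq> {0}"
  proof
    fix q assume "q \<in> ?B\<^sub>2"
    then obtain p where p: "p \<in> points C\<^sub>2" "q = orbit G \<phi>\<^sub>2 p" "u q \<noteq> 0"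
      unfolding B.quotient_points orbits_def by blast
    then have "card (B.Stab p) \<noteq> 1"
      using B.min_vanishing_order_less[OF that(1) chibar _ p(1)] that(2) unfolding V2 u_def by simp
    then show "q \<in> Crit G \<phi>\<^sub>2 C\<^sub>2" using B.not_Crit_imp_trivial_stab[OF p(1)] p(2) by blast
  qed
  have order: "(let m = stabilizer_order G \<phi>\<^sub>1 q; h = local_monodromy G \<phi>\<^sub>1 C\<^sub>1 p in n \<le> m - 1 \<and>
        chi h = exp (2 * of_real pi * \<i> / of_nat m * (of_nat m - of_nat n - 1))) \<longleftrightarrow> n = t q"
    if a: "biholomorphic ?Q\<^sub>1 projective_line" "V\<^sub>1 \<noteq> {0}" "q \<in> Crit G \<phi>\<^sub>1 C\<^sub>1" "p \<in> q" for q p n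
  proof -
    obtain x where x: "x \<in> points C\<^sub>1" "q = orbit G \<phi>\<^sub>1 x"
      using a(3) A.Crit_subset unfolding orbits_def by blast
    have "p \<in> orbit G \<phi>\<^sub>1 x" using a(4) x(2) by simp
    \<comment> \<open>The fibre is rewritten as the orbit of the given p, because the stabilizer
      order, the monodromy and the minimal order are all computed at p.\<close>
    from A.quot_eq_of_mem[OF x(1) this] have p: "p \<in> points C\<^sub>1" "q = orbit G \<phi>\<^sub>1 p" unfolding x(2) by simp_all
    have m: "card (A.Stab p) > 0" using A.finite_stab A.stabilizer_one_closed[OF p(1)] card_gt_0_iff by blast
    show ?thesis
      using A.min_vanishing_order_characterisation[OF a(1) chi _ p(1), of n] a(2)
      unfolding Let_def p(2) A.stabilizer_order[OF p(1)] exp_complementary_exponent[OF m] V1 t_def by simp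
  qed
  have order': "(let m = stabilizer_order G \<phi>\<^sub>2 l; g = local_monodromy G \<phi>\<^sub>2 C\<^sub>2 p in n \<le> m - 1 \<and>
        chi g = exp (2 * of_real pi * \<i> / of_nat m * (of_nat n + 1))) \<longleftrightarrow> n = u l"
    if a: "biholomorphic ?Q\<^sub>2 projective_line" "V\<^sub>2 \<noteq> {0}" "l \<in> Crit G \<phi>\<^sub>2 C\<^sub>2" "p \<in> l" for l p n
  proof -
    obtain x where x: "x \<in> points C\<^sub>2" "l = orbit G \<phi>\<^sub>2 x"
      using a(3) B.Crit_subset unfolding orbits_def by blast
    have "p \<in> orbit G \<phi>\<^sub>2 x" using a(4) x(2) by simp
    from B.quot_eq_of_mem[OF x(1) this] have p: "p \<in> points C\<^sub>2" "l = orbit G \<phi>\<^sub>2 p" unfolding x(2) by simp_all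
    have "norm (chi (local_monodromy G \<phi>\<^sub>2 C\<^sub>2 p)) = 1"
      using norm B.local_monodromy(1)[OF p(1)] B.stab_iff by blast
    note iff = exp_conjugate_exponent[OF this]
    show ?thesis
      using B.min_vanishing_order_characterisation[OF a(1) chibar _ p(1), of n] a(2)
      unfolding Let_def p(2) B.stabilizer_order[OF p(1)] iff V2 u_def chibar_def by simp
  qed
  show ?thesis
    unfolding Let_def chibar_def[symmetric] V\<^sub>1_def[symmetric] V\<^sub>2_def[symmetric] t_def[symmetric] u_def[symmetric]
  proof (intro conjI impI ballI allI)
    show "?VG = ?V" by (rule VG)
    show "finite (Crit G \<phi>\<^sub>1 C\<^sub>1)" "finite (Crit G \<phi>\<^sub>2 C\<^sub>2)" by (rule A.finite_Crit, rule B.finite_Crit)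
  next
    assume V: "V\<^sub>1 \<noteq> {0} \<and> V\<^sub>2 \<noteq> {0}"
    show "finite ?B\<^sub>1" "finite ?B\<^sub>2" using fin fin' V by simp_all
    show "base_scheme C\<^sub>1 C\<^sub>2 ?VG = divisor_scheme C\<^sub>1 C\<^sub>2
        (fibre_divisor C\<^sub>1 C\<^sub>2 (Crit G \<phi>\<^sub>1 C\<^sub>1 \<union> ?B\<^sub>1) t (Crit G \<phi>\<^sub>2 C\<^sub>2 \<union> ?B\<^sub>2) u)"
      using V fin fin' A.finite_Crit B.finite_Crit crit by (intro base) auto
  next
    assume rat: "biholomorphic ?Q\<^sub>1 projective_line \<and> biholomorphic ?Q\<^sub>2 projective_line"
      and V: "V\<^sub>1 \<noteq> {0} \<and> V\<^sub>2 \<noteq> {0}"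
    show "base_scheme C\<^sub>1 C\<^sub>2 ?VG = divisor_scheme C\<^sub>1 C\<^sub>2
        (fibre_divisor C\<^sub>1 C\<^sub>2 (Crit G \<phi>\<^sub>1 C\<^sub>1) t (Crit G \<phi>\<^sub>2 C\<^sub>2) u)"
      using V A.finite_Crit B.finite_Crit crit rational rational' rat by (intro base) simp_all
  next
    fix q p and n :: nat
    assume "biholomorphic ?Q\<^sub>1 projective_line \<and> biholomorphic ?Q\<^sub>2 projective_line"
      "V\<^sub>1 \<noteq> {0}" "q \<in> Crit G \<phi>\<^sub>1 C\<^sub>1" "p \<in> q"
    then show "(n \<le> stabilizer_order G \<phi>\<^sub>1 q - 1 \<and> chi (local_monodromy G \<phi>\<^sub>1 C\<^sub>1 p) =
        exp (2 * of_real pi * \<i> / of_nat (stabilizer_order G \<phi>\<^sub>1 q) *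
          (of_nat (stabilizer_order G \<phi>\<^sub>1 q) - of_nat n - 1))) \<longleftrightarrow> n = t q"
      by (intro order[unfolded Let_def]) simp_all
  next
    fix l p and n :: nat
    assume "biholomorphic ?Q\<^sub>1 projective_line \<and> biholomorphic ?Q\<^sub>2 projective_line"
      "V\<^sub>2 \<noteq> {0}" "l \<in> Crit G \<phi>\<^sub>2 C\<^sub>2" "p \<in> l"
    then show "(n \<le> stabilizer_order G \<phi>\<^sub>2 l - 1 \<and> chi (local_monodromy G \<phi>\<^sub>2 C\<^sub>2 p) =
        exp (2 * of_real pi * \<i> / of_nat (stabilizer_order G \<phi>\<^sub>2 l) * (of_nat n + 1))) \<longleftrightarrow> n = u l"
      by (intro order'[unfolded Let_def]) simp_all
  qed
qed

end
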